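(* Let $\alpha>0$ and let $\boldsymbol\Theta=\{\Theta_j,j\in\mathbb{Z}\}$ be a non negative real-valued random sequence such that $\mathbb{P}(\Theta_0=1)=1$, $\lim_{|j|\to\infty}\Theta_j=0$ almost surely, and which satisfies the time change formula: for all $k\in\mathbb{Z}$ and all non negative measurable $H$ on $\mathbb{R}^{\mathbb{Z}}$, $$\mathbb{E}[H(B^k\boldsymbol\Theta)\mathbf{1}\{\Theta_{-k}\ne0\}]=\mathbb{E}[H(\Theta_k^{-1}\boldsymbol\Theta)\Theta_k^\alpha],$$ where the quantity inside the expectation on the right hand side is understood to be $0$ when $\Theta_k=0$. Define $\vartheta=\mathbb{P}(I(\boldsymbol\Theta)=0)$ and the measure $\nu$ on $\mathbb{R}^{\mathbb{Z}}$ by $$\nu(H)=\sum_{j\in\mathbb{Z}}\int_0^\infty\mathbb{E}\left[H(rB^j\boldsymbol\Theta)\mathbf{1}\{I(\boldsymbol\Theta)=0\}\right]\alpha r^{-\alpha-1}\,\mathrm{d}r .$$ Let $\sum_{i\ge1}\delta_{W^{(i)}}$ be a Poisson point process on $[0,\infty)^{\mathbb{Z}}$ with mean measure $\nu$ and define the max-stable process $\boldsymbol\zeta$ by $\zeta_j=\bigvee_{i\ge1}W^{(i)}_j$, $j\in\mathbb{Z}$. The measure $\nu$ is $\sigma$-finite, $\nu(\{\boldsymbol 0\})=0$, and $\nu$ is homogeneous (with index $-\alpha$) and shift invariant. The max-stable process $\boldsymbol\zeta$ is stationary, has tail measure $\nu$, spectral tail process $\boldsymbol\Theta$, extremal index $\vartheta>0$,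 and it admits the M3 representation $$\{\zeta_j,j\in\mathbb{Z}\}\stackrel{d}{=}\left\{\bigvee_{i\ge1}P_iQ^{(i)}_{j-T_i},\ j\in\mathbb{Z}\right\},$$ where $\sum_{i\ge1}\delta_{(P_i,T_i)}$ is a Poisson point process on $(0,\infty)\times\mathbb{Z}$ whose mean measure is the product of $\alpha x^{-\alpha-1}\,\mathrm{d}x$ and $\vartheta$ times the counting measure on $\mathbb{Z}$, and $\boldsymbol Q^{(i)}$, $i\ge1$, are i.i.d. copies of the sequence $\boldsymbol Q$, independent of this point process.
   Context: Notation: $B$ is the backshift, $(B\boldsymbol x)_j=\boldsymbol x_{j-1}$, and $B^k$, $k\in\mathbb{Z}$, its iterates. For $-\infty\le s\le t\le\infty$, $\boldsymbol y^*_{s,t}=\max_{s\le i\le t}|y_i|$ and $\boldsymbol y^*=\max_{i\in\mathbb{Z}}|y_i|$ (understood as suprema in $[0,\infty]$). The infargmax functional $I$ on $\mathbb{R}^{\mathbb{Z}}$ is: $I(\boldsymbol y)=j\in\mathbb{Z}$ if $\boldsymbol y^*_{-\infty,j-1}<|y_j|$ and $\boldsymbol y^*_{j+1,\infty}\le|y_j|$; $I(\boldsymbol y)=-\infty$ if $\boldsymbol y^*=\boldsymbol y^*_{-\infty,j}$ for all $j$; $I(\boldsymbol y)=+\infty$ if $\boldsymbol y^*>\boldsymbol y^*_{-\infty,j}$ for all $j$. $\nu(H)$ is the integral of the non negative measurable function $H$ with respect to $\nu$. Homogeneous with index $-\alpha$ means $\nu(c\,\cdot)=c^{-\alpha}\nu$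 for all $c>0$; shift invariant means $\nu\circ B^{-1}=\nu$. The sequence $\boldsymbol Q$: let $Y_0$ be a random variable independent of $\boldsymbol\Theta$ with $\mathbb{P}(Y_0>y)=y^{-\alpha}$ for $y\ge1$, let $\boldsymbol Y=Y_0\boldsymbol\Theta$; then $\boldsymbol Q$ is a random sequence whose distribution is that of $(\boldsymbol Y^* )^{-1}\boldsymbol Y$ conditionally on $\boldsymbol Y^*_{-\infty,-1}\le1$. Tail measure and spectral tail process of a stationary process $\boldsymbol\zeta$: $\boldsymbol\zeta$ is regularly varying with tail index $\alpha$ if for all integers $s\le t$ there is a non-zero Radon measure $\nu_{s,t}$ on $\mathbb{R}^{[s,t]}\setminus\{\boldsymbol 0\}$ such that $\mathbb{P}(u^{-1}(\zeta_s,\dots,\zeta_t)\in\cdot)/\mathbb{P}(|\zeta_0|>u)\to\nu_{s,t}$ vaguely as $u\to\infty$; its tail measure is the unique Borel measure on $\mathbb{R}^{\mathbb{Z}}$ (product topology) giving no mass to $\{\boldsymbol 0\}$ whose image by the projection on the coordinates in $[s,t]$ equals $\nu_{s,t}$ on $\mathbb{R}^{[s,t]}\setminus\{\boldsymbol 0\}$ for all $s\le t$. Its tail process $\boldsymbol Y$ is the limit in the sense of weak convergence of finite-dimensional distributions of $u^{-1}\boldsymbol\zeta$ conditionally on $|\zeta_0|>u$ as $u\to\infty$, and its spectral tail process is $\boldsymbol Y/|Y_0|$ (in distribution). The process $\boldsymbol\zeta$ has extremal index $\vartheta$ if $\lim_{n\to\infty}\mathbb{P}(\max_{1\le i\le n}\zeta_i\le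 n^{1/\alpha}x)=\mathrm{e}^{-\vartheta x^{-\alpha}}$ for all $x>0$ (the marginals of $\boldsymbol\zeta$ being standard $\alpha$-Fr\'echet, $\mathbb{P}(\zeta_0\le x)=\mathrm{e}^{-x^{-\alpha}}$). *)

theory Defs
  imports "HOL-Probability.Probability" "HOL-Library.Extended"
begin

text \<open>
  Bi-infinite real sequences are functions of type \<^typ>\<open>int \<Rightarrow> real\<close>. The topology of this
  type is the product topology, and \<^term>\<open>borel :: (int \<Rightarrow> real) measure\<close> carries the
  product sigma-algebra. A process on a probability space \<open>M\<close> is a map
  \<open>X :: 'a \<Rightarrow> int \<Rightarrow> real\<close>, with \<open>X \<omega> j\<close> its value at time \<open>j\<close>.
\<close>

text \<open>The iterate \<open>B\<^sup>k\<close>, \<open>k \<in> \<int>\<close>, of the backshift \<open>(B y)\<^sub>j = y\<^sub>j\<^sub>-\<^sub>1\<close>.\<close>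

definition backshift :: "int \<Rightarrow> (int \<Rightarrow> real) \<Rightarrow> int \<Rightarrow> real" where
  "backshift k y = (\<lambda>j. y (j - k))"

text \<open>
  \<open>y\<^sup>*\<^sub>s\<^sub>,\<^sub>t\<close> is \<open>abs_sup S y\<close> with \<open>S\<close> the set of integers \<open>i\<close> such that \<open>s \<le> i \<le> t\<close>; unbounded
  ranges are \<open>{..t}\<close>, \<open>{s..}\<close> and \<open>UNIV\<close>.
\<close>

definition abs_sup :: "int set \<Rightarrow> (int \<Rightarrow> real) \<Rightarrow> ennreal" where
  "abs_sup S y = (SUP i\<in>S. ennreal \<bar>y i\<bar>)"

definition first_argmax :: "(int \<Rightarrow> real) \<Rightarrow> int \<Rightarrow> bool" where
  "first_argmax y j \<longleftrightarrow>
     abs_sup {..j - 1} y < ennreal \<bar>y j\<bar> \<and> abs_sup {j + 1..} y \<le> ennreal \<bar>y j\<bar>"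

text \<open>
  The infargmax functional. The last branch is the case \<open>y\<^sup>* > y\<^sup>*\<^sub>-\<^sub>\<infinity>\<^sub>,\<^sub>j\<close> for all \<open>j\<close>: the three
  cases are exclusive and exhaustive, see the lemmas below.
\<close>

definition infargmax :: "(int \<Rightarrow> real) \<Rightarrow> int extended" where
  "infargmax y =
     (if \<exists>j. first_argmax y j then Fin (THE j. first_argmax y j)
      else if \<forall>j. abs_sup UNIV y = abs_sup {..j} y then Minf
      else Pinf)"

definition nonneg_seqs :: "(int \<Rightarrow> real) set" where
  "nonneg_seqs = {y. \<forall>j. 0 \<le> y j}"

definition candidate_theta :: "'a measure \<Rightarrow> ('a \<Rightarrow> int \<Rightarrow> real) \<Rightarrow> real" where
  "candidate_theta M \<Theta> = measure M {\<omega> \<in> space M. infargmax (\<Theta> \<omega>) = Fin 0}"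

definition nu_functional ::
    "real \<Rightarrow> 'a measure \<Rightarrow> ('a \<Rightarrow> int \<Rightarrow> real) \<Rightarrow> ((int \<Rightarrow> real) \<Rightarrow> ennreal) \<Rightarrow> ennreal" where
  "nu_functional \<alpha> M \<Theta> H =
     (\<integral>\<^sup>+ j. (\<integral>\<^sup>+ r\<in>{0<..}.
         (\<integral>\<^sup>+ \<omega>. H (\<lambda>i. r * backshift j (\<Theta> \<omega>) i) * indicator {\<omega>. infargmax (\<Theta> \<omega>) = Fin 0} \<omega> \<partial>M)
           * ennreal (\<alpha> * r powr (- \<alpha> - 1)) \<partial>lborel) \<partial>count_space UNIV)"

text \<open>
  The measure \<open>\<nu>\<close>. That \<open>\<nu>(H)\<close> is given by \<^const>\<open>nu_functional\<close> for every non negative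
  measurable \<open>H\<close> is lemma \<open>nn_integral_nu\<close> below.
\<close>

definition nu :: "real \<Rightarrow> 'a measure \<Rightarrow> ('a \<Rightarrow> int \<Rightarrow> real) \<Rightarrow> (int \<Rightarrow> real) measure" where
  "nu \<alpha> M \<Theta> = measure_of UNIV (sets borel) (\<lambda>A. nu_functional \<alpha> M \<Theta> (indicator A))"

definition homogeneous :: "real \<Rightarrow> (int \<Rightarrow> real) measure \<Rightarrow> bool" where
  "homogeneous \<alpha> \<nu> \<longleftrightarrow> (\<forall>c>0. \<forall>A\<in>sets \<nu>.
     emeasure \<nu> ((\<lambda>y j. c * y j) ` A) = ennreal (c powr (- \<alpha>)) * emeasure \<nu> A)"

definition shift_invariant :: "(int \<Rightarrow> real) measure \<Rightarrow> bool" where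
  "shift_invariant \<nu> \<longleftrightarrow> distr \<nu> borel (backshift 1) = \<nu>"

definition same_law ::
    "'a measure \<Rightarrow> ('a \<Rightarrow> int \<Rightarrow> real) \<Rightarrow> 'b measure \<Rightarrow> ('b \<Rightarrow> int \<Rightarrow> real) \<Rightarrow> bool" where
  "same_law M X N Y \<longleftrightarrow>
     X \<in> borel_measurable M \<and> Y \<in> borel_measurable N \<and> distr M borel X = distr N borel Y"

definition stationary :: "'a measure \<Rightarrow> ('a \<Rightarrow> int \<Rightarrow> real) \<Rightarrow> bool" where
  "stationary M X \<longleftrightarrow> (\<forall>k. same_law M (\<lambda>\<omega>. backshift k (X \<omega>)) M X)"

text \<open>
  \<open>\<real>\<^bsup>[s,t]\<^esup>\<close> is \<open>PiE {s..t} (\<lambda>_. UNIV)\<close>, with the topology inherited from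
  \<^typ>\<open>int \<Rightarrow> real\<close> (the coordinates outside \<open>[s,t]\<close> are frozen, so this is the
  product topology); its zero is \<open>restrict (\<lambda>_. 0) {s..t}\<close>.
\<close>

definition punctured :: "int \<Rightarrow> int \<Rightarrow> (int \<Rightarrow> real) set" where
  "punctured s t = (PiE {s..t} (\<lambda>_. UNIV)) - {restrict (\<lambda>_. 0) {s..t}}"

text \<open>
  \<open>\<mu>\<close> is the limit \<open>\<nu>\<^sub>s\<^sub>,\<^sub>t\<close> in the definition of regular variation: a non-zero Radon measure on
  \<open>\<real>\<^bsup>[s,t]\<^esup>\<close> minus the origin which is the vague limit of the normalised laws. Radon means finite on
  the compact subsets of that space, and the test functions of vague convergence are the
  continuous functions on it with compact support, extended by zero. The last clause, homogeneity
  of degree \<open>-\<alpha>\<close> of the limit, is what identifies \<open>\<alpha>\<close> as the tail index.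
\<close>

definition exponent_measure ::
    "real \<Rightarrow> 'a measure \<Rightarrow> ('a \<Rightarrow> int \<Rightarrow> real) \<Rightarrow> int \<Rightarrow> int \<Rightarrow> (int \<Rightarrow> real) measure \<Rightarrow> bool" where
  "exponent_measure \<alpha> M X s t \<mu> \<longleftrightarrow>
     sets \<mu> = sets (restrict_space (Pi\<^sub>M {s..t} (\<lambda>_. borel)) (punctured s t)) \<and>
     emeasure \<mu> (space \<mu>) \<noteq> 0 \<and>
     (\<forall>K. compact K \<and> K \<subseteq> punctured s t \<longrightarrow> emeasure \<mu> K < top) \<and>
     (\<forall>f :: (int \<Rightarrow> real) \<Rightarrow> real. \<forall>K.
        continuous_on (punctured s t) f \<and> compact K \<and> K \<subseteq> punctured s t \<and> (\<forall>y. y \<notin> K \<longrightarrow> f y = 0) \<longrightarrow>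
        ((\<lambda>u. (\<integral>\<omega>. f (restrict (\<lambda>j. X \<omega> j / u) {s..t}) \<partial>M)
               / measure M {\<omega> \<in> space M. u < \<bar>X \<omega> 0\<bar>})
           \<longlongrightarrow> (\<integral>y. f y \<partial>\<mu>)) at_top) \<and>
     (\<forall>c>0. \<forall>A\<in>sets \<mu>. emeasure \<mu> ((\<lambda>y. restrict (\<lambda>j. c * y j) {s..t}) ` A)
        = ennreal (c powr (- \<alpha>)) * emeasure \<mu> A)"

text \<open>
  \<open>X\<close> is regularly varying with tail index \<open>\<alpha>\<close> and \<open>\<nu>\<close> is its tail measure.
\<close>

definition has_tail_measure ::
    "real \<Rightarrow> 'a measure \<Rightarrow> ('a \<Rightarrow> int \<Rightarrow> real) \<Rightarrow> (int \<Rightarrow> real) measure \<Rightarrow> bool" where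
  "has_tail_measure \<alpha> M X \<nu> \<longleftrightarrow>
     sets \<nu> = sets borel \<and> emeasure \<nu> {\<lambda>_. 0} = 0 \<and>
     (\<forall>s t. s \<le> t \<longrightarrow> (\<exists>\<mu>. exponent_measure \<alpha> M X s t \<mu> \<and>
        (\<forall>A\<in>sets \<mu>. emeasure \<nu> {y. restrict y {s..t} \<in> A} = emeasure \<mu> A)))"

text \<open>
  \<open>L\<close> is the law of the tail process of \<open>X\<close>: the limit, for the finite-dimensional distributions,
  of \<open>X / u\<close> conditionally on \<open>\<bar>X\<^sub>0\<bar> > u\<close>.
\<close>

definition tail_process_law ::
    "'a measure \<Rightarrow> ('a \<Rightarrow> int \<Rightarrow> real) \<Rightarrow> (int \<Rightarrow> real) measure \<Rightarrow> bool" where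
  "tail_process_law M X L \<longleftrightarrow>
     prob_space L \<and> sets L = sets borel \<and>
     (\<forall>J. finite J \<longrightarrow> (\<forall>f :: (int \<Rightarrow> real) \<Rightarrow> real.
        continuous_on (PiE J (\<lambda>_. UNIV)) f \<and> bounded (f ` (PiE J (\<lambda>_. UNIV))) \<longrightarrow>
        ((\<lambda>u. \<integral>\<omega>. f (restrict (\<lambda>j. X \<omega> j / u) J)
                 \<partial>uniform_measure M {\<omega> \<in> space M. u < \<bar>X \<omega> 0\<bar>})
           \<longlongrightarrow> (\<integral>y. f (restrict y J) \<partial>L)) at_top))"

definition has_spectral_tail_process ::
    "'a measure \<Rightarrow> ('a \<Rightarrow> int \<Rightarrow> real) \<Rightarrow> 'b measure \<Rightarrow> ('b \<Rightarrow> int \<Rightarrow> real) \<Rightarrow> bool" where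
  "has_spectral_tail_process M X N \<Theta> \<longleftrightarrow>
     (\<exists>L. tail_process_law M X L \<and> same_law L (\<lambda>y j. y j / \<bar>y 0\<bar>) N \<Theta>)"

text \<open>
  The first clause is the normalisation under which the extremal index is defined: standard
  \<open>\<alpha>\<close>-Frechet marginals.
\<close>

definition has_extremal_index ::
    "real \<Rightarrow> 'a measure \<Rightarrow> ('a \<Rightarrow> int \<Rightarrow> real) \<Rightarrow> real \<Rightarrow> bool" where
  "has_extremal_index \<alpha> M X \<theta> \<longleftrightarrow>
     (\<forall>j. \<forall>x>0. measure M {\<omega> \<in> space M. X \<omega> j \<le> x} = exp (- (x powr (- \<alpha>)))) \<and>
     (\<forall>x>0. (\<lambda>n :: nat. measure M
               {\<omega> \<in> space M. Max ((\<lambda>i. X \<omega> i) ` {1..int n}) \<le> real n powr (1 / \<alpha>) * x})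
            \<longlonglongrightarrow> exp (- \<theta> * x powr (- \<alpha>)))"

definition point_count :: "(nat \<Rightarrow> 'a \<Rightarrow> 'e) \<Rightarrow> 'e set \<Rightarrow> 'a \<Rightarrow> ennreal" where
  "point_count X A \<omega> = emeasure (count_space UNIV) {i. X i \<omega> \<in> A}"

text \<open>
  The point process \<open>\<Sum>\<^sub>i \<delta>\<^bsub>X i\<^esub>\<close> is Poisson with mean measure \<open>\<mu>\<close>: independent counts on disjoint
  sets, the count of \<open>A\<close> being Poisson with mean \<open>\<mu>(A)\<close>, and a.s. infinite when
  \<open>\<mu>(A) = \<infinity>\<close>. As there are infinitely many points, \<open>\<mu>\<close> has infinite mass.
\<close>

definition poisson_point_process ::
    "'a measure \<Rightarrow> (nat \<Rightarrow> 'a \<Rightarrow> 'e) \<Rightarrow> 'e measure \<Rightarrow> bool" where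
  "poisson_point_process M X \<mu> \<longleftrightarrow>
     prob_space M \<and> (\<forall>i. X i \<in> M \<rightarrow>\<^sub>M \<mu>) \<and>
     (\<forall>A\<in>sets \<mu>. emeasure \<mu> A < top \<longrightarrow> (\<forall>k :: nat.
        measure M {\<omega> \<in> space M. point_count X A \<omega> = of_nat k}
          = exp (- measure \<mu> A) * measure \<mu> A ^ k / fact k)) \<and>
     (\<forall>A\<in>sets \<mu>. emeasure \<mu> A = top \<longrightarrow> (AE \<omega> in M. point_count X A \<omega> = top)) \<and>
     (\<forall>A :: nat \<Rightarrow> 'e set. range A \<subseteq> sets \<mu> \<and> disjoint_family A \<longrightarrow>
        prob_space.indep_vars M (\<lambda>_. borel) (\<lambda>n. point_count X (A n)) UNIV)"

text \<open>
  The supremum is taken in \<^typ>\<open>real\<close>, hence is meaningful only where it is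
  finite; this is stated as \<open>ae_finite_max\<close>.
\<close>

definition max_process :: "(nat \<Rightarrow> 'a \<Rightarrow> int \<Rightarrow> real) \<Rightarrow> 'a \<Rightarrow> int \<Rightarrow> real" where
  "max_process W \<omega> j = (SUP i. W i \<omega> j)"

definition ae_finite_max :: "'a measure \<Rightarrow> (nat \<Rightarrow> 'a \<Rightarrow> int \<Rightarrow> real) \<Rightarrow> bool" where
  "ae_finite_max M W \<longleftrightarrow> (AE \<omega> in M. \<forall>j. bdd_above (range (\<lambda>i. W i \<omega> j)))"

text \<open>The law of \<open>Y\<^sub>0\<close>, see lemma \<open>emeasure_pareto_greaterThan\<close> below.\<close>

definition pareto :: "real \<Rightarrow> real measure" where
  "pareto \<alpha> = density lborel (\<lambda>y. ennreal (\<alpha> * y powr (- \<alpha> - 1)) * indicator {1..} y)"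

text \<open>
  The law of \<open>Y / Y\<^sup>*\<close> conditionally on \<open>Y\<^sup>*\<^sub>-\<^sub>\<infinity>\<^sub>,\<^sub>-\<^sub>1 \<le> 1\<close>, where \<open>Y = Y\<^sub>0 \<Theta>\<close> lives on the product space
  that makes \<open>Y\<^sub>0\<close> and \<open>\<Theta>\<close> independent.
\<close>

definition Q_law :: "real \<Rightarrow> 'a measure \<Rightarrow> ('a \<Rightarrow> int \<Rightarrow> real) \<Rightarrow> (int \<Rightarrow> real) measure" where
  "Q_law \<alpha> M \<Theta> =
     (let P = pareto \<alpha> \<Otimes>\<^sub>M M; Y = (\<lambda>(y, \<omega>) j. y * \<Theta> \<omega> j)
      in distr (uniform_measure P {p \<in> space P. abs_sup {..-1} (Y p) \<le> 1}) borel
           (\<lambda>p j. inverse (enn2real (abs_sup UNIV (Y p))) * Y p j))"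

definition PT_mean :: "real \<Rightarrow> real \<Rightarrow> (real \<times> int) measure" where
  "PT_mean \<alpha> \<theta> =
     density (restrict_space lborel {0<..}) (\<lambda>x. ennreal (\<alpha> * x powr (- \<alpha> - 1)))
       \<Otimes>\<^sub>M scale_measure (ennreal \<theta>) (count_space UNIV)"

text \<open>
  The \<open>Q i\<close> are i.i.d. with law \<open>L\<close> and independent of the Poisson process, i.e. of the sequence of
  its points \<open>(P i, T i)\<close>.
\<close>

definition M3_ingredients ::
    "real \<Rightarrow> real \<Rightarrow> (int \<Rightarrow> real) measure \<Rightarrow> 'a measure \<Rightarrow>
     (nat \<Rightarrow> 'a \<Rightarrow> real) \<Rightarrow> (nat \<Rightarrow> 'a \<Rightarrow> int) \<Rightarrow> (nat \<Rightarrow> 'a \<Rightarrow> int \<Rightarrow> real) \<Rightarrow> bool" where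
  "M3_ingredients \<alpha> \<theta> L M P T Q \<longleftrightarrow>
     poisson_point_process M (\<lambda>i \<omega>. (P i \<omega>, T i \<omega>)) (PT_mean \<alpha> \<theta>) \<and>
     (\<forall>i. Q i \<in> borel_measurable M \<and> distr M borel (Q i) = L) \<and>
     prob_space.indep_vars M (\<lambda>_. borel) Q UNIV \<and>
     prob_space.indep_set M
       (sets (vimage_algebra (space M) (\<lambda>\<omega> i. (P i \<omega>, T i \<omega>)) (Pi\<^sub>M UNIV (\<lambda>_. PT_mean \<alpha> \<theta>))))
       (sets (vimage_algebra (space M) (\<lambda>\<omega> i. Q i \<omega>) (Pi\<^sub>M UNIV (\<lambda>_. borel))))"

definition M3_terms ::
    "(nat \<Rightarrow> 'a \<Rightarrow> real) \<Rightarrow> (nat \<Rightarrow> 'a \<Rightarrow> int) \<Rightarrow> (nat \<Rightarrow> 'a \<Rightarrow> int \<Rightarrow> real) \<Rightarrow>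
     nat \<Rightarrow> 'a \<Rightarrow> int \<Rightarrow> real" where
  "M3_terms P T Q i \<omega> j = P i \<omega> * Q i \<omega> (j - T i \<omega>)"

lemma abs_sup_ge: "i \<in> S \<Longrightarrow> ennreal \<bar>y i\<bar> \<le> abs_sup S y"
  by (auto simp: abs_sup_def intro: SUP_upper)

lemma abs_sup_mono: "S \<subseteq> S' \<Longrightarrow> abs_sup S y \<le> abs_sup S' y"
  by (auto simp: abs_sup_def intro: SUP_subset_mono)

lemma abs_sup_union: "abs_sup (S \<union> S') y = max (abs_sup S y) (abs_sup S' y)"
  by (simp add: abs_sup_def SUP_union sup_max)

lemma first_argmax_unique:
  assumes "first_argmax y j" "first_argmax y k"
  shows "j = k"
proof -
  have *: False if "first_argmax y j" "first_argmax y k" "j < k" for j k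
  proof -
    have "ennreal \<bar>y j\<bar> \<le> abs_sup {..k - 1} y" using that(3) by (intro abs_sup_ge) auto
    also have "\<dots> < ennreal \<bar>y k\<bar>" using that(2) by (simp add: first_argmax_def)
    also have "\<dots> \<le> abs_sup {j + 1..} y" using that(3) by (intro abs_sup_ge) auto
    also have "\<dots> \<le> ennreal \<bar>y j\<bar>" using that(1) by (simp add: first_argmax_def)
    finally show False by simp
  qed
  show ?thesis using * assms by (cases j k rule: linorder_cases) auto
qed

lemma infargmax_eq_Fin_iff: "infargmax y = Fin j \<longleftrightarrow> first_argmax y j"
proof
  assume *: "infargmax y = Fin j"
  then have ex: "\<exists>j. first_argmax y j" by (auto simp: infargmax_def split: if_splits)
  then have "\<exists>!j. first_argmax y j" using first_argmax_unique by blast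
  from theI'[OF this] ex * show "first_argmax y j" by (simp add: infargmax_def)
next
  assume *: "first_argmax y j"
  then have "(THE j. first_argmax y j) = j" using first_argmax_unique by blast
  with * show "infargmax y = Fin j" by (auto simp: infargmax_def)
qed

lemma first_argmax_abs_sup_less:
  assumes "first_argmax y j"
  shows "abs_sup {..j - 1} y < abs_sup UNIV y" "abs_sup {..j} y = abs_sup UNIV y"
proof -
  have 1: "ennreal \<bar>y j\<bar> \<le> abs_sup {..j} y" by (rule abs_sup_ge) simp
  have 2: "abs_sup {..j} y \<le> abs_sup UNIV y" by (rule abs_sup_mono) simp
  show "abs_sup {..j - 1} y < abs_sup UNIV y"
    using assms 1 2 by (auto simp: first_argmax_def)
  have "abs_sup UNIV y = abs_sup ({..j} \<union> {j + 1..}) y"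
    by (rule arg_cong[where f = "\<lambda>S. abs_sup S y"]) auto
  also have "\<dots> = abs_sup {..j} y"
    using assms 1 by (auto simp: abs_sup_union first_argmax_def max_def)
  finally show "abs_sup {..j} y = abs_sup UNIV y" by simp
qed

lemma infargmax_eq_Minf_iff: "infargmax y = Minf \<longleftrightarrow> (\<forall>j. abs_sup UNIV y = abs_sup {..j} y)"
proof -
  have "\<not> first_argmax y j" if "\<forall>j. abs_sup UNIV y = abs_sup {..j} y" for j
    using first_argmax_abs_sup_less(1)[of y j] that by (metis less_irrefl)
  then show ?thesis by (auto simp: infargmax_def)
qed

lemma infargmax_eq_Pinf_iff: "infargmax y = Pinf \<longleftrightarrow> (\<forall>j. abs_sup UNIV y > abs_sup {..j} y)"
proof
  assume *: "\<forall>j. abs_sup UNIV y > abs_sup {..j} y"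
  then have "\<not> first_argmax y j" for j
    using first_argmax_abs_sup_less(2)[of y j] by (metis less_irrefl)
  moreover have "abs_sup UNIV y \<noteq> abs_sup {..0} y" using * by (metis less_irrefl)
  ultimately show "infargmax y = Pinf" by (auto simp: infargmax_def)
next
  assume *: "infargmax y = Pinf"
  then have no: "\<And>j. \<not> first_argmax y j" and "\<not> (\<forall>j. abs_sup UNIV y = abs_sup {..j} y)"
    by (auto simp: infargmax_def split: if_splits)
  then obtain j0 where j0: "abs_sup {..j0} y \<noteq> abs_sup UNIV y" by metis
  have step: "abs_sup {..j + 1} y < abs_sup UNIV y" if "abs_sup {..j} y < abs_sup UNIV y" for j
  proof (rule ccontr)
    assume "\<not> abs_sup {..j + 1} y < abs_sup UNIV y"
    then have eq: "abs_sup {..j + 1} y = abs_sup UNIV y"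
      using abs_sup_mono[of "{..j + 1}" UNIV y] by auto
    have "{..j + 1} = {..j} \<union> {j + 1}" by auto
    then have "abs_sup {..j + 1} y = max (abs_sup {..j} y) (ennreal \<bar>y (j + 1)\<bar>)"
      by (simp only: abs_sup_union) (simp add: abs_sup_def)
    with eq that have m: "ennreal \<bar>y (j + 1)\<bar> = abs_sup UNIV y"
      by (auto simp: max_def split: if_splits)
    have "first_argmax y (j + 1)"
      using that m abs_sup_mono[of "{j + 1 + 1..}" UNIV y] by (simp add: first_argmax_def)
    with no show False by blast
  qed
  have base: "abs_sup {..j0} y < abs_sup UNIV y"
    using j0 abs_sup_mono[of "{..j0}" UNIV y] by auto
  show "\<forall>j. abs_sup UNIV y > abs_sup {..j} y"
  proof
    fix j
    show "abs_sup {..j} y < abs_sup UNIV y"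
    proof (cases "j \<le> j0")
      case True
      then show ?thesis using base abs_sup_mono[of "{..j}" "{..j0}" y] by auto
    next
      case False
      then have "j0 \<le> j" by simp
      then show ?thesis by (induction j rule: int_ge_induct) (use base step in auto)
    qed
  qed
qed

lemma measurable_coordinate [measurable]: "(\<lambda>y :: int \<Rightarrow> real. y i) \<in> borel_measurable borel"
  by (rule borel_measurable_continuous_onI) (rule continuous_on_product_coordinates)

lemma measurable_coordinate':
  "f \<in> borel_measurable M \<Longrightarrow> (\<lambda>x. (f x :: int \<Rightarrow> real) i) \<in> borel_measurable M"
  using measurable_compose[OF _ measurable_coordinate] .

lemma measurable_abs_sup [measurable]: "abs_sup S \<in> borel_measurable borel"
proof -
  have "(\<lambda>y. SUP i\<in>S. ennreal \<bar>y i\<bar>) \<in> borel_measurable (borel :: (int \<Rightarrow> real) measure)"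
    by (intro borel_measurable_SUP) auto
  then show ?thesis by (simp add: abs_sup_def[abs_def])
qed

lemma sets_infargmax_eq_Fin: "{y. infargmax y = Fin j} \<in> sets borel"
proof -
  have "Measurable.pred borel (\<lambda>y. first_argmax y j)"
    unfolding first_argmax_def not_less[symmetric] by measurable
  then show ?thesis by (simp add: infargmax_eq_Fin_iff pred_def)
qed

lemma nn_integral_nu:
  assumes "prob_space M" and \<Theta>: "\<Theta> \<in> borel_measurable M" and H: "H \<in> borel_measurable borel"
  shows "(\<integral>\<^sup>+ y. H y \<partial>nu \<alpha> M \<Theta>) = nu_functional \<alpha> M \<Theta> H"
proof -
  interpret prob_space M by fact
  let ?C = "count_space (UNIV :: int set)"
  let ?P = "?C \<Otimes>\<^sub>M (lborel \<Otimes>\<^sub>M M)"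
  define g :: "int \<times> real \<times> 'a \<Rightarrow> ennreal" where
    "g = (\<lambda>(j, r, \<omega>). indicator {\<omega>. infargmax (\<Theta> \<omega>) = Fin 0} \<omega>
            * (ennreal (\<alpha> * r powr (- \<alpha> - 1)) * indicator {0<..} r))"
  define h :: "int \<times> real \<times> 'a \<Rightarrow> int \<Rightarrow> real" where
    "h = (\<lambda>(j, r, \<omega>) i. r * backshift j (\<Theta> \<omega>) i)"
  interpret LM: pair_sigma_finite lborel M ..
  interpret C: sigma_finite_measure ?C
    by (rule sigma_finite_measure_count_space_countable) simp
  interpret CP: pair_sigma_finite ?C "lborel \<Otimes>\<^sub>M M" ..
  have "Measurable.pred M (\<lambda>\<omega>. infargmax (\<Theta> \<omega>) = Fin 0)"
    using measurable_compose[OF \<Theta>, of "\<lambda>y. infargmax y = Fin 0" "count_space UNIV"]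
      sets_infargmax_eq_Fin[of 0] by (simp add: pred_def)
  then have [measurable]:
    "(\<lambda>\<omega>. indicator {\<omega>. infargmax (\<Theta> \<omega>) = Fin 0} \<omega> :: ennreal) \<in> borel_measurable M"
    by (simp add: indicator_def of_bool_def)
  have \<Theta>i [measurable]: "(\<lambda>\<omega>. \<Theta> \<omega> i) \<in> borel_measurable M" for i
    by (rule measurable_coordinate'[OF \<Theta>])
  have [measurable]: "g \<in> borel_measurable ?P"
    unfolding g_def by measurable
  have [measurable]: "h \<in> borel_measurable ?P"
  proof (rule measurable_coordinatewise_then_product)
    fix i
    have "(\<lambda>p. fst (snd p) * \<Theta> (snd (snd p)) (i - fst p)) \<in> borel_measurable ?P"
    proof (rule measurable_compose_countable[where f = "\<lambda>j p. fst (snd p) * \<Theta> (snd (snd p)) (i - j)"])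
      show "(\<lambda>p. fst (snd p) * \<Theta> (snd (snd p)) (i - j)) \<in> borel_measurable ?P" for j by measurable
    qed measurable
    then show "(\<lambda>p. h p i) \<in> borel_measurable ?P"
      by (simp add: h_def backshift_def case_prod_beta')
  qed
  let ?D = "distr (density ?P g) borel h"
  have key: "(\<integral>\<^sup>+ y. F y \<partial>?D) = nu_functional \<alpha> M \<Theta> F" if F [measurable]: "F \<in> borel_measurable borel" for F
  proof -
    have m: "(\<lambda>p. g p * F (h p)) \<in> borel_measurable ?P" by measurable
    have hm: "(\<lambda>\<omega>. F (h (j, r, \<omega>))) \<in> borel_measurable M" for j r by measurable
    have gm: "(\<lambda>q. g (j, q) * F (h (j, q))) \<in> borel_measurable (lborel \<Otimes>\<^sub>M M)" for j by measurable
    have "(\<integral>\<^sup>+ y. F y \<partial>?D) = (\<integral>\<^sup>+ p. g p * F (h p) \<partial>?P)"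
      by (simp add: nn_integral_distr nn_integral_density)
    also have "\<dots> = (\<integral>\<^sup>+ j. (\<integral>\<^sup>+ q. g (j, q) * F (h (j, q)) \<partial>(lborel \<Otimes>\<^sub>M M)) \<partial>?C)"
      by (rule LM.P.nn_integral_fst[OF m, symmetric])
    also have "\<dots> = (\<integral>\<^sup>+ j. (\<integral>\<^sup>+ r. (\<integral>\<^sup>+ \<omega>. g (j, r, \<omega>) * F (h (j, r, \<omega>)) \<partial>M) \<partial>lborel) \<partial>?C)"
      by (intro nn_integral_cong nn_integral_fst[symmetric] gm)
    also have "\<dots> = nu_functional \<alpha> M \<Theta> F"
      unfolding nu_functional_def
    proof (intro nn_integral_cong)
      fix j r
      have "(\<integral>\<^sup>+ \<omega>. g (j, r, \<omega>) * F (h (j, r, \<omega>)) \<partial>M)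
        = (\<integral>\<^sup>+ \<omega>. (F (h (j, r, \<omega>)) * indicator {\<omega>. infargmax (\<Theta> \<omega>) = Fin 0} \<omega>)
            * (ennreal (\<alpha> * r powr (- \<alpha> - 1)) * indicator {0<..} r) \<partial>M)"
        by (intro nn_integral_cong) (simp add: g_def mult_ac)
      also have "\<dots> = (\<integral>\<^sup>+ \<omega>. F (h (j, r, \<omega>)) * indicator {\<omega>. infargmax (\<Theta> \<omega>) = Fin 0} \<omega> \<partial>M)
            * (ennreal (\<alpha> * r powr (- \<alpha> - 1)) * indicator {0<..} r)"
        using hm by (intro nn_integral_multc) measurable
      finally show "(\<integral>\<^sup>+ \<omega>. g (j, r, \<omega>) * F (h (j, r, \<omega>)) \<partial>M)
        = (\<integral>\<^sup>+ \<omega>. F (\<lambda>i. r * backshift j (\<Theta> \<omega>) i) * indicator {\<omega>. infargmax (\<Theta> \<omega>) = Fin 0} \<omega> \<partial>M)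
            * ennreal (\<alpha> * r powr (- \<alpha> - 1)) * indicator {0<..} r"
        by (simp add: h_def mult_ac)
    qed
    finally show ?thesis .
  qed
  have "nu \<alpha> M \<Theta> = measure_of UNIV (sets borel) (emeasure ?D)"
    unfolding nu_def
  proof (rule measure_of_eq)
    fix A :: "(int \<Rightarrow> real) set" assume "A \<in> sigma_sets UNIV (sets borel)"
    then have A: "A \<in> sets borel" using sets.sigma_sets_eq[of "borel :: (int \<Rightarrow> real) measure"] by simp
    then show "nu_functional \<alpha> M \<Theta> (indicator A) = emeasure ?D A"
      by (subst key[symmetric]) auto
  qed auto
  also have "\<dots> = ?D"
    using measure_of_of_measure[of ?D] by simp
  finally show ?thesis using key[OF H] by simp
qed

lemma emeasure_pareto_greaterThan:
  assumes "0 < \<alpha>" "1 \<le> y"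
  shows "emeasure (pareto \<alpha>) {y<..} = ennreal (y powr (- \<alpha>))"
proof -
  have lim: "((\<lambda>x. - (x powr (- \<alpha>))) \<longlongrightarrow> 0) at_top"
    using tendsto_minus[OF tendsto_neg_powr[OF _ filterlim_ident, of "- \<alpha>"]] assms by simp
  have "emeasure (pareto \<alpha>) {y<..}
      = (\<integral>\<^sup>+ x. ennreal (\<alpha> * x powr (- \<alpha> - 1)) * indicator {1..} x * indicator {y<..} x \<partial>lborel)"
    unfolding pareto_def by (subst emeasure_density) auto
  also have "\<dots> = (\<integral>\<^sup>+ x. ennreal (\<alpha> * x powr (- \<alpha> - 1)) * indicator {y..} x \<partial>lborel)"
    using AE_lborel_singleton[of y] assms
    by (intro nn_integral_cong_AE) (auto elim!: eventually_mono split: split_indicator)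
  also have "\<dots> = ennreal (0 - - (y powr (- \<alpha>)))"
  proof (rule nn_integral_FTC_atLeast)
    fix x assume "y \<le> x"
    then have "0 < x" using assms by simp
    then show "((\<lambda>x. - (x powr (- \<alpha>))) has_real_derivative \<alpha> * x powr (- \<alpha> - 1)) (at x)"
      by (auto intro!: derivative_eq_intros)
    show "0 \<le> \<alpha> * x powr (- \<alpha> - 1)" using assms by simp
  qed (use lim in auto)
  finally show ?thesis by simp
qed

end

theory Submission
  imports Defs
begin

text \<open>
  Everything rests on one formula for \<open>\<nu>\<close>. Let \<open>\<rho>\<close> be the measure \<open>\<alpha> r powr (- \<alpha> - 1) dr\<close> on
  \<open>(0,\<infinity>)\<close>. The formula (\<open>nn_integral_nu_nonzero\<close>) says that, on sequences with \<open>y 0 \<noteq> 0\<close>, the measure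
  \<open>\<nu>\<close> is the image of \<open>\<rho> \<Otimes> P\<close> under \<open>(r, \<omega>) \<mapsto> r \<Theta> \<omega>\<close>. Indeed the time change formula rewrites the \<open>j\<close>-th term
  of the series that defines \<open>\<nu>\<close> as an expectation over the event that the first maximum of \<open>\<Theta>\<close> is at \<open>j\<close>;
  a substitution in \<open>r\<close> removes the factor \<open>\<Theta> j powr \<alpha>\<close>, and these events exhaust the probability space because
  \<open>\<Theta>\<close> vanishes at both ends. As \<open>\<nu>\<close> is shift invariant and homogeneous by construction, each set
  \<open>{y. x < y j}\<close> has mass \<open>x powr (- \<alpha>)\<close>; hence \<open>\<nu>\<close> is \<open>\<sigma>\<close>-finite, and \<open>\<theta>\<close> is positive since otherwise \<open>\<nu>\<close> would be zero.

  The sequence \<open>Q\<close> enters through a change of anchor. Under \<open>\<nu>\<close>, a sequence can be located at its first maximum or at its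
  first exceedance of the level 1. For shift invariant functionals the two choices give the same integrals
  (\<open>anchoring\<close>), so that \<open>Q\<close> has, up to shifts, the law of \<open>\<Theta>\<close> given that its first maximum is at 0, and
  \<open>\<theta>\<close> is both the probability of \<open>I(\<Theta>) = 0\<close> and the mass of the sequences whose first exceedance is at 0.

  All statements on the law of a maximum over points follow from void probabilities: \<open>\<zeta> j \<le> x j\<close> for all \<open>j\<close> in \<open>J\<close>
  means that no point lies in \<open>{y. \<exists>j\<in>J. x j < y j}\<close>, an event of probability \<open>exp (- \<nu> \<dots>)\<close>. This property is the
  locale \<open>max_stable_points\<close>; it determines the law, gives stationarity and the extremal index, and is shared by the
  points \<open>P i * Q i (j - T i)\<close> of the M3 representation. For the latter it follows from the Laplace functional of the Poisson
  process, which turns independent marks into a thinning.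

  The tail measure and the tail process come from the principle of a single large point. If \<open>g\<close> is bounded, vanishes near
  the origin and is continuous \<open>\<nu>\<close>-almost everywhere, then \<open>g (\<zeta> / u)\<close> and \<open>\<Sum>i. g (W i / u)\<close> differ only when two
  large points occur, which has probability of order \<open>u powr (- 2 * \<alpha>)\<close>, or through the oscillation of \<open>g\<close>.
  By Campbell's formula the sum has mean \<open>u powr (- \<alpha>) * \<nu>(g)\<close>, whence \<open>u powr \<alpha> * E(g (\<zeta> / u)) \<longrightarrow> \<nu>(g)\<close>
  (\<open>tail_limit\<close>). Vague convergence and the tail process are two instances of this limit.
\<close>

section \<open>The radial measure\<close>

text \<open>
  Without the restriction to \<open>{1..}\<close> the Pareto density has infinite mass near 0, but scaling acts on it by a mere factor.
\<close>

definition radial :: "real \<Rightarrow> real measure" where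
  "radial \<alpha> = density lborel (\<lambda>r. ennreal (\<alpha> * r powr (- \<alpha> - 1)) * indicator {0<..} r)"

lemma sets_radial [simp, measurable_cong]: "sets (radial \<alpha>) = sets borel"
  by (simp add: radial_def)

lemma space_radial [simp]: "space (radial \<alpha>) = UNIV"
  by (simp add: radial_def)

lemma nn_integral_radial:
  assumes "F \<in> borel_measurable borel"
  shows "(\<integral>\<^sup>+ r. F r \<partial>radial \<alpha>)
    = (\<integral>\<^sup>+ r. F r * ennreal (\<alpha> * r powr (- \<alpha> - 1)) * indicator {0<..} r \<partial>lborel)"
  unfolding radial_def using assms by (subst nn_integral_density) (auto simp: mult_ac)

lemma AE_radial_pos: "AE r in radial \<alpha>. 0 < r"
  unfolding radial_def by (subst AE_density) (auto split: split_indicator)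

lemma nn_integral_radial_scale:
  assumes "0 < \<alpha>" "0 < c" and F [measurable]: "F \<in> borel_measurable borel"
  shows "(\<integral>\<^sup>+ r. F (c * r) \<partial>radial \<alpha>) = ennreal (c powr \<alpha>) * (\<integral>\<^sup>+ r. F r \<partial>radial \<alpha>)"
proof -
  let ?f = "\<lambda>r. F r * ennreal (\<alpha> * r powr (- \<alpha> - 1)) * indicator {0<..} r"
  have [measurable]: "?f \<in> borel_measurable borel" by measurable
  have "(\<integral>\<^sup>+ r. F r \<partial>radial \<alpha>) = (\<integral>\<^sup>+ r. ?f r \<partial>lborel)"
    by (rule nn_integral_radial) simp
  also have "\<dots> = ennreal c * (\<integral>\<^sup>+ r. ?f (0 + c * r) \<partial>lborel)"
    using assms by (subst nn_integral_real_affine[where c = c and t = 0]) auto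
  also have "(\<integral>\<^sup>+ r. ?f (0 + c * r) \<partial>lborel)
      = (\<integral>\<^sup>+ r. ennreal (c powr (- \<alpha> - 1))
          * (F (c * r) * ennreal (\<alpha> * r powr (- \<alpha> - 1)) * indicator {0<..} r) \<partial>lborel)"
  proof (rule nn_integral_cong)
    fix r :: real
    show "?f (0 + c * r) = ennreal (c powr (- \<alpha> - 1))
          * (F (c * r) * ennreal (\<alpha> * r powr (- \<alpha> - 1)) * indicator {0<..} r)"
    proof (cases "0 < r")
      case True
      then have "ennreal (\<alpha> * (c * r) powr (- \<alpha> - 1))
          = ennreal (c powr (- \<alpha> - 1)) * ennreal (\<alpha> * r powr (- \<alpha> - 1))"
        using assms by (simp add: powr_mult ennreal_mult[symmetric] mult_ac)
      then show ?thesis using True assms by (simp add: mult_ac)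
    next
      case False
      then show ?thesis using assms by (simp add: zero_less_mult_iff)
    qed
  qed
  also have "\<dots> = ennreal (c powr (- \<alpha> - 1)) * (\<integral>\<^sup>+ r. F (c * r) \<partial>radial \<alpha>)"
    by (subst nn_integral_cmult) (auto simp: nn_integral_radial)
  finally have "(\<integral>\<^sup>+ r. F r \<partial>radial \<alpha>)
      = ennreal (c * c powr (- \<alpha> - 1)) * (\<integral>\<^sup>+ r. F (c * r) \<partial>radial \<alpha>)"
    using assms by (simp add: mult.assoc[symmetric] ennreal_mult)
  also have "c * c powr (- \<alpha> - 1) = c powr (- \<alpha>)"
    using assms powr_add[of c 1 "- \<alpha> - 1"] by simp
  finally have "ennreal (c powr \<alpha>) * (\<integral>\<^sup>+ r. F r \<partial>radial \<alpha>)
      = ennreal (c powr \<alpha> * c powr (- \<alpha>)) * (\<integral>\<^sup>+ r. F (c * r) \<partial>radial \<alpha>)"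
    by (simp add: mult.assoc[symmetric] ennreal_mult)
  then show ?thesis using assms by (simp add: powr_add[symmetric])
qed

lemma nn_integral_pareto:
  assumes F [measurable]: "F \<in> borel_measurable borel"
  shows "(\<integral>\<^sup>+ r. F r \<partial>pareto \<alpha>) = (\<integral>\<^sup>+ r. F r * indicator {1<..} r \<partial>radial \<alpha>)"
proof -
  have "(\<integral>\<^sup>+ r. F r \<partial>pareto \<alpha>)
      = (\<integral>\<^sup>+ r. F r * (ennreal (\<alpha> * r powr (- \<alpha> - 1)) * indicator {1..} r) \<partial>lborel)"
    unfolding pareto_def by (subst nn_integral_density) (auto simp: mult_ac)
  also have "\<dots> = (\<integral>\<^sup>+ r. F r * indicator {1<..} r * ennreal (\<alpha> * r powr (- \<alpha> - 1))
      * indicator {0<..} r \<partial>lborel)"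
    using AE_lborel_singleton[of 1]
    by (intro nn_integral_cong_AE) (auto elim!: eventually_mono split: split_indicator simp: mult_ac)
  finally show ?thesis by (subst nn_integral_radial) auto
qed

lemma emeasure_radial_greaterThan:
  assumes "0 < \<alpha>" "0 < x"
  shows "emeasure (radial \<alpha>) {x<..} = ennreal (x powr (- \<alpha>))"
proof -
  have 1: "emeasure (radial \<alpha>) {1<..} = 1"
  proof -
    have "emeasure (radial \<alpha>) {1<..} = (\<integral>\<^sup>+ r. indicator {1<..} r \<partial>radial \<alpha>)"
      by simp
    also have "\<dots> = (\<integral>\<^sup>+ r. indicator {1<..} r \<partial>pareto \<alpha>)"
      by (subst nn_integral_pareto) (auto simp: indicator_inter_arith[symmetric])
    also have "\<dots> = 1"
      using emeasure_pareto_greaterThan[of \<alpha> 1] assms by (simp add: pareto_def)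
    finally show ?thesis .
  qed
  have "emeasure (radial \<alpha>) {x<..} = (\<integral>\<^sup>+ r. indicator {1<..} (inverse x * r) \<partial>radial \<alpha>)"
  proof -
    have "indicator {1<..} (inverse x * r) = (indicator {x<..} r :: ennreal)" for r
      using assms by (auto simp: field_simps split: split_indicator)
    then show ?thesis by simp
  qed
  also have "\<dots> = ennreal (inverse x powr \<alpha>) * emeasure (radial \<alpha>) {1<..}"
    using assms by (subst nn_integral_radial_scale) auto
  also have "inverse x powr \<alpha> = x powr (- \<alpha>)"
    using assms by (simp add: powr_minus inverse_powr)
  finally show ?thesis using 1 by simp
qed

lemma AE_radial_neq: "AE r in radial \<alpha>. r \<noteq> x"
  unfolding radial_def using AE_lborel_singleton[of x] by (subst AE_density) auto

lemma prob_space_pareto: "0 < \<alpha> \<Longrightarrow> prob_space (pareto \<alpha>)"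
proof (rule prob_spaceI)
  assume "0 < \<alpha>"
  have "emeasure (pareto \<alpha>) (space (pareto \<alpha>)) = (\<integral>\<^sup>+ r. 1 \<partial>pareto \<alpha>)"
    by simp
  also have "\<dots> = emeasure (radial \<alpha>) {1<..}"
    by (subst nn_integral_pareto) auto
  finally show "emeasure (pareto \<alpha>) (space (pareto \<alpha>)) = 1"
    using \<open>0 < \<alpha>\<close> by (simp add: emeasure_radial_greaterThan)
qed

lemma sigma_finite_radial: "sigma_finite_measure (radial \<alpha>)"
  unfolding radial_def
  by (subst sigma_finite_measure.sigma_finite_iff_density_finite[OF sigma_finite_lborel])
    (auto split: split_indicator simp: ennreal_mult_eq_top_iff)

section \<open>First maxima and first exceedances\<close>

lemma abs_sup_backshift: "abs_sup S (backshift k y) = abs_sup ((\<lambda>i. i - k) ` S) y"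
  by (simp add: abs_sup_def backshift_def image_image)

lemma image_int_diff_atMost: "(\<lambda>i. i - k) ` {..j} = {..j - (k::int)}"
  by (auto intro!: image_eqI[where x = "_ + k"])

lemma image_int_diff_atLeast: "(\<lambda>i. i - k) ` {j..} = {j - (k::int)..}"
  by (auto intro!: image_eqI[where x = "_ + k"])

lemma image_int_diff_UNIV: "range (\<lambda>i. i - (k::int)) = UNIV"
  by (auto intro!: image_eqI[where x = "_ + k"])

lemma first_argmax_backshift: "first_argmax (backshift k y) j \<longleftrightarrow> first_argmax y (j - k)"
  by (simp add: first_argmax_def abs_sup_backshift image_int_diff_atMost image_int_diff_atLeast
      algebra_simps) (simp add: backshift_def)

lemma abs_sup_scale: "0 \<le> c \<Longrightarrow> abs_sup S (\<lambda>i. c * y i) = ennreal c * abs_sup S y"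
  by (simp add: abs_sup_def SUP_mult_left_ennreal abs_mult ennreal_mult)

lemma first_argmax_scale: "0 < c \<Longrightarrow> first_argmax (\<lambda>i. c * y i) j \<longleftrightarrow> first_argmax y j"
proof -
  assume c: "0 < c"
  have "ennreal c * a \<le> ennreal c * b \<longleftrightarrow> a \<le> b" for a b
    using c by (simp add: ennreal_mult_le_mult_iff)
  then show ?thesis
    using c by (simp add: first_argmax_def abs_sup_scale abs_mult ennreal_mult not_le[symmetric])
qed

lemma first_argmax_pos: "first_argmax y j \<Longrightarrow> 0 < \<bar>y j\<bar>"
  by (auto simp: first_argmax_def dest: le_less_trans[OF zero_le])

lemma first_argmax_abs_sup: "first_argmax y j \<Longrightarrow> abs_sup UNIV y = ennreal \<bar>y j\<bar>"
proof -
  assume *: "first_argmax y j"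
  have "(UNIV :: int set) = {..j - 1} \<union> {j + 1..} \<union> {j}" by auto
  then have "abs_sup UNIV y = max (max (abs_sup {..j - 1} y) (abs_sup {j + 1..} y)) (abs_sup {j} y)"
    by (metis abs_sup_union)
  also have "abs_sup {j} y = ennreal \<bar>y j\<bar>" by (simp add: abs_sup_def)
  finally show ?thesis using * by (auto simp: first_argmax_def max_def)
qed

lemma abs_sup_leI: "(\<And>i. i \<in> S \<Longrightarrow> \<bar>y i\<bar> \<le> c) \<Longrightarrow> abs_sup S y \<le> ennreal c"
  unfolding abs_sup_def by (intro SUP_least ennreal_leI)

lemma finite_exceedances:
  fixes y :: "int \<Rightarrow> real"
  assumes "(y \<longlongrightarrow> 0) at_top" "(y \<longlongrightarrow> 0) at_bot" "0 < c"
  shows "finite {j. c \<le> \<bar>y j\<bar>}"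
proof -
  have "eventually (\<lambda>j. \<bar>y j\<bar> < c) at_top" "eventually (\<lambda>j. \<bar>y j\<bar> < c) at_bot"
    using tendstoD[OF assms(1,3)] tendstoD[OF assms(2,3)] by simp_all
  then obtain a b where "\<forall>j\<ge>a. \<bar>y j\<bar> < c" "\<forall>j\<le>b. \<bar>y j\<bar> < c"
    unfolding eventually_at_top_linorder eventually_at_bot_linorder by blast
  then have "{j. c \<le> \<bar>y j\<bar>} \<subseteq> {b..a}" by (auto simp: not_less[symmetric])
  then show ?thesis by (rule finite_subset) simp
qed

text \<open>
  Only finitely many entries are as large as \<open>\<bar>y i\<bar>\<close>, so the maximum is attained and has a first location. The
  inequality on \<open>{..j - 1}\<close> must hold strictly for the supremum, which again uses that only finitely many entries
  exceed half of the maximum.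
\<close>

lemma first_argmax_exists:
  fixes y :: "int \<Rightarrow> real"
  assumes "(y \<longlongrightarrow> 0) at_top" "(y \<longlongrightarrow> 0) at_bot" "y i \<noteq> 0"
  shows "\<exists>j. first_argmax y j"
proof -
  let ?A = "{j. \<bar>y i\<bar> \<le> \<bar>y j\<bar>}"
  have fin: "finite ?A" by (rule finite_exceedances) (use assms in auto)
  have ne: "?A \<noteq> {}" by auto
  define m where "m = Max ((\<lambda>j. \<bar>y j\<bar>) ` ?A)"
  have m_in: "m \<in> (\<lambda>j. \<bar>y j\<bar>) ` ?A" unfolding m_def using fin ne by (intro Max_in) auto
  have le: "\<bar>y k\<bar> \<le> m" for k
  proof (cases "k \<in> ?A")
    case True then show ?thesis unfolding m_def using fin by (intro Max_ge) auto
  next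
    case False then show ?thesis using m_in by auto
  qed
  let ?B = "{j. \<bar>y j\<bar> = m}"
  have B: "finite ?B" "?B \<noteq> {}" using fin m_in by (auto intro: finite_subset[of _ ?A])
  define j where "j = Min ?B"
  have j: "\<bar>y j\<bar> = m" using Min_in[OF B] by (simp add: j_def)
  have before: "\<bar>y k\<bar> < m" if "k < j" for k
  proof -
    have "k \<notin> ?B" using that Min_le[OF B(1), of k] by (auto simp: j_def)
    then show ?thesis using le[of k] by auto
  qed
  have m_pos: "0 < m" using le[of i] assms(3) by simp
  have 1: "abs_sup {..j - 1} y < ennreal m"
  proof -
    let ?C = "{k. m / 2 \<le> \<bar>y k\<bar>} \<inter> {..j - 1}"
    have finC: "finite ?C" using finite_exceedances[OF assms(1,2), of "m / 2"] m_pos by auto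
    define c where "c = Max (insert (m / 2) ((\<lambda>k. \<bar>y k\<bar>) ` ?C))"
    have "c \<in> insert (m / 2) ((\<lambda>k. \<bar>y k\<bar>) ` ?C)" unfolding c_def using finC by (intro Max_in) auto
    then have "c < m" using before m_pos by auto
    have "\<bar>y k\<bar> \<le> c" if "k \<le> j - 1" for k
    proof (cases "m / 2 \<le> \<bar>y k\<bar>")
      case True then show ?thesis unfolding c_def using finC that by (intro Max_ge) auto
    next
      case False
      have "m / 2 \<le> c" unfolding c_def using finC by (intro Max_ge) auto
      with False show ?thesis by simp
    qed
    then have "abs_sup {..j - 1} y \<le> ennreal c" by (intro abs_sup_leI) auto
    also have "\<dots> < ennreal m" using \<open>c < m\<close> m_pos by (simp add: ennreal_lessI)
    finally show ?thesis .
  qed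
  have "abs_sup {j + 1..} y \<le> ennreal m" using le by (intro abs_sup_leI) auto
  with 1 j have "first_argmax y j" by (simp add: first_argmax_def)
  then show ?thesis ..
qed

text \<open>
  The modulus occurs only in the second conjunct: this is the shape in which the event \<open>Y\<^sup>*\<^sub>-\<^sub>\<infinity>\<^sub>,\<^sub>-\<^sub>1 \<le> 1\<close> of the law of
  \<open>Q\<close> meets the exceedance \<open>1 < Y 0\<close>.
\<close>

definition first_exceedance :: "(int \<Rightarrow> real) \<Rightarrow> int \<Rightarrow> bool" where
  "first_exceedance y k \<longleftrightarrow> 1 < y k \<and> abs_sup {..k - 1} y \<le> 1"

lemma abs_sup_le_1_iff: "abs_sup S y \<le> 1 \<longleftrightarrow> (\<forall>i\<in>S. \<bar>y i\<bar> \<le> 1)"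
  by (auto simp: abs_sup_def SUP_le_iff)

lemma first_exceedance_unique: "first_exceedance y j \<Longrightarrow> first_exceedance y k \<Longrightarrow> j = k"
  unfolding first_exceedance_def abs_sup_le_1_iff
  by (rule ccontr) (auto simp: neq_iff, (smt (verit) atMost_iff)+)

lemma first_exceedance_exists:
  assumes "(y \<longlongrightarrow> 0) at_top" "(y \<longlongrightarrow> 0) at_bot" "\<And>j. 0 \<le> y j" "1 < y i"
  shows "\<exists>k. first_exceedance y k"
proof -
  let ?A = "{j. 1 < \<bar>y j\<bar>}"
  have fin: "finite ?A" by (rule finite_subset[OF _ finite_exceedances[OF assms(1,2), of 1]]) auto
  have ne: "?A \<noteq> {}" using assms(4) by (auto intro!: exI[of _ i])
  define k where "k = Min ?A"
  have "k \<in> ?A" unfolding k_def by (rule Min_in[OF fin ne])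
  moreover have "\<bar>y j\<bar> \<le> 1" if "j < k" for j
    using that Min_le[OF fin, of j] by (auto simp: k_def not_less[symmetric])
  ultimately show ?thesis using assms(3) by (auto simp: first_exceedance_def abs_sup_le_1_iff)
qed

lemma first_exceedance_backshift: "first_exceedance (backshift k y) j \<longleftrightarrow> first_exceedance y (j - k)"
  by (simp add: first_exceedance_def abs_sup_backshift image_int_diff_atMost algebra_simps)
    (simp add: backshift_def)

lemma measurable_seqI:
  fixes f :: "'a \<Rightarrow> int \<Rightarrow> real"
  shows "(\<And>i. (\<lambda>x. f x i) \<in> borel_measurable M) \<Longrightarrow> f \<in> borel_measurable M"
  by (rule measurable_coordinatewise_then_product)

lemma measurable_backshift [measurable]: "backshift k \<in> borel_measurable borel"
  by (rule measurable_seqI) (simp add: backshift_def)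

lemma sets_first_argmax [measurable]: "Measurable.pred borel (\<lambda>y. first_argmax y j)"
  using sets_infargmax_eq_Fin[of j] by (simp add: infargmax_eq_Fin_iff pred_def)

lemma sets_first_exceedance [measurable]: "Measurable.pred borel (\<lambda>y. first_exceedance y j)"
  unfolding first_exceedance_def by measurable

lemma sets_nonneg_seqs [measurable]: "nonneg_seqs \<in> sets borel"
proof -
  have "Measurable.pred (borel :: (int \<Rightarrow> real) measure) (\<lambda>y. \<forall>j. 0 \<le> y j)" by measurable
  then show ?thesis by (simp add: nonneg_seqs_def pred_def)
qed

section \<open>The measure in terms of the spectral tail process\<close>

lemma sets_nu [simp, measurable_cong]: "sets (nu \<alpha> M \<Theta>) = sets borel"
  using sets.sigma_sets_eq[of "borel :: (int \<Rightarrow> real) measure"] by (simp add: nu_def)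

lemma space_nu [simp]: "space (nu \<alpha> M \<Theta>) = UNIV"
  by (simp add: nu_def)

locale tail_spectrum = prob_space M for M :: "'a measure" +
  fixes \<alpha> :: real and \<Theta> :: "'a \<Rightarrow> int \<Rightarrow> real"
  assumes \<alpha>_pos: "0 < \<alpha>"
    and \<Theta>_measurable [measurable]: "\<Theta> \<in> borel_measurable M"
    and \<Theta>_nonneg: "AE \<omega> in M. \<forall>j. 0 \<le> \<Theta> \<omega> j"
    and \<Theta>_0: "AE \<omega> in M. \<Theta> \<omega> 0 = 1"
    and \<Theta>_vanishes: "AE \<omega> in M. (\<Theta> \<omega> \<longlongrightarrow> 0) at_top \<and> (\<Theta> \<omega> \<longlongrightarrow> 0) at_bot"
    and time_change: "\<And>k (H :: (int \<Rightarrow> real) \<Rightarrow> ennreal). H \<in> borel_measurable borel \<Longrightarrow>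
      (\<integral>\<^sup>+ \<omega>. H (backshift k (\<Theta> \<omega>)) * indicator {\<omega>. \<Theta> \<omega> (- k) \<noteq> 0} \<omega> \<partial>M)
      = (\<integral>\<^sup>+ \<omega>. (if \<Theta> \<omega> k = 0 then 0
               else H (\<lambda>j. inverse (\<Theta> \<omega> k) * \<Theta> \<omega> j) * ennreal (\<Theta> \<omega> k powr \<alpha>)) \<partial>M)"
begin

abbreviation "\<nu> \<equiv> nu \<alpha> M \<Theta>"
abbreviation "\<rho> \<equiv> radial \<alpha>"
abbreviation "\<theta> \<equiv> candidate_theta M \<Theta>"
abbreviation argmax_at :: "int \<Rightarrow> 'a \<Rightarrow> ennreal" where
  "argmax_at j \<equiv> indicator {\<omega>. first_argmax (\<Theta> \<omega>) j}"

sublocale \<rho>: sigma_finite_measure \<rho> by (rule sigma_finite_radial)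
sublocale \<rho>M: pair_sigma_finite \<rho> M ..
sublocale C: sigma_finite_measure "count_space (UNIV :: int set)"
  by (rule sigma_finite_measure_count_space_countable) simp

lemma \<Theta>_coord [measurable]: "(\<lambda>\<omega>. \<Theta> \<omega> i) \<in> borel_measurable M"
  by (rule measurable_coordinate') measurable

lemma scaled_measurable [measurable]:
  "(\<lambda>(r, \<omega>) i. r * \<Theta> \<omega> (i - j)) \<in> borel_measurable (\<rho> \<Otimes>\<^sub>M M)"
  "(\<lambda>\<omega> i. r * \<Theta> \<omega> (i - j)) \<in> borel_measurable M"
  "(\<lambda>r i. r * \<Theta> \<omega> (i - j)) \<in> borel_measurable borel"
  "(\<lambda>\<omega> i. inverse (\<Theta> \<omega> j) * \<Theta> \<omega> i) \<in> borel_measurable M"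
  by (rule measurable_seqI, simp add: case_prod_beta')+

lemma nn_integral_nu_radial:
  assumes H [measurable]: "H \<in> borel_measurable borel"
  shows "(\<integral>\<^sup>+ y. H y \<partial>\<nu>) =
    (\<integral>\<^sup>+ j. (\<integral>\<^sup>+ r. (\<integral>\<^sup>+ \<omega>. H (\<lambda>i. r * \<Theta> \<omega> (i - j)) * argmax_at 0 \<omega> \<partial>M)
      \<partial>\<rho>) \<partial>count_space UNIV)"
proof -
  have "(\<integral>\<^sup>+ y. H y \<partial>\<nu>) = nu_functional \<alpha> M \<Theta> H"
    by (rule nn_integral_nu) (auto intro: prob_space_axioms)
  also have "\<dots> = (\<integral>\<^sup>+ j. (\<integral>\<^sup>+ r. (\<integral>\<^sup>+ \<omega>. H (\<lambda>i. r * \<Theta> \<omega> (i - j)) * argmax_at 0 \<omega> \<partial>M)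
      \<partial>\<rho>) \<partial>count_space UNIV)"
    unfolding nu_functional_def infargmax_eq_Fin_iff backshift_def
    by (intro nn_integral_cong, subst nn_integral_radial) auto
  finally show ?thesis .
qed

lemma unique_argmax: "AE \<omega> in M. \<exists>!j. first_argmax (\<Theta> \<omega>) j"
  using \<Theta>_vanishes \<Theta>_0
proof eventually_elim
  case (elim \<omega>)
  then have "\<exists>j. first_argmax (\<Theta> \<omega>) j" by (intro first_argmax_exists[where i = 0]) auto
  then show ?case using first_argmax_unique by blast
qed

text \<open>
  The location of the first maximum partitions the probability space, up to a null set.
\<close>

lemma nn_integral_sum_argmax:
  assumes [measurable]: "G \<in> borel_measurable M"
  shows "(\<integral>\<^sup>+ j. (\<integral>\<^sup>+ \<omega>. G \<omega> * argmax_at j \<omega> \<partial>M) \<partial>count_space UNIV)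
    = (\<integral>\<^sup>+ \<omega>. G \<omega> \<partial>M)"
proof -
  interpret CM: pair_sigma_finite "count_space (UNIV :: int set)" M ..
  have [measurable]: "(\<lambda>(j, \<omega>). G \<omega> * argmax_at j \<omega>)
      \<in> borel_measurable (count_space (UNIV :: int set) \<Otimes>\<^sub>M M)"
    by (rule measurable_pair_measure_countable1) auto
  have "(\<integral>\<^sup>+ j. (\<integral>\<^sup>+ \<omega>. G \<omega> * argmax_at j \<omega> \<partial>M) \<partial>count_space UNIV)
    = (\<integral>\<^sup>+ \<omega>. (\<integral>\<^sup>+ j. G \<omega> * argmax_at j \<omega> \<partial>count_space UNIV) \<partial>M)"
    by (rule CM.Fubini'[symmetric]) simp
  also have "\<dots> = (\<integral>\<^sup>+ \<omega>. G \<omega> \<partial>M)"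
  proof (rule nn_integral_cong_AE)
    show "AE \<omega> in M. (\<integral>\<^sup>+ j. G \<omega> * argmax_at j \<omega> \<partial>count_space UNIV) = G \<omega>"
      using unique_argmax
    proof eventually_elim
      case (elim \<omega>)
      then obtain k where k: "\<And>j. first_argmax (\<Theta> \<omega>) j \<longleftrightarrow> j = k" by blast
      have "(\<integral>\<^sup>+ j. G \<omega> * argmax_at j \<omega> \<partial>count_space UNIV)
          = (\<integral>\<^sup>+ j. G \<omega> * indicator {k} j \<partial>count_space UNIV)"
        by (intro nn_integral_cong) (simp add: k indicator_def)
      also have "\<dots> = G \<omega>"
        by (subst nn_integral_cmult) auto
      finally show ?case .
    qed
  qed
  finally show ?thesis .
qed

text \<open>
  The time change formula with \<open>k = j\<close>, applied to \<open>y \<mapsto> H (r y)\<close> restricted to the sequences with first maximum at \<open>j\<close>,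
  moves the origin from the maximum to \<open>j\<close>. It produces \<open>\<Theta>\<close> divided by \<open>\<Theta> j\<close> and the weight \<open>\<Theta> j powr \<alpha>\<close>, and
  integrating over \<open>r\<close> against the radial measure cancels both.
\<close>

lemma change_of_origin:
  assumes H [measurable]: "H \<in> borel_measurable borel"
  shows "(\<integral>\<^sup>+ r. (\<integral>\<^sup>+ \<omega>. H (\<lambda>i. r * \<Theta> \<omega> (i - j)) * indicator {y. y 0 \<noteq> 0} (\<lambda>i. r * \<Theta> \<omega> (i - j))
        * argmax_at 0 \<omega> \<partial>M) \<partial>\<rho>)
    = (\<integral>\<^sup>+ \<omega>. (\<integral>\<^sup>+ r. H (\<lambda>i. r * \<Theta> \<omega> i) \<partial>\<rho>) * argmax_at j \<omega> \<partial>M)"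
    (is "?L = ?R")
proof -
  \<comment> \<open>The integrand that the time change formula produces for a fixed \<open>r\<close>.\<close>
  let ?K = "\<lambda>r \<omega>. if \<Theta> \<omega> j = 0 then 0
      else H (\<lambda>i. r * (inverse (\<Theta> \<omega> j) * \<Theta> \<omega> i)) * argmax_at j \<omega>
        * ennreal (\<Theta> \<omega> j powr \<alpha>)"
  have "?L = (\<integral>\<^sup>+ r. (\<integral>\<^sup>+ \<omega>. ?K r \<omega> \<partial>M) \<partial>\<rho>)"
  proof (rule nn_integral_cong_AE)
    have "(\<integral>\<^sup>+ \<omega>. H (\<lambda>i. r * \<Theta> \<omega> (i - j)) * indicator {y. y 0 \<noteq> 0} (\<lambda>i. r * \<Theta> \<omega> (i - j))
        * argmax_at 0 \<omega> \<partial>M) = (\<integral>\<^sup>+ \<omega>. ?K r \<omega> \<partial>M)" if r: "0 < r" for r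
    proof -
      let ?H = "\<lambda>y. H (\<lambda>i. r * y i) * indicator {y. first_argmax y j} y"
      have [measurable]: "(\<lambda>y i. r * y i) \<in> borel_measurable (borel :: (int \<Rightarrow> real) measure)"
        by (rule measurable_seqI) measurable
      have "(\<integral>\<^sup>+ \<omega>. H (\<lambda>i. r * \<Theta> \<omega> (i - j)) * indicator {y. y 0 \<noteq> 0} (\<lambda>i. r * \<Theta> \<omega> (i - j))
          * argmax_at 0 \<omega> \<partial>M)
        = (\<integral>\<^sup>+ \<omega>. ?H (backshift j (\<Theta> \<omega>)) * indicator {\<omega>. \<Theta> \<omega> (- j) \<noteq> 0} \<omega> \<partial>M)"
        using r by (intro nn_integral_cong)
          (simp add: indicator_def first_argmax_backshift, simp add: backshift_def)
      also have "\<dots> = (\<integral>\<^sup>+ \<omega>. (if \<Theta> \<omega> j = 0 then 0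
               else ?H (\<lambda>i. inverse (\<Theta> \<omega> j) * \<Theta> \<omega> i) * ennreal (\<Theta> \<omega> j powr \<alpha>)) \<partial>M)"
        by (rule time_change) measurable
      also have "\<dots> = (\<integral>\<^sup>+ \<omega>. ?K r \<omega> \<partial>M)"
      proof (rule nn_integral_cong_AE)
        show "AE \<omega> in M. (if \<Theta> \<omega> j = 0 then 0
            else ?H (\<lambda>i. inverse (\<Theta> \<omega> j) * \<Theta> \<omega> i) * ennreal (\<Theta> \<omega> j powr \<alpha>)) = ?K r \<omega>"
          using \<Theta>_nonneg
        proof eventually_elim
          case (elim \<omega>)
          then have "\<Theta> \<omega> j = 0 \<or> 0 < \<Theta> \<omega> j" by (auto simp: less_le)
          then show ?case using first_argmax_scale[of "inverse (\<Theta> \<omega> j)" "\<Theta> \<omega>" j]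
            by (auto simp: indicator_def)
        qed
      qed
      finally show ?thesis .
    qed
    then show "AE r in \<rho>. (\<integral>\<^sup>+ \<omega>. H (\<lambda>i. r * \<Theta> \<omega> (i - j)) * indicator {y. y 0 \<noteq> 0} (\<lambda>i. r * \<Theta> \<omega> (i - j))
        * argmax_at 0 \<omega> \<partial>M) = (\<integral>\<^sup>+ \<omega>. ?K r \<omega> \<partial>M)"
      by (rule eventually_mono[OF AE_radial_pos])
  qed
  also have "\<dots> = (\<integral>\<^sup>+ \<omega>. (\<integral>\<^sup>+ r. ?K r \<omega> \<partial>\<rho>) \<partial>M)"
  proof (rule \<rho>M.Fubini'[symmetric])
    have [measurable]: "(\<lambda>(r, \<omega>) i. r * (inverse (\<Theta> \<omega> j) * \<Theta> \<omega> i)) \<in> borel_measurable (\<rho> \<Otimes>\<^sub>M M)"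
      by (rule measurable_seqI) (simp add: case_prod_beta')
    show "(\<lambda>(r, \<omega>). ?K r \<omega>) \<in> borel_measurable (\<rho> \<Otimes>\<^sub>M M)" by measurable
  qed
  also have "\<dots> = ?R"
  proof (rule nn_integral_cong_AE)
    show "AE \<omega> in M. (\<integral>\<^sup>+ r. ?K r \<omega> \<partial>\<rho>)
        = (\<integral>\<^sup>+ r. H (\<lambda>i. r * \<Theta> \<omega> i) \<partial>\<rho>) * argmax_at j \<omega>"
      using \<Theta>_nonneg
    proof eventually_elim
      case (elim \<omega>)
      show ?case
      proof (cases "first_argmax (\<Theta> \<omega>) j")
        case True
        then have pos: "0 < \<Theta> \<omega> j" using first_argmax_pos[of "\<Theta> \<omega>" j] elim by auto
        have HM [measurable]: "(\<lambda>r. H (\<lambda>i. r * \<Theta> \<omega> i)) \<in> borel_measurable borel"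
          using measurable_compose[OF scaled_measurable(3)[of \<omega> 0] H] by simp
        have "(\<lambda>r. inverse (\<Theta> \<omega> j) * r) \<in> borel_measurable borel" by measurable
        from measurable_compose[OF this HM]
        have HM': "(\<lambda>r. H (\<lambda>i. (inverse (\<Theta> \<omega> j) * r) * \<Theta> \<omega> i)) \<in> borel_measurable \<rho>"
          by (simp cong: measurable_cong_sets)
        have "(\<integral>\<^sup>+ r. ?K r \<omega> \<partial>\<rho>)
            = (\<integral>\<^sup>+ r. H (\<lambda>i. (inverse (\<Theta> \<omega> j) * r) * \<Theta> \<omega> i) * ennreal (\<Theta> \<omega> j powr \<alpha>) \<partial>\<rho>)"
          using True pos by (intro nn_integral_cong) (simp add: mult_ac)
        also have "\<dots> = (\<integral>\<^sup>+ r. H (\<lambda>i. (inverse (\<Theta> \<omega> j) * r) * \<Theta> \<omega> i) \<partial>\<rho>) * ennreal (\<Theta> \<omega> j powr \<alpha>)"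
          by (rule nn_integral_multc[OF HM'])
        also have "(\<integral>\<^sup>+ r. H (\<lambda>i. (inverse (\<Theta> \<omega> j) * r) * \<Theta> \<omega> i) \<partial>\<rho>)
            = ennreal (inverse (\<Theta> \<omega> j) powr \<alpha>) * (\<integral>\<^sup>+ r. H (\<lambda>i. r * \<Theta> \<omega> i) \<partial>\<rho>)"
          using pos \<alpha>_pos by (intro nn_integral_radial_scale) auto
        also have "ennreal (inverse (\<Theta> \<omega> j) powr \<alpha>) * (\<integral>\<^sup>+ r. H (\<lambda>i. r * \<Theta> \<omega> i) \<partial>\<rho>) * ennreal (\<Theta> \<omega> j powr \<alpha>)
            = ennreal (inverse (\<Theta> \<omega> j) powr \<alpha> * \<Theta> \<omega> j powr \<alpha>) * (\<integral>\<^sup>+ r. H (\<lambda>i. r * \<Theta> \<omega> i) \<partial>\<rho>)"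
          by (simp add: ennreal_mult mult_ac)
        also have "inverse (\<Theta> \<omega> j) powr \<alpha> * \<Theta> \<omega> j powr \<alpha> = 1"
          using pos by (simp add: powr_mult[symmetric])
        finally show ?thesis using True by simp
      qed (simp cong: if_cong)
    qed
  qed
  finally show ?thesis .
qed

text \<open>
  The key formula. Summing \<open>change_of_origin\<close> over \<open>j\<close> removes the restriction to a given location of the maximum.
\<close>

lemma nn_integral_nu_nonzero:
  assumes H [measurable]: "H \<in> borel_measurable borel"
  shows "(\<integral>\<^sup>+ y. H y * indicator {y. y 0 \<noteq> 0} y \<partial>\<nu>) = (\<integral>\<^sup>+ r. (\<integral>\<^sup>+ \<omega>. H (\<lambda>i. r * \<Theta> \<omega> i) \<partial>M) \<partial>\<rho>)"
proof -
  have [measurable]: "(\<lambda>(r, \<omega>). H (\<lambda>i. r * \<Theta> \<omega> i)) \<in> borel_measurable (\<rho> \<Otimes>\<^sub>M M)"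
    using measurable_compose[OF scaled_measurable(1)[of 0] H] by (simp add: case_prod_beta')
  have G: "(\<lambda>\<omega>. \<integral>\<^sup>+ r. H (\<lambda>i. r * \<Theta> \<omega> i) \<partial>\<rho>) \<in> borel_measurable M"
    by (rule \<rho>.borel_measurable_nn_integral)
      (use measurable_compose[OF measurable_pair_swap' , of "\<lambda>(r, \<omega>). H (\<lambda>i. r * \<Theta> \<omega> i)" \<rho> M borel] in
        \<open>simp add: case_prod_beta'\<close>)
  have "(\<integral>\<^sup>+ y. H y * indicator {y. y 0 \<noteq> 0} y \<partial>\<nu>)
    = (\<integral>\<^sup>+ j. (\<integral>\<^sup>+ r. (\<integral>\<^sup>+ \<omega>. H (\<lambda>i. r * \<Theta> \<omega> (i - j)) * indicator {y. y 0 \<noteq> 0} (\<lambda>i. r * \<Theta> \<omega> (i - j))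
        * argmax_at 0 \<omega> \<partial>M) \<partial>\<rho>) \<partial>count_space UNIV)"
    by (rule nn_integral_nu_radial) measurable
  also have "\<dots> = (\<integral>\<^sup>+ j. (\<integral>\<^sup>+ \<omega>. (\<integral>\<^sup>+ r. H (\<lambda>i. r * \<Theta> \<omega> i) \<partial>\<rho>)
      * argmax_at j \<omega> \<partial>M) \<partial>count_space UNIV)"
    by (simp add: change_of_origin)
  also have "\<dots> = (\<integral>\<^sup>+ \<omega>. (\<integral>\<^sup>+ r. H (\<lambda>i. r * \<Theta> \<omega> i) \<partial>\<rho>) \<partial>M)"
    by (rule nn_integral_sum_argmax[OF G])
  also have "\<dots> = (\<integral>\<^sup>+ r. (\<integral>\<^sup>+ \<omega>. H (\<lambda>i. r * \<Theta> \<omega> i) \<partial>M) \<partial>\<rho>)"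
    by (rule \<rho>M.Fubini') simp
  finally show ?thesis .
qed

text \<open>
  It suffices to look at the terms of the series one by one.
\<close>

lemma emeasure_nu_eq_0:
  assumes A [measurable]: "A \<in> sets borel"
    and "\<And>r j. 0 < r \<Longrightarrow> AE \<omega> in M. first_argmax (\<Theta> \<omega>) 0 \<longrightarrow> (\<lambda>i. r * \<Theta> \<omega> (i - j)) \<notin> A"
  shows "emeasure \<nu> A = 0"
proof -
  let ?I = "\<lambda>j r. \<integral>\<^sup>+ \<omega>. indicator A (\<lambda>i. r * \<Theta> \<omega> (i - j)) * argmax_at 0 \<omega> \<partial>M"
  have "?I j r = 0" if "0 < r" for r j
  proof -
    have "?I j r = (\<integral>\<^sup>+ \<omega>. 0 \<partial>M)"
      by (rule nn_integral_cong_AE, rule eventually_mono[OF assms(2)[OF that, of j]])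
        (auto simp: indicator_def)
    then show ?thesis by simp
  qed
  then have "(\<integral>\<^sup>+ r. ?I j r \<partial>\<rho>) = (\<integral>\<^sup>+ r. 0 \<partial>\<rho>)" for j
    by (intro nn_integral_cong_AE eventually_mono[OF AE_radial_pos])
  then have "(\<integral>\<^sup>+ y. indicator A y \<partial>\<nu>) = 0"
    by (subst nn_integral_nu_radial) simp_all
  then show ?thesis by simp
qed

lemma nu_nonneg: "AE y in \<nu>. y \<in> nonneg_seqs"
proof -
  have "emeasure \<nu> (- nonneg_seqs) = 0"
  proof (rule emeasure_nu_eq_0)
    fix r :: real and j :: int assume "0 < r"
    then show "AE \<omega> in M. first_argmax (\<Theta> \<omega>) 0 \<longrightarrow> (\<lambda>i. r * \<Theta> \<omega> (i - j)) \<notin> - nonneg_seqs"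
      using \<Theta>_nonneg by (auto elim!: eventually_mono simp: nonneg_seqs_def)
  qed auto
  then show ?thesis by (intro AE_I[where N = "- nonneg_seqs"]) auto
qed

text \<open>
  A shift permutes the terms of the series.
\<close>

lemma nn_integral_nu_backshift:
  assumes H [measurable]: "H \<in> borel_measurable borel"
  shows "(\<integral>\<^sup>+ y. H (backshift k y) \<partial>\<nu>) = (\<integral>\<^sup>+ y. H y \<partial>\<nu>)"
proof -
  let ?I = "\<lambda>j. (\<integral>\<^sup>+ r. (\<integral>\<^sup>+ \<omega>. H (\<lambda>i. r * \<Theta> \<omega> (i - j))
      * argmax_at 0 \<omega> \<partial>M) \<partial>\<rho>)"
  have "(\<integral>\<^sup>+ y. H (backshift k y) \<partial>\<nu>) = (\<integral>\<^sup>+ j. ?I (j + k) \<partial>count_space UNIV)"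
    by (subst nn_integral_nu_radial) (measurable, simp add: backshift_def algebra_simps)
  also have "\<dots> = (\<integral>\<^sup>+ j. ?I j \<partial>count_space UNIV)"
    by (rule nn_integral_bij_count_space)
      (auto simp: bij_betw_def inj_on_def intro!: image_eqI[where x = "_ - k"])
  also have "\<dots> = (\<integral>\<^sup>+ y. H y \<partial>\<nu>)"
    by (rule nn_integral_nu_radial[symmetric]) simp
  finally show ?thesis .
qed

lemma distr_nu_backshift: "distr \<nu> borel (backshift k) = \<nu>"
proof (rule measure_eqI)
  fix A assume "A \<in> sets (distr \<nu> borel (backshift k))"
  then have [measurable]: "A \<in> sets borel" by simp
  have "emeasure (distr \<nu> borel (backshift k)) A = (\<integral>\<^sup>+ y. indicator A (backshift k y) \<partial>\<nu>)"
    by (simp add: nn_integral_indicator[symmetric] nn_integral_distr del: nn_integral_indicator)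
  also have "\<dots> = emeasure \<nu> A" by (subst nn_integral_nu_backshift) auto
  finally show "emeasure (distr \<nu> borel (backshift k)) A = emeasure \<nu> A" .
qed simp

lemma emeasure_nu_backshift:
  assumes "A \<in> sets borel"
  shows "emeasure \<nu> {y. backshift k y \<in> A} = emeasure \<nu> A"
  using arg_cong[OF distr_nu_backshift[of k], of "\<lambda>M. emeasure M A"] assms
  by (subst (asm) emeasure_distr) (auto simp: vimage_def)

lemma nn_integral_nu_scale:
  assumes "0 < c" and H [measurable]: "H \<in> borel_measurable borel"
  shows "(\<integral>\<^sup>+ y. H (\<lambda>i. c * y i) \<partial>\<nu>) = ennreal (c powr \<alpha>) * (\<integral>\<^sup>+ y. H y \<partial>\<nu>)"
proof -
  let ?I = "\<lambda>j r. (\<integral>\<^sup>+ \<omega>. H (\<lambda>i. r * \<Theta> \<omega> (i - j)) * argmax_at 0 \<omega> \<partial>M)"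
  have [measurable]: "(\<lambda>y i. c * y i) \<in> borel_measurable (borel :: (int \<Rightarrow> real) measure)"
    by (rule measurable_seqI) measurable
  have [measurable]: "(\<lambda>(r, \<omega>). H (\<lambda>i. r * \<Theta> \<omega> (i - j)) * argmax_at 0 \<omega>)
      \<in> borel_measurable (\<rho> \<Otimes>\<^sub>M M)" for j
    using measurable_compose[OF scaled_measurable(1)[of j] H] by (simp add: case_prod_beta')
  have I [measurable]: "?I j \<in> borel_measurable borel" for j
    using borel_measurable_nn_integral[of
        "\<lambda>r \<omega>. H (\<lambda>i. r * \<Theta> \<omega> (i - j)) * argmax_at 0 \<omega>" \<rho>]
    by (simp cong: measurable_cong_sets)
  have "(\<integral>\<^sup>+ y. H (\<lambda>i. c * y i) \<partial>\<nu>) = (\<integral>\<^sup>+ j. (\<integral>\<^sup>+ r. ?I j (c * r) \<partial>\<rho>) \<partial>count_space UNIV)"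
    by (subst nn_integral_nu_radial) (auto simp: mult.assoc)
  also have "\<dots> = (\<integral>\<^sup>+ j. ennreal (c powr \<alpha>) * (\<integral>\<^sup>+ r. ?I j r \<partial>\<rho>) \<partial>count_space UNIV)"
    using assms \<alpha>_pos by (intro nn_integral_cong nn_integral_radial_scale) auto
  also have "\<dots> = ennreal (c powr \<alpha>) * (\<integral>\<^sup>+ j. (\<integral>\<^sup>+ r. ?I j r \<partial>\<rho>) \<partial>count_space UNIV)"
    by (rule nn_integral_cmult) simp
  also have "(\<integral>\<^sup>+ j. (\<integral>\<^sup>+ r. ?I j r \<partial>\<rho>) \<partial>count_space UNIV) = (\<integral>\<^sup>+ y. H y \<partial>\<nu>)"
    by (rule nn_integral_nu_radial[symmetric]) simp
  finally show ?thesis .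
qed

lemma emeasure_nu_scale:
  assumes "0 < c" and [measurable]: "A \<in> sets borel"
  shows "emeasure \<nu> {y. (\<lambda>i. c * y i) \<in> A} = ennreal (c powr \<alpha>) * emeasure \<nu> A"
proof -
  have [measurable]: "(\<lambda>y i. c * y i) \<in> borel_measurable (borel :: (int \<Rightarrow> real) measure)"
    by (rule measurable_seqI) measurable
  have "{y. (\<lambda>i. c * y i) \<in> A} \<in> sets borel"
    using measurable_sets[OF \<open>(\<lambda>y i. c * y i) \<in> borel_measurable borel\<close> assms(2)]
    by (simp add: vimage_def)
  then have "emeasure \<nu> {y. (\<lambda>i. c * y i) \<in> A}
      = (\<integral>\<^sup>+ y. indicator {y. (\<lambda>i. c * y i) \<in> A} y \<partial>\<nu>)"
    by simp
  also have "\<dots> = (\<integral>\<^sup>+ y. indicator A (\<lambda>i. c * y i) \<partial>\<nu>)"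
    by (intro nn_integral_cong) (simp add: indicator_def)
  also have "\<dots> = ennreal (c powr \<alpha>) * emeasure \<nu> A"
    using assms by (subst nn_integral_nu_scale) auto
  finally show ?thesis .
qed

lemma homogeneous_nu: "homogeneous \<alpha> \<nu>"
  unfolding homogeneous_def
proof (intro allI impI ballI)
  fix c :: real and A assume c: "0 < c" and A: "A \<in> sets \<nu>"
  have "(\<lambda>y j. c * y j) ` A = {y. (\<lambda>i. inverse c * y i) \<in> A}"
    using c by (auto simp: image_iff mult.assoc[symmetric] intro!: bexI[where x = "\<lambda>i. inverse c * _ i"])
  then show "emeasure \<nu> ((\<lambda>y j. c * y j) ` A) = ennreal (c powr (- \<alpha>)) * emeasure \<nu> A"
    using c A emeasure_nu_scale[of "inverse c" A] by (simp add: powr_minus inverse_powr)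
qed

lemma emeasure_nu_0_greater:
  assumes "0 < x"
  shows "emeasure \<nu> {y. x < y 0} = ennreal (x powr (- \<alpha>))"
proof -
  have "emeasure \<nu> {y. x < y 0} = (\<integral>\<^sup>+ y. indicator {y. x < y 0} y \<partial>\<nu>)"
    by simp
  also have "\<dots> = (\<integral>\<^sup>+ y. indicator {y. x < y 0} y * indicator {y. y 0 \<noteq> 0} y \<partial>\<nu>)"
    using assms by (intro nn_integral_cong) (simp split: split_indicator)
  also have "\<dots> = (\<integral>\<^sup>+ r. (\<integral>\<^sup>+ \<omega>. indicator {y. x < y 0} (\<lambda>i. r * \<Theta> \<omega> i) \<partial>M) \<partial>\<rho>)"
    by (rule nn_integral_nu_nonzero) auto
  also have "\<dots> = (\<integral>\<^sup>+ r. (\<integral>\<^sup>+ \<omega>. indicator {x<..} r \<partial>M) \<partial>\<rho>)"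
    using \<Theta>_0 by (intro nn_integral_cong nn_integral_cong_AE)
      (auto elim!: eventually_mono simp: indicator_def)
  also have "\<dots> = emeasure \<rho> {x<..}" by (simp add: emeasure_space_1)
  finally show ?thesis using assms \<alpha>_pos by (simp add: emeasure_radial_greaterThan)
qed

lemma emeasure_nu_greater:
  assumes "0 < x"
  shows "emeasure \<nu> {y. x < y j} = ennreal (x powr (- \<alpha>))"
  using emeasure_nu_backshift[of "{y. x < y 0}" "- j"] emeasure_nu_0_greater[OF assms]
  by (simp add: backshift_def)

lemma nu_zero: "emeasure \<nu> {\<lambda>_. 0} = 0"
proof (rule emeasure_nu_eq_0)
  fix r :: real and j :: int assume r: "0 < r"
  have "(\<lambda>i. r * \<Theta> \<omega> (i - j)) \<noteq> (\<lambda>_. 0)" if "first_argmax (\<Theta> \<omega>) 0" for \<omega>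
    using r first_argmax_pos[OF that] by (auto simp: fun_eq_iff intro!: exI[of _ j])
  then show "AE \<omega> in M. first_argmax (\<Theta> \<omega>) 0 \<longrightarrow> (\<lambda>i. r * \<Theta> \<omega> (i - j)) \<notin> {\<lambda>_. 0}"
    by auto
qed simp

text \<open>
  A non negative sequence other than 0 exceeds some \<open>1 / Suc n\<close> at some \<open>j\<close>, and these exceedance sets have finite mass.
\<close>

lemma sigma_finite_nu: "sigma_finite_measure \<nu>"
proof
  \<comment> \<open>The null set of sequences with a negative entry is needed to cover the whole space.\<close>
  let ?B = "\<lambda>(j :: int, n :: nat). {y :: int \<Rightarrow> real. 1 / real (Suc n) < y j}"
  let ?A = "range ?B \<union> {{\<lambda>_. 0}, - nonneg_seqs}"
  have "emeasure \<nu> (- nonneg_seqs) = 0"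
    using AE_iff_measurable[of "- nonneg_seqs" \<nu> "\<lambda>y. y \<in> nonneg_seqs"] nu_nonneg by (auto simp: Compl_eq)
  moreover have "\<Union>?A = UNIV"
  proof (intro set_eqI iffI UNIV_I)
    fix y :: "int \<Rightarrow> real"
    show "y \<in> \<Union>?A"
    proof (cases "y \<in> nonneg_seqs \<and> y \<noteq> (\<lambda>_. 0)")
      case True
      then obtain j where "0 < y j" by (auto simp: nonneg_seqs_def fun_eq_iff less_le)
      then obtain n where "1 / real (Suc n) < y j" using nat_approx_posE by blast
      then have "y \<in> ?B (j, n)" by simp
      then show ?thesis by blast
    qed auto
  qed
  ultimately show "\<exists>A. countable A \<and> A \<subseteq> sets \<nu> \<and> \<Union>A = space \<nu> \<and> (\<forall>a\<in>A. emeasure \<nu> a \<noteq> \<infinity>)"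
    by (intro exI[of _ ?A]) (auto simp: nu_zero emeasure_nu_greater)
qed

lemma candidate_theta_pos: "0 < \<theta>"
proof (rule ccontr)
  assume "\<not> 0 < \<theta>"
  then have "prob {\<omega> \<in> space M. first_argmax (\<Theta> \<omega>) 0} = 0"
    by (simp add: candidate_theta_def infargmax_eq_Fin_iff not_less measure_le_0_iff)
  then have AE: "AE \<omega> in M. \<not> first_argmax (\<Theta> \<omega>) 0"
    by (subst AE_iff_measurable[OF _ refl]) (auto simp: emeasure_eq_measure)
  have "emeasure \<nu> {y. 1 < y 0} = 0"
    using AE by (intro emeasure_nu_eq_0) (auto elim!: eventually_mono)
  then   show False using emeasure_nu_0_greater[of 1] by simp
qed

end

section \<open>Anchoring and the law of the normalised sequence\<close>

lemma nn_integral_count_space_ex1: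
  assumes "\<exists>!j. P j"
  shows "(\<integral>\<^sup>+ j. a * indicator {j. P j} j \<partial>count_space UNIV) = (a :: ennreal)"
proof -
  from assms obtain k where "\<And>j. P j \<longleftrightarrow> j = k" by blast
  then have "{j. P j} = {k}" by auto
  then show ?thesis by (simp add: nn_integral_cmult)
qed

lemma sigma_finite_count_int: "sigma_finite_measure (count_space (UNIV :: int set))"
  by (rule sigma_finite_measure_count_space_countable) simp

lemma measurable_nn_integral_count_int:
  fixes f :: "int \<Rightarrow> 'b \<Rightarrow> ennreal"
  assumes [measurable]: "\<And>j. f j \<in> borel_measurable N"
  shows "(\<lambda>x. \<integral>\<^sup>+ j. f j x \<partial>count_space UNIV) \<in> borel_measurable N"
proof -
  interpret sigma_finite_measure "count_space (UNIV :: int set)" by (rule sigma_finite_count_int)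
  have "(\<lambda>(j, x). f j x) \<in> borel_measurable (count_space UNIV \<Otimes>\<^sub>M N)"
    by (rule measurable_pair_measure_countable1) auto
  from measurable_pair_swap[OF this] show ?thesis
    by (intro borel_measurable_nn_integral) simp
qed

lemma measurable_shifted_scaled [measurable]:
  "(\<lambda>(p, q) i. p * q (i - t)) \<in> borel_measurable (borel \<Otimes>\<^sub>M (borel :: (int \<Rightarrow> real) measure))"
  by (rule measurable_seqI) (simp add: case_prod_beta')

context tail_spectrum
begin

abbreviation "Y \<equiv> (\<lambda>(y, \<omega>) j. y * \<Theta> \<omega> j)"
abbreviation "PM \<equiv> pareto \<alpha> \<Otimes>\<^sub>M M"

lemma sets_pareto [simp, measurable_cong]: "sets (pareto \<alpha>) = sets borel"
  by (simp add: pareto_def)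

lemma measurable_Y [measurable]: "Y \<in> borel_measurable PM"
  by (rule measurable_seqI) (simp add: case_prod_beta')

lemma prob_space_PM: "prob_space PM"
proof -
  interpret P: prob_space "pareto \<alpha>" by (rule prob_space_pareto[OF \<alpha>_pos])
  interpret PM: pair_prob_space "pareto \<alpha>" M ..
  show ?thesis by (rule PM.prob_space_axioms)
qed

text \<open>
  The law of \<open>Y = Y\<^sub>0 \<Theta>\<close> is the restriction of \<open>\<nu>\<close> to \<open>{y. 1 < y 0}\<close>: the Pareto law is the radial measure on
  \<open>{1<..}\<close>, and \<open>\<Theta> 0 = 1\<close>.
\<close>

lemma nn_integral_Y:
  assumes G [measurable]: "G \<in> borel_measurable borel"
  shows "(\<integral>\<^sup>+ p. G (Y p) \<partial>PM) = (\<integral>\<^sup>+ y. G y * indicator {y. 1 < y 0} y \<partial>\<nu>)"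
proof -
  have [measurable]: "(\<lambda>(r, \<omega>). G (\<lambda>i. r * \<Theta> \<omega> i)) \<in> borel_measurable (borel \<Otimes>\<^sub>M M)"
    using measurable_compose[OF measurable_Y G] by (simp add: case_prod_beta' cong: measurable_cong_sets sets_pair_measure_cong)
  have "(\<integral>\<^sup>+ p. G (Y p) \<partial>PM) = (\<integral>\<^sup>+ r. (\<integral>\<^sup>+ \<omega>. G (\<lambda>i. r * \<Theta> \<omega> i) \<partial>M) \<partial>pareto \<alpha>)"
    using nn_integral_fst[OF measurable_compose[OF measurable_Y G]] by simp
  also have "\<dots> = (\<integral>\<^sup>+ r. (\<integral>\<^sup>+ \<omega>. G (\<lambda>i. r * \<Theta> \<omega> i) \<partial>M) * indicator {1<..} r \<partial>\<rho>)"
    by (rule nn_integral_pareto) measurable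
  also have "\<dots> = (\<integral>\<^sup>+ r. (\<integral>\<^sup>+ \<omega>. G (\<lambda>i. r * \<Theta> \<omega> i) * indicator {y. 1 < y 0} (\<lambda>i. r * \<Theta> \<omega> i) \<partial>M) \<partial>\<rho>)"
  proof (rule nn_integral_cong)
    fix r
    have [measurable]: "(\<lambda>\<omega>. G (\<lambda>i. r * \<Theta> \<omega> i)) \<in> borel_measurable M"
      using measurable_compose[OF scaled_measurable(2)[of r 0] G] by simp
    have "(\<integral>\<^sup>+ \<omega>. G (\<lambda>i. r * \<Theta> \<omega> i) \<partial>M) * indicator {1<..} r
        = (\<integral>\<^sup>+ \<omega>. G (\<lambda>i. r * \<Theta> \<omega> i) * indicator {1<..} r \<partial>M)"
      by (rule nn_integral_multc[symmetric]) simp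
    also have "\<dots> = (\<integral>\<^sup>+ \<omega>. G (\<lambda>i. r * \<Theta> \<omega> i) * indicator {y. 1 < y 0} (\<lambda>i. r * \<Theta> \<omega> i) \<partial>M)"
      using \<Theta>_0 by (intro nn_integral_cong_AE) (auto elim!: eventually_mono simp: indicator_def)
    finally show "(\<integral>\<^sup>+ \<omega>. G (\<lambda>i. r * \<Theta> \<omega> i) \<partial>M) * indicator {1<..} r = \<dots>" .
  qed
  also have "\<dots> = (\<integral>\<^sup>+ y. G y * indicator {y. 1 < y 0} y * indicator {y. y 0 \<noteq> 0} y \<partial>\<nu>)"
    by (rule nn_integral_nu_nonzero[symmetric]) measurable
  also have "\<dots> = (\<integral>\<^sup>+ y. G y * indicator {y. 1 < y 0} y \<partial>\<nu>)"
    by (intro nn_integral_cong) (auto simp: indicator_def)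
  finally show ?thesis .
qed

abbreviation normalised :: "(int \<Rightarrow> real) \<Rightarrow> int \<Rightarrow> real" where
  "normalised y \<equiv> (\<lambda>j. inverse (enn2real (abs_sup UNIV y)) * y j)"

lemma measurable_normalised [measurable]: "normalised \<in> borel_measurable borel"
  by (rule measurable_seqI) measurable

text \<open>
  In the series for \<open>\<nu>\<close>, the sequence \<open>r B\<^sup>j \<Theta>\<close> with \<open>I(\<Theta>) = 0\<close> has supremum \<open>r\<close>, so its normalisation is a shift of
  \<open>\<Theta>\<close>, to which \<open>F\<close> is blind. What is left of the sum over \<open>j\<close> counts the locations of the first exceedance of
  \<open>r \<Theta>\<close>: there is one if \<open>1 < r\<close> and none otherwise, and \<open>{1<..}\<close> has radial mass 1.
\<close>

lemma anchoring:
  assumes F [measurable]: "F \<in> borel_measurable borel"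
    and inv: "\<And>k y. F (backshift k y) = F y"
  shows "(\<integral>\<^sup>+ y. F (normalised y) * indicator {y. first_exceedance y 0} y \<partial>\<nu>)
    = (\<integral>\<^sup>+ \<omega>. F (\<Theta> \<omega>) * argmax_at 0 \<omega> \<partial>M)"
proof -
  let ?c = "\<integral>\<^sup>+ \<omega>. F (\<Theta> \<omega>) * argmax_at 0 \<omega> \<partial>M"
  \<comment> \<open>The first exceedance of \<open>r B\<^sup>j \<Theta>\<close> is at 0 when that of \<open>r \<Theta>\<close> is at \<open>- j\<close>.\<close>
  let ?K = "\<lambda>j (r, \<omega>). F (\<Theta> \<omega>) * argmax_at 0 \<omega>
      * indicator {j. first_exceedance (\<lambda>i. r * \<Theta> \<omega> i) (- j)} j"
  interpret CP: pair_sigma_finite "count_space (UNIV :: int set)" "\<rho> \<Otimes>\<^sub>M M" ..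
  have [measurable]: "(\<lambda>(r, \<omega>) i. r * \<Theta> \<omega> i) \<in> borel_measurable (\<rho> \<Otimes>\<^sub>M M)"
    by (rule measurable_seqI) (simp add: case_prod_beta')
  have [measurable]: "Measurable.pred (\<rho> \<Otimes>\<^sub>M M) (\<lambda>(r, \<omega>). first_exceedance (\<lambda>i. r * \<Theta> \<omega> i) k)" for k
    using measurable_compose[OF _ sets_first_exceedance[of k], of "\<lambda>(r, \<omega>) i. r * \<Theta> \<omega> i" "\<rho> \<Otimes>\<^sub>M M"]
    by (simp add: case_prod_beta')
  have Kj [measurable]: "?K j \<in> borel_measurable (\<rho> \<Otimes>\<^sub>M M)" for j
    unfolding indicator_def by measurable
  have K: "(\<lambda>(j, p). ?K j p) \<in> borel_measurable (count_space UNIV \<Otimes>\<^sub>M (\<rho> \<Otimes>\<^sub>M M))"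
    by (rule measurable_pair_measure_countable1) (use Kj in auto)
  have "(\<integral>\<^sup>+ y. F (normalised y) * indicator {y. first_exceedance y 0} y \<partial>\<nu>)
    = (\<integral>\<^sup>+ j. (\<integral>\<^sup>+ r. (\<integral>\<^sup>+ \<omega>. ?K j (r, \<omega>) \<partial>M) \<partial>\<rho>) \<partial>count_space UNIV)"
  proof (subst nn_integral_nu_radial)
    have "(\<integral>\<^sup>+ \<omega>. F (normalised (\<lambda>i. r * \<Theta> \<omega> (i - j)))
          * indicator {y. first_exceedance y 0} (\<lambda>i. r * \<Theta> \<omega> (i - j))
          * argmax_at 0 \<omega> \<partial>M)
        = (\<integral>\<^sup>+ \<omega>. ?K j (r, \<omega>) \<partial>M)" if r: "0 < r" for j r
      using \<Theta>_0
    proof (rule nn_integral_cong_AE[OF eventually_mono])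
      fix \<omega> assume 0: "\<Theta> \<omega> 0 = 1"
      have shift: "(\<lambda>i. r * \<Theta> \<omega> (i - j)) = backshift j (\<lambda>i. r * \<Theta> \<omega> i)" by (simp add: backshift_def)
      have norm: "normalised (\<lambda>i. r * \<Theta> \<omega> (i - j)) = backshift j (\<Theta> \<omega>)" if "first_argmax (\<Theta> \<omega>) 0"
      proof -
        have "abs_sup UNIV (\<lambda>i. r * \<Theta> \<omega> (i - j)) = ennreal r"
          unfolding shift using r 0 first_argmax_abs_sup[OF that]
          by (simp add: abs_sup_backshift image_int_diff_UNIV abs_sup_scale)
        then show ?thesis using r by (auto simp: backshift_def)
      qed
      show "F (normalised (\<lambda>i. r * \<Theta> \<omega> (i - j)))
          * indicator {y. first_exceedance y 0} (\<lambda>i. r * \<Theta> \<omega> (i - j))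
          * argmax_at 0 \<omega> = ?K j (r, \<omega>)"
      proof (cases "first_argmax (\<Theta> \<omega>) 0")
        case True
        then show ?thesis
          unfolding norm[OF True] inv using first_exceedance_backshift[of j "\<lambda>i. r * \<Theta> \<omega> i" 0]
          by (simp add: indicator_def shift)
      qed simp
    qed
    then show "(\<integral>\<^sup>+ j. (\<integral>\<^sup>+ r. (\<integral>\<^sup>+ \<omega>. F (normalised (\<lambda>i. r * \<Theta> \<omega> (i - j)))
          * indicator {y. first_exceedance y 0} (\<lambda>i. r * \<Theta> \<omega> (i - j))
          * argmax_at 0 \<omega> \<partial>M) \<partial>\<rho>) \<partial>count_space UNIV)
        = (\<integral>\<^sup>+ j. (\<integral>\<^sup>+ r. (\<integral>\<^sup>+ \<omega>. ?K j (r, \<omega>) \<partial>M) \<partial>\<rho>) \<partial>count_space UNIV)"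
      by (intro nn_integral_cong[where M = "count_space UNIV"] nn_integral_cong_AE[where M = \<rho>]
          eventually_mono[OF AE_radial_pos])
  qed measurable
  also have "\<dots> = (\<integral>\<^sup>+ j. (\<integral>\<^sup>+ p. ?K j p \<partial>(\<rho> \<Otimes>\<^sub>M M)) \<partial>count_space UNIV)"
    by (intro nn_integral_cong nn_integral_fst) (rule Kj)
  also have "\<dots> = (\<integral>\<^sup>+ p. (\<integral>\<^sup>+ j. ?K j p \<partial>count_space UNIV) \<partial>(\<rho> \<Otimes>\<^sub>M M))"
    by (rule CP.Fubini'[symmetric, OF K])
  also have "\<dots> = (\<integral>\<^sup>+ r. (\<integral>\<^sup>+ \<omega>. (\<integral>\<^sup>+ j. ?K j (r, \<omega>) \<partial>count_space UNIV) \<partial>M) \<partial>\<rho>)"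
    by (rule nn_integral_fst[symmetric]) (rule measurable_nn_integral_count_int, rule Kj)
  also have "\<dots> = (\<integral>\<^sup>+ r. ?c * indicator {1<..} r \<partial>\<rho>)"
  proof (rule nn_integral_cong_AE[OF eventually_mono[OF AE_radial_pos]])
    fix r :: real assume r: "0 < r"
    have "(\<integral>\<^sup>+ \<omega>. (\<integral>\<^sup>+ j. ?K j (r, \<omega>) \<partial>count_space UNIV) \<partial>M)
      = (\<integral>\<^sup>+ \<omega>. F (\<Theta> \<omega>) * argmax_at 0 \<omega> * indicator {1<..} r \<partial>M)"
    proof (rule nn_integral_cong_AE)
      show "AE \<omega> in M. (\<integral>\<^sup>+ j. ?K j (r, \<omega>) \<partial>count_space UNIV)
          = F (\<Theta> \<omega>) * argmax_at 0 \<omega> * indicator {1<..} r"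
        using \<Theta>_0 \<Theta>_nonneg \<Theta>_vanishes
      proof eventually_elim
        case (elim \<omega>)
        show ?case
        proof (cases "first_argmax (\<Theta> \<omega>) 0")
          case fa: True
          have le: "\<Theta> \<omega> i \<le> 1" for i
            using first_argmax_abs_sup[OF fa] abs_sup_ge[of i UNIV "\<Theta> \<omega>"] elim by simp
          show ?thesis
          proof (cases "1 < r")
            case True
            have "\<exists>k. first_exceedance (\<lambda>i. r * \<Theta> \<omega> i) k"
              using elim True by (intro first_exceedance_exists[where i = 0])
                (auto intro!: tendsto_mult_right_zero)
            then obtain k where k: "first_exceedance (\<lambda>i. r * \<Theta> \<omega> i) k" ..
            have "\<exists>!j. first_exceedance (\<lambda>i. r * \<Theta> \<omega> i) (- j)"
            proof (rule ex1I[of _ "- k"])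
              show "j = - k" if "first_exceedance (\<lambda>i. r * \<Theta> \<omega> i) (- j)" for j
                using first_exceedance_unique[OF that k] by simp
            qed (use k in simp)
            from nn_integral_count_space_ex1[OF this] show ?thesis using True by simp
          next
            case False
            then have "r * \<Theta> \<omega> i \<le> 1" for i using le[of i] r elim mult_mono[of r 1 "\<Theta> \<omega> i" 1] by simp
            then have "\<not> first_exceedance (\<lambda>i. r * \<Theta> \<omega> i) k" for k
              by (auto simp: first_exceedance_def not_less)
            then show ?thesis using False by simp
          qed
        qed simp
      qed
    qed
    also have "\<dots> = ?c * indicator {1<..} r" by (rule nn_integral_multc) measurable
    finally show "(\<integral>\<^sup>+ \<omega>. (\<integral>\<^sup>+ j. ?K j (r, \<omega>) \<partial>count_space UNIV) \<partial>M) = ?c * indicator {1<..} r" .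
  qed
  also have "\<dots> = ?c"
    using \<alpha>_pos by (simp add: nn_integral_cmult_indicator emeasure_radial_greaterThan)
  finally show ?thesis .
qed

lemma emeasure_nu_first_exceedance: "emeasure \<nu> {y. first_exceedance y 0} = ennreal \<theta>"
proof -
  have "emeasure \<nu> {y. first_exceedance y 0} = (\<integral>\<^sup>+ y. 1 * indicator {y. first_exceedance y 0} y \<partial>\<nu>)"
    by simp
  also have "\<dots> = (\<integral>\<^sup>+ \<omega>. 1 * argmax_at 0 \<omega> \<partial>M)"
    by (rule anchoring) auto
  also have "\<dots> = (\<integral>\<^sup>+ \<omega>. indicator {\<omega> \<in> space M. first_argmax (\<Theta> \<omega>) 0} \<omega> \<partial>M)"
    by (intro nn_integral_cong) (simp add: indicator_def)
  also have "\<dots> = ennreal \<theta>"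
    by (simp add: candidate_theta_def infargmax_eq_Fin_iff emeasure_eq_measure)
  finally show ?thesis .
qed

abbreviation "E0 \<equiv> {p \<in> space PM. abs_sup {..-1} (Y p) \<le> 1}"

lemma sets_E0 [measurable]: "E0 \<in> sets PM"
  by measurable

lemma nn_integral_Y_E0:
  assumes G [measurable]: "G \<in> borel_measurable borel"
  shows "(\<integral>\<^sup>+ p. G (Y p) * indicator E0 p \<partial>PM)
    = (\<integral>\<^sup>+ y. G y * indicator {y. first_exceedance y 0} y \<partial>\<nu>)"
proof -
  have "(\<integral>\<^sup>+ p. G (Y p) * indicator E0 p \<partial>PM)
      = (\<integral>\<^sup>+ p. (\<lambda>y. G y * indicator {y. abs_sup {..-1} y \<le> 1} y) (Y p) \<partial>PM)"
    by (intro nn_integral_cong) (simp add: indicator_def)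
  also have "\<dots> = (\<integral>\<^sup>+ y. G y * indicator {y. abs_sup {..-1} y \<le> 1} y * indicator {y. 1 < y 0} y \<partial>\<nu>)"
    by (rule nn_integral_Y) measurable
  also have "\<dots> = (\<integral>\<^sup>+ y. G y * indicator {y. first_exceedance y 0} y \<partial>\<nu>)"
    by (intro nn_integral_cong) (auto simp: indicator_def first_exceedance_def)
  finally show ?thesis .
qed

lemma emeasure_E0: "emeasure PM E0 = ennreal \<theta>"
proof -
  have "emeasure PM E0 = (\<integral>\<^sup>+ p. 1 * indicator E0 p \<partial>PM)"
    using nn_integral_indicator[OF sets_E0] by simp
  also have "\<dots> = ennreal \<theta>"
    by (subst nn_integral_Y_E0) (auto simp: emeasure_nu_first_exceedance)
  finally show ?thesis .
qed

abbreviation "QL \<equiv> Q_law \<alpha> M \<Theta>"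

lemma Q_law_eq: "QL = distr (uniform_measure PM E0) borel (\<lambda>p. normalised (Y p))"
  by (simp add: Q_law_def Let_def)

lemma prob_space_Q_law: "prob_space QL"
  unfolding Q_law_eq
  using candidate_theta_pos by (intro prob_space.prob_space_distr prob_space_uniform_measure)
    (auto simp: emeasure_E0)

lemma sets_Q_law [simp, measurable_cong]: "sets QL = sets borel"
  by (simp add: Q_law_eq)

lemma nn_integral_Q_law:
  assumes F [measurable]: "F \<in> borel_measurable borel"
    and inv: "\<And>k y. F (backshift k y) = F y"
  shows "ennreal \<theta> * (\<integral>\<^sup>+ q. F q \<partial>QL)
    = (\<integral>\<^sup>+ \<omega>. F (\<Theta> \<omega>) * argmax_at 0 \<omega> \<partial>M)"
proof -
  have "(\<integral>\<^sup>+ q. F q \<partial>QL) = (\<integral>\<^sup>+ p. F (normalised (Y p)) \<partial>uniform_measure PM E0)"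
    unfolding Q_law_eq by (subst nn_integral_distr) auto
  also have "\<dots> = (\<integral>\<^sup>+ p. (\<lambda>y. F (normalised y)) (Y p) * indicator E0 p \<partial>PM) / ennreal \<theta>"
    by (subst nn_integral_uniform_measure[OF _ sets_E0]) (auto simp: emeasure_E0)
  also have "(\<integral>\<^sup>+ p. (\<lambda>y. F (normalised y)) (Y p) * indicator E0 p \<partial>PM)
      = (\<integral>\<^sup>+ \<omega>. F (\<Theta> \<omega>) * argmax_at 0 \<omega> \<partial>M)"
    by (subst nn_integral_Y_E0, measurable) (rule anchoring[OF F inv])
  finally show ?thesis
    using candidate_theta_pos by (simp add: ennreal_times_divide mult.commute[of "ennreal \<theta>"] ennreal_mult_divide_eq)
qed

text \<open>
  The inner double integral is a shift invariant functional of \<open>q\<close>, so it may be evaluated at \<open>\<Theta>\<close> given \<open>I(\<Theta>) = 0\<close>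
  instead of \<open>Q\<close>, which gives the series that defines \<open>\<nu>\<close>.
\<close>

lemma nn_integral_nu_Q:
  assumes H [measurable]: "H \<in> borel_measurable borel"
  shows "(\<integral>\<^sup>+ y. H y \<partial>\<nu>) = ennreal \<theta> *
    (\<integral>\<^sup>+ q. (\<integral>\<^sup>+ t. (\<integral>\<^sup>+ p. H (\<lambda>i. p * q (i - t)) \<partial>\<rho>) \<partial>count_space UNIV) \<partial>QL)"
proof -
  let ?F = "\<lambda>q. \<integral>\<^sup>+ t. (\<integral>\<^sup>+ p. H (\<lambda>i. p * q (i - t)) \<partial>\<rho>) \<partial>count_space UNIV"
  let ?A = "argmax_at 0"
  interpret CM: pair_sigma_finite "count_space (UNIV :: int set)" M ..
  have H2: "(\<lambda>(p, q). H (\<lambda>i. p * q (i - t))) \<in> borel_measurable (\<rho> \<Otimes>\<^sub>M borel)" for t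
    using measurable_compose[OF measurable_shifted_scaled[of t] H]
    by (simp add: case_prod_beta' cong: measurable_cong_sets sets_pair_measure_cong)
  have H1: "(\<lambda>q. \<integral>\<^sup>+ p. H (\<lambda>i. p * q (i - t)) \<partial>\<rho>) \<in> borel_measurable borel" for t
    using \<rho>.borel_measurable_nn_integral[OF measurable_pair_swap[OF H2]] by simp
  have F [measurable]: "?F \<in> borel_measurable borel"
    by (rule measurable_nn_integral_count_int) (rule H1)
  have inv: "?F (backshift k q) = ?F q" for k q
  proof -
    have "?F (backshift k q) = (\<integral>\<^sup>+ t. (\<integral>\<^sup>+ p. H (\<lambda>i. p * q (i - (t + k))) \<partial>\<rho>) \<partial>count_space UNIV)"
      by (simp add: backshift_def algebra_simps)
    also have "\<dots> = ?F q"
      by (rule nn_integral_bij_count_space)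
        (auto simp: bij_betw_def inj_on_def intro!: image_eqI[where x = "_ - k"])
    finally show ?thesis .
  qed
  have M1: "(\<lambda>(r, \<omega>). H (\<lambda>i. r * \<Theta> \<omega> (i - t)) * ?A \<omega>) \<in> borel_measurable (\<rho> \<Otimes>\<^sub>M M)" for t
    using measurable_compose[OF scaled_measurable(1)[of t] H] by (simp add: case_prod_beta')
  have M2: "(\<lambda>\<omega>. (\<integral>\<^sup>+ p. H (\<lambda>i. p * \<Theta> \<omega> (i - t)) \<partial>\<rho>)) \<in> borel_measurable M" for t
    using measurable_compose[OF \<Theta>_measurable H1[of t]] by simp
  have M3: "(\<lambda>p. H (\<lambda>i. p * \<Theta> \<omega> (i - t))) \<in> borel_measurable \<rho>" for \<omega> t
    using measurable_compose[OF scaled_measurable(3)[of \<omega> t] H] by (simp cong: measurable_cong_sets)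
  have "ennreal \<theta> * (\<integral>\<^sup>+ q. ?F q \<partial>QL) = (\<integral>\<^sup>+ \<omega>. ?F (\<Theta> \<omega>) * ?A \<omega> \<partial>M)"
    by (rule nn_integral_Q_law[OF F inv])
  also have "\<dots> = (\<integral>\<^sup>+ \<omega>. (\<integral>\<^sup>+ t. (\<integral>\<^sup>+ p. H (\<lambda>i. p * \<Theta> \<omega> (i - t)) \<partial>\<rho>) * ?A \<omega> \<partial>count_space UNIV) \<partial>M)"
    by (simp add: nn_integral_multc)
  also have "\<dots> = (\<integral>\<^sup>+ t. (\<integral>\<^sup>+ \<omega>. (\<integral>\<^sup>+ p. H (\<lambda>i. p * \<Theta> \<omega> (i - t)) \<partial>\<rho>) * ?A \<omega> \<partial>M) \<partial>count_space UNIV)"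
    by (rule CM.Fubini', rule measurable_pair_measure_countable1) (auto intro!: M2 borel_measurable_times)
  also have "\<dots> = (\<integral>\<^sup>+ t. (\<integral>\<^sup>+ \<omega>. (\<integral>\<^sup>+ p. H (\<lambda>i. p * \<Theta> \<omega> (i - t)) * ?A \<omega> \<partial>\<rho>) \<partial>M) \<partial>count_space UNIV)"
    by (simp only: nn_integral_multc[OF M3])
  also have "\<dots> = (\<integral>\<^sup>+ t. (\<integral>\<^sup>+ p. (\<integral>\<^sup>+ \<omega>. H (\<lambda>i. p * \<Theta> \<omega> (i - t)) * ?A \<omega> \<partial>M) \<partial>\<rho>) \<partial>count_space UNIV)"
    by (intro nn_integral_cong \<rho>M.Fubini' M1)
  also have "\<dots> = (\<integral>\<^sup>+ y. H y \<partial>\<nu>)"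
    by (rule nn_integral_nu_radial[symmetric, OF H])
  finally show ?thesis ..
qed

end

section \<open>Laplace transforms on the extended half line\<close>

text \<open>
  The function \<open>exp (- x)\<close> on \<open>[0,\<infinity>]\<close>. The value 0 at infinity makes it continuous, so that sums over infinitely many points
  and sets of infinite mean need no separate treatment.
\<close>

definition nexp :: "ennreal \<Rightarrow> ennreal" where
  "nexp x = (if x = top then 0 else ennreal (exp (- enn2real x)))"

lemma nexp_0 [simp]: "nexp 0 = 1" and nexp_top [simp]: "nexp top = 0"
  by (simp_all add: nexp_def)

lemma nexp_ennreal [simp]: "0 \<le> x \<Longrightarrow> nexp (ennreal x) = ennreal (exp (- x))"
  by (simp add: nexp_def)

lemma measurable_nexp [measurable]: "nexp \<in> borel_measurable borel"
  unfolding nexp_def by measurable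

lemma nexp_add: "nexp (x + y) = nexp x * nexp y"
proof (cases "x = top \<or> y = top")
  case False
  then obtain a b where "x = ennreal a" "0 \<le> a" "y = ennreal b" "0 \<le> b"
    by (metis ennreal_cases)
  then show ?thesis
    by (simp add: ennreal_plus[symmetric] ennreal_mult[symmetric] exp_add[symmetric] del: ennreal_plus)
qed auto

lemma nexp_sum: "finite I \<Longrightarrow> nexp (\<Sum>i\<in>I. f i) = (\<Prod>i\<in>I. nexp (f i))"
  by (induction I rule: finite_induct) (auto simp: nexp_add)

lemma nexp_of_nat_mult: "nexp (of_nat k * c) = nexp c ^ k"
  by (induction k) (auto simp: nexp_add distrib_right)

lemma nexp_le_1: "nexp x \<le> 1"
  by (cases x) (auto simp: top_unique)

lemma nexp_neq_top [simp]: "nexp x \<noteq> top"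
  using nexp_le_1[of x] by (auto simp: top_unique)

lemma nexp_antimono: "x \<le> y \<Longrightarrow> nexp y \<le> nexp x"
  by (cases y; cases x) (auto simp: top_unique intro!: ennreal_leI)

lemma nexp_eq_1_iff: "nexp x = 1 \<longleftrightarrow> x = 0"
  by (cases x) (auto simp: ennreal_eq_1)

lemma tendsto_nexp:
  assumes f: "(f \<longlongrightarrow> x) F"
  shows "((\<lambda>z. nexp (f z)) \<longlongrightarrow> nexp x) F"
proof (cases "x = top")
  case False
  then obtain a where a: "x = ennreal a" "0 \<le> a" by (metis ennreal_cases)
  have "((\<lambda>z. ennreal (exp (- enn2real (f z)))) \<longlongrightarrow> ennreal (exp (- a))) F"
    using f a by (intro tendsto_intros) auto
  then have lim: "((\<lambda>z. ennreal (exp (- enn2real (f z)))) \<longlongrightarrow> nexp x) F" using a by simp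
  have "eventually (\<lambda>z. f z < top) F"
    using order_tendstoD(2)[OF f, of top] False by (simp add: less_top)
  then have "eventually (\<lambda>z. ennreal (exp (- enn2real (f z))) = nexp (f z)) F"
    by eventually_elim (simp add: nexp_def)
  from lim this show ?thesis by (rule Lim_transform_eventually)
next
  case True
  show ?thesis
  proof (rule order_tendstoI)
    fix a assume "nexp x < a"
    then have "0 < a" using True by simp
    then obtain d where d: "0 < d" "d < a" using dense by blast
    then obtain e where "d = ennreal e" "0 \<le> e" by (cases d) auto
    with d have e: "0 < e" "ennreal e < a" by auto
    \<comment> \<open>The maximum matters when \<open>1 < e\<close>, where \<open>- ln e\<close> is negative.\<close>
    define b where "b = max 0 (- ln e)"
    have "eventually (\<lambda>z. ennreal b < f z) F"
      using order_tendstoD(1)[OF f, of "ennreal b"] True by simp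
    then show "eventually (\<lambda>z. nexp (f z) < a) F"
    proof eventually_elim
      case (elim z)
      have "nexp (f z) \<le> nexp (ennreal b)" using elim by (intro nexp_antimono) simp
      also have "\<dots> = ennreal (exp (- b))" by (rule nexp_ennreal) (simp add: b_def)
      also have "\<dots> \<le> ennreal e"
      proof (rule ennreal_leI)
        have "- b \<le> ln e" by (simp add: b_def)
        then show "exp (- b) \<le> e" using e by (metis exp_ln exp_le_cancel_iff)
      qed
      finally show ?case using e by simp
    qed
  next
    fix a assume "a < nexp x"
    then show "eventually (\<lambda>z. a < nexp (f z)) F" using True by simp
  qed
qed

text \<open>
  Every number in \<open>[0,1]\<close>, in particular 0, is a value of \<open>nexp\<close>; this writes a product of probabilities as the \<open>nexp\<close> of a sum.
\<close>

lemma nexp_inverse: "p \<le> 1 \<Longrightarrow> nexp (if p = 0 then top else ennreal (- ln (enn2real p))) = p"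
proof -
  assume "p \<le> 1"
  then obtain r where r: "p = ennreal r" "0 \<le> r" "r \<le> 1"
    by (cases p) (auto simp: top_unique)
  show ?thesis
  proof (cases "r = 0")
    case False
    then show ?thesis using r by simp
  qed (use r in simp)
qed

section \<open>Poisson point processes\<close>

lemma poisson_sums: "(\<lambda>k. exp (- m) * m ^ k / fact k) sums (1 :: real)"
  using sums_mult[OF exp_converges[of m], of "exp (- m)"]
  by (simp add: exp_minus divide_inverse mult_ac)

locale poisson_process =
  fixes M :: "'a measure" and X :: "nat \<Rightarrow> 'a \<Rightarrow> 'e" and \<mu> :: "'e measure"
  assumes ppp: "poisson_point_process M X \<mu>"
begin

sublocale prob_space M using ppp by (simp add: poisson_point_process_def)

lemma measurable_point [measurable]: "X i \<in> M \<rightarrow>\<^sub>M \<mu>"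
  using ppp by (simp add: poisson_point_process_def)

lemma count_finite_mean:
  "A \<in> sets \<mu> \<Longrightarrow> emeasure \<mu> A < top \<Longrightarrow>
    prob {\<omega> \<in> space M. point_count X A \<omega> = of_nat k} = exp (- measure \<mu> A) * measure \<mu> A ^ k / fact k"
  using ppp by (simp add: poisson_point_process_def)

lemma count_infinite_mean:
  "A \<in> sets \<mu> \<Longrightarrow> emeasure \<mu> A = top \<Longrightarrow> AE \<omega> in M. point_count X A \<omega> = top"
  using ppp by (simp add: poisson_point_process_def)

lemma count_indep:
  "range A \<subseteq> sets \<mu> \<Longrightarrow> disjoint_family A \<Longrightarrow>
    indep_vars (\<lambda>_. borel) (\<lambda>n. point_count X (A n)) (UNIV :: nat set)"
  using ppp by (simp add: poisson_point_process_def)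

lemma point_count_eq: "point_count X A \<omega> = (\<integral>\<^sup>+ i. indicator A (X i \<omega>) \<partial>count_space UNIV)"
proof -
  have "point_count X A \<omega> = (\<integral>\<^sup>+ i. indicator {i. X i \<omega> \<in> A} i \<partial>count_space UNIV)"
    unfolding point_count_def by (rule nn_integral_indicator[symmetric]) simp
  then show ?thesis by (simp add: indicator_def)
qed

lemma measurable_point_sum:
  assumes [measurable]: "h \<in> borel_measurable \<mu>"
  shows "(\<lambda>\<omega>. \<integral>\<^sup>+ i. h (X i \<omega>) \<partial>count_space UNIV) \<in> borel_measurable M"
  unfolding nn_integral_count_space_nat by measurable

lemma measurable_count [measurable]: "A \<in> sets \<mu> \<Longrightarrow> point_count X A \<in> borel_measurable M"
  using measurable_point_sum[of "indicator A"] by (simp add: point_count_eq[abs_def])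

lemma point_count_cases:
  obtains k where "point_count X A \<omega> = of_nat k" | "point_count X A \<omega> = top"
  by (cases "finite {i. X i \<omega> \<in> A}") (auto simp: point_count_def)

text \<open>
  The Poisson weights sum to 1, which leaves no mass for an infinite count.
\<close>

lemma AE_count_finite:
  assumes A [measurable]: "A \<in> sets \<mu>" and fin: "emeasure \<mu> A < top"
  shows "AE \<omega> in M. point_count X A \<omega> \<noteq> top"
proof -
  let ?E = "\<lambda>k :: nat. {\<omega> \<in> space M. point_count X A \<omega> = of_nat k}"
  have "(\<lambda>k. prob (?E k)) sums prob (\<Union>k. ?E k)"
    by (rule finite_measure_UNION) (auto simp: disjoint_family_on_def)
  then have "prob (\<Union>k. ?E k) = 1"
    using poisson_sums[of "measure \<mu> A"] sums_unique2 by (simp add: count_finite_mean[OF assms])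
  then have "AE \<omega> in M. \<omega> \<in> (\<Union>k. ?E k)"
    by (subst (asm) prob_eq_1) auto
  then show ?thesis by eventually_elim (auto simp: ennreal_of_nat_eq_real_of_nat)
qed

lemma nn_integral_count:
  assumes A [measurable]: "A \<in> sets \<mu>" and fin: "emeasure \<mu> A < top"
  shows "(\<integral>\<^sup>+ \<omega>. \<phi> (point_count X A \<omega>) \<partial>M)
    = (\<Sum>k. \<phi> (of_nat k) * ennreal (exp (- measure \<mu> A) * measure \<mu> A ^ k / fact k))"
proof -
  let ?E = "\<lambda>k :: nat. {\<omega> \<in> space M. point_count X A \<omega> = of_nat k}"
  have "(\<integral>\<^sup>+ \<omega>. \<phi> (point_count X A \<omega>) \<partial>M) = (\<integral>\<^sup>+ \<omega>. (\<Sum>k. \<phi> (of_nat k) * indicator (?E k) \<omega>) \<partial>M)"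
  proof (rule nn_integral_cong_AE)
    show "AE \<omega> in M. \<phi> (point_count X A \<omega>) = (\<Sum>k. \<phi> (of_nat k) * indicator (?E k) \<omega>)"
      using AE_count_finite[OF assms] AE_space
    proof eventually_elim
      case (elim \<omega>)
      then obtain n where n: "point_count X A \<omega> = of_nat n" by (cases rule: point_count_cases[of A \<omega>]) auto
      have "(\<Sum>k. \<phi> (of_nat k) * indicator (?E k) \<omega>) = (\<Sum>k\<in>{n}. \<phi> (of_nat k) * indicator (?E k) \<omega>)"
        using elim n by (intro suminf_finite) (auto simp: indicator_def)
      then show ?case using elim n by simp
    qed
  qed
  also have "\<dots> = (\<Sum>k. \<integral>\<^sup>+ \<omega>. \<phi> (of_nat k) * indicator (?E k) \<omega> \<partial>M)"
    by (rule nn_integral_suminf) measurable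
  also have "\<dots> = (\<Sum>k. \<phi> (of_nat k) * emeasure M (?E k))"
    by (intro suminf_cong nn_integral_cmult_indicator) measurable
  finally show ?thesis
    by (simp add: emeasure_eq_measure count_finite_mean[OF assms])
qed

text \<open>
  The shift \<open>k p\<^sub>k = m p\<^sub>k\<^sub>-\<^sub>1\<close> of the Poisson weights reduces the mean to their total mass.
\<close>

lemma mean_count:
  assumes A [measurable]: "A \<in> sets \<mu>"
  shows "(\<integral>\<^sup>+ \<omega>. point_count X A \<omega> \<partial>M) = emeasure \<mu> A"
proof (cases "emeasure \<mu> A < top")
  case True
  let ?m = "measure \<mu> A"
  let ?p = "\<lambda>k. exp (- ?m) * ?m ^ k / fact k"
  have shift: "real (Suc k) * ?p (Suc k) = ?m * ?p k" for k
    by (simp add: fact_Suc field_simps del: of_nat_Suc)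
  have "(\<lambda>k. real (Suc k) * ?p (Suc k)) sums (?m * 1)"
    unfolding shift by (rule sums_mult[OF poisson_sums])
  then have "(\<lambda>k. real k * ?p k) sums ?m"
    by (subst (asm) sums_Suc_iff) simp
  then have "(\<Sum>k. ennreal (real k * ?p k)) = ennreal ?m"
    by (intro suminf_ennreal_eq) auto
  then show ?thesis
    using True by (subst nn_integral_count[OF A True])
      (simp add: ennreal_mult[symmetric] ennreal_of_nat_eq_real_of_nat emeasure_eq_ennreal_measure)
next
  case False
  then have top: "emeasure \<mu> A = top" by (simp add: less_top[symmetric])
  have "(\<integral>\<^sup>+ \<omega>. point_count X A \<omega> \<partial>M) = (\<integral>\<^sup>+ \<omega>. top \<partial>M)"
    using count_infinite_mean[OF A top] by (intro nn_integral_cong_AE) auto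
  then show ?thesis by (simp add: top emeasure_space_1)
qed

text \<open>
  On at least two points \<open>1 + N \<le> 2 N (N - 1)\<close>, and \<open>m\<^sup>2\<close> is the second factorial moment of the Poisson law. Being
  quadratic in the mean, the bound is negligible against it for rare sets.
\<close>

lemma multiple_points_bound:
  assumes A [measurable]: "A \<in> sets \<mu>" and fin: "emeasure \<mu> A < top"
  shows "(\<integral>\<^sup>+ \<omega>. (1 + point_count X A \<omega>) * indicator {2..} (point_count X A \<omega>) \<partial>M)
    \<le> ennreal (2 * (measure \<mu> A)\<^sup>2)"
proof -
  let ?m = "measure \<mu> A"
  let ?p = "\<lambda>k. exp (- ?m) * ?m ^ k / fact k"
  \<comment> \<open>The recursion of the Poisson weights, used twice.\<close>
  have shift: "real (Suc (Suc k)) * real (Suc k) * ?p (Suc (Suc k)) = ?m\<^sup>2 * ?p k" for k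
    by (simp add: fact_Suc field_simps power2_eq_square del: of_nat_Suc)
  have "(\<lambda>k. real (Suc (Suc k)) * real (Suc k) * ?p (Suc (Suc k))) sums (?m\<^sup>2 * 1)"
    unfolding shift by (rule sums_mult[OF poisson_sums])
  then have "(\<lambda>k. real (Suc k) * (real (Suc k) - 1) * ?p (Suc k)) sums ?m\<^sup>2"
    by (subst (asm) sums_Suc_iff) (simp add: algebra_simps)
  then have "(\<lambda>k. real k * (real k - 1) * ?p k) sums ?m\<^sup>2"
    by (subst (asm) sums_Suc_iff) simp
  then have s: "(\<lambda>k. 2 * (real k * (real k - 1) * ?p k)) sums (2 * ?m\<^sup>2)"
    by (rule sums_mult)
  have nonneg: "0 \<le> real k * (real k - 1)" for k by (cases k) auto
  have "(\<integral>\<^sup>+ \<omega>. (1 + point_count X A \<omega>) * indicator {2..} (point_count X A \<omega>) \<partial>M)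
      = (\<Sum>k. (1 + of_nat k) * indicator {2..} (of_nat k :: ennreal) * ennreal (?p k))"
    by (rule nn_integral_count[OF assms])
  also have "\<dots> \<le> (\<Sum>k. ennreal (2 * (real k * (real k - 1) * ?p k)))"
  proof (rule suminf_le)
    fix k :: nat
    show "(1 + of_nat k) * indicator {2..} (of_nat k :: ennreal) * ennreal (?p k)
        \<le> ennreal (2 * (real k * (real k - 1) * ?p k))"
    proof (cases "2 \<le> k")
      case True
      have "(1 + real k) * 1 \<le> (2 * real k) * (real k - 1)"
        using True by (intro mult_mono) auto
      then have "(1 + real k) * ?p k \<le> 2 * (real k * (real k - 1)) * ?p k"
        by (intro mult_right_mono) auto
      then have le: "ennreal ((1 + real k) * ?p k) \<le> ennreal (2 * (real k * (real k - 1) * ?p k))"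
        by (intro ennreal_leI) (simp only: mult.assoc)
      have eq: "(1 + of_nat k :: ennreal) = ennreal (1 + real k)"
        by (subst ennreal_plus) (simp_all add: ennreal_of_nat_eq_real_of_nat)
      have "(1 + of_nat k) * indicator {2..} (of_nat k :: ennreal) * ennreal (?p k)
          \<le> (1 + of_nat k) * ennreal (?p k)"
        by (simp add: indicator_def)
      also have "\<dots> = ennreal ((1 + real k) * ?p k)"
        unfolding eq by (rule ennreal_mult[symmetric]) auto
      finally show ?thesis using le by (rule order_trans)
    next
      case False
      then have "of_nat k < (2 :: ennreal)"
        by (metis not_le of_nat_less_iff of_nat_numeral)
      then show ?thesis by (simp add: not_le)
    qed
  qed auto
  also have "\<dots> = ennreal (2 * ?m\<^sup>2)"
    using s nonneg by (intro suminf_ennreal_eq) auto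
  finally show ?thesis .
qed

lemma void_probability:
  assumes A [measurable]: "A \<in> sets \<mu>"
  shows "emeasure M {\<omega> \<in> space M. \<forall>i. X i \<omega> \<notin> A} = nexp (emeasure \<mu> A)"
proof -
  have iff: "(\<forall>i. X i \<omega> \<notin> A) \<longleftrightarrow> point_count X A \<omega> = of_nat 0" for \<omega>
    by (auto simp: point_count_def emeasure_count_space_eq_0)
  show ?thesis
  proof (cases "emeasure \<mu> A < top")
    case True
    then show ?thesis
      unfolding iff emeasure_eq_measure count_finite_mean[OF A True]
      by (simp add: emeasure_eq_ennreal_measure)
  next
    case False
    then have top: "emeasure \<mu> A = top" by (simp add: less_top[symmetric])
    have "AE \<omega> in M. \<not> (point_count X A \<omega> = of_nat 0)"
      using count_infinite_mean[OF A top] by eventually_elim simp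
    then have "emeasure M {\<omega> \<in> space M. point_count X A \<omega> = of_nat 0} = 0"
      by (subst (asm) AE_iff_measurable[OF _ refl]) auto
    then show ?thesis unfolding iff top by simp
  qed
qed

text \<open>
  Both sides are \<open>\<sigma>\<close>-additive in \<open>h\<close>, so the mean count of a set is all that matters.
\<close>

lemma campbell:
  assumes "h \<in> borel_measurable \<mu>"
  shows "(\<integral>\<^sup>+ \<omega>. (\<integral>\<^sup>+ i. h (X i \<omega>) \<partial>count_space UNIV) \<partial>M) = (\<integral>\<^sup>+ x. h x \<partial>\<mu>)"
  using assms
proof (induction rule: borel_measurable_induct)
  case (cong f g)
  have "(\<integral>\<^sup>+ \<omega>. (\<integral>\<^sup>+ i. f (X i \<omega>) \<partial>count_space UNIV) \<partial>M)
      = (\<integral>\<^sup>+ \<omega>. (\<integral>\<^sup>+ i. g (X i \<omega>) \<partial>count_space UNIV) \<partial>M)"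
    using measurable_space[OF measurable_point] cong(3)
    by (intro nn_integral_cong) auto
  then show ?case using cong by (simp cong: nn_integral_cong)
next
  case (set A)
  then show ?case using mean_count[OF set] by (simp add: point_count_eq)
next
  case (mult u c)
  then show ?case
    by (simp add: nn_integral_cmult measurable_point_sum)
next
  case (add u v)
  then show ?case
    by (simp add: nn_integral_add measurable_point_sum)
next
  case (seq U)
  have "(\<integral>\<^sup>+ i. (SUP n. U n (X i \<omega>)) \<partial>count_space UNIV)
      = (SUP n. \<integral>\<^sup>+ i. U n (X i \<omega>) \<partial>count_space UNIV)" for \<omega>
    using seq by (intro nn_integral_monotone_convergence_SUP) (auto simp: incseq_def le_fun_def)
  moreover have "(\<integral>\<^sup>+ \<omega>. (SUP n. \<integral>\<^sup>+ i. U n (X i \<omega>) \<partial>count_space UNIV) \<partial>M)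
      = (SUP n. \<integral>\<^sup>+ \<omega>. (\<integral>\<^sup>+ i. U n (X i \<omega>) \<partial>count_space UNIV) \<partial>M)"
    using seq by (intro nn_integral_monotone_convergence_SUP measurable_point_sum)
      (auto simp: incseq_def le_fun_def intro!: nn_integral_mono)
  moreover have "(\<integral>\<^sup>+ x. (SUP n. U n x) \<partial>\<mu>) = (SUP n. \<integral>\<^sup>+ x. U n x \<partial>\<mu>)"
    using seq by (intro nn_integral_monotone_convergence_SUP) auto
  ultimately show ?case using seq by (simp add: SUP_apply image_comp)
qed

lemma laplace_count:
  assumes A [measurable]: "A \<in> sets \<mu>"
  shows "(\<integral>\<^sup>+ \<omega>. nexp (point_count X A \<omega> * c) \<partial>M) = nexp (emeasure \<mu> A * (1 - nexp c))"
proof (cases "emeasure \<mu> A < top")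
  case True
  let ?m = "measure \<mu> A"
  obtain q where q: "nexp c = ennreal q" "0 \<le> q" "q \<le> 1"
    using nexp_le_1[of c] by (cases "nexp c") (auto simp: top_unique)
  have "(\<lambda>k. exp (- ?m) * ((?m * q) ^ k / fact k)) sums (exp (- ?m) * exp (?m * q))"
    by (intro sums_mult) (use exp_converges[of "?m * q"] in \<open>simp add: divide_inverse mult_ac\<close>)
  then have s: "(\<lambda>k. q ^ k * (exp (- ?m) * ?m ^ k / fact k)) sums exp (- (?m * (1 - q)))"
    by (simp add: exp_add[symmetric] power_mult_distrib algebra_simps)
  have "(\<integral>\<^sup>+ \<omega>. nexp (point_count X A \<omega> * c) \<partial>M)
      = (\<Sum>k. nexp (of_nat k * c) * ennreal (exp (- ?m) * ?m ^ k / fact k))"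
    by (rule nn_integral_count[OF A True])
  also have "\<dots> = (\<Sum>k. ennreal (q ^ k * (exp (- ?m) * ?m ^ k / fact k)))"
    using q by (intro suminf_cong) (simp add: nexp_of_nat_mult ennreal_power ennreal_mult[symmetric])
  also have "\<dots> = ennreal (exp (- (?m * (1 - q))))"
    using q s by (intro suminf_ennreal_eq) auto
  also have "\<dots> = nexp (ennreal (?m * (1 - q)))"
    using q by (intro nexp_ennreal[symmetric]) simp
  also have "ennreal (?m * (1 - q)) = emeasure \<mu> A * (1 - nexp c)"
    using True q by (simp add: emeasure_eq_ennreal_measure ennreal_mult ennreal_minus[symmetric] flip: ennreal_1)
  finally show ?thesis .
next
  case False
  then have top: "emeasure \<mu> A = top" by (simp add: less_top[symmetric])
  show ?thesis
  proof (cases "c = 0")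
    case False
    then have "1 - nexp c \<noteq> 0"
      using nexp_eq_1_iff[of c] nexp_le_1[of c] by (auto simp: diff_eq_0_iff_ennreal)
    moreover have "(\<integral>\<^sup>+ \<omega>. nexp (point_count X A \<omega> * c) \<partial>M) = (\<integral>\<^sup>+ \<omega>. 0 \<partial>M)"
      using count_infinite_mean[OF A top] False
      by (intro nn_integral_cong_AE) (auto elim!: eventually_mono simp: ennreal_top_mult)
    ultimately show ?thesis by (simp add: top ennreal_top_mult)
  qed (simp add: emeasure_space_1)
qed

end

context poisson_process
begin

text \<open>
  The level sets of a simple function are disjoint, hence have independent counts.
\<close>

lemma laplace_simple:
  assumes h: "simple_function \<mu> h"
  shows "(\<integral>\<^sup>+ \<omega>. nexp (\<integral>\<^sup>+ i. h (X i \<omega>) \<partial>count_space UNIV) \<partial>M)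
    = nexp (\<integral>\<^sup>+ x. 1 - nexp (h x) \<partial>\<mu>)"
proof -
  have fin: "finite (h ` space \<mu>)" using h by (rule simple_functionD(1))
  define n where "n = card (h ` space \<mu>)"
  obtain b where b: "bij_betw b {0..<n} (h ` space \<mu>)"
    using ex_bij_betw_nat_finite[OF fin] by (auto simp: n_def)
  \<comment> \<open>Padding by empty sets, as the counts are independent along infinite sequences of sets.\<close>
  define A where "A k = (if k < n then h -` {b k} \<inter> space \<mu> else {})" for k
  have A [measurable]: "A k \<in> sets \<mu>" for k
    using simple_functionD(2)[OF h] by (simp add: A_def)
  have inj: "b j = b k \<longleftrightarrow> j = k" if "j < n" "k < n" for j k
    using inj_on_eq_iff[OF bij_betw_imp_inj_on[OF b], of j k] that by simp
  have disj: "disjoint_family A"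
  proof (unfold disjoint_family_on_def, intro ballI impI)
    fix j k :: nat assume "j \<noteq> k"
    show "A j \<inter> A k = {}"
    proof (cases "j < n \<and> k < n")
      case True
      then have "b j \<noteq> b k" using inj[of j k] \<open>j \<noteq> k\<close> by blast
      then show ?thesis using True by (auto simp: A_def)
    qed (auto simp: A_def)
  qed
  have repr: "f (h x) = (\<Sum>k<n. f (b k) * indicator (A k) x)" if "x \<in> space \<mu>" for x and f :: "ennreal \<Rightarrow> ennreal"
  proof -
    have "h x \<in> b ` {0..<n}" unfolding bij_betw_imp_surj_on[OF b] using that by (rule imageI)
    then obtain k where k: "k < n" "h x = b k" by auto
    have "indicator (A j) x = (if j = k then 1 else 0 :: ennreal)" if "j < n" for j
      using k that inj[of j k] \<open>x \<in> space \<mu>\<close> by (cases "j = k") (auto simp: A_def)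
    then have "(\<Sum>j<n. f (b j) * indicator (A j) x) = (\<Sum>j<n. if j = k then f (b j) else 0)"
      by (intro sum.cong) auto
    also have "\<dots> = f (b k)" using k(1) by simp
    finally show ?thesis using k(2) by simp
  qed
  have "(\<integral>\<^sup>+ i. h (X i \<omega>) \<partial>count_space UNIV) = (\<Sum>k<n. point_count X (A k) \<omega> * b k)"
    if "\<omega> \<in> space M" for \<omega>
  proof -
    have "(\<integral>\<^sup>+ i. h (X i \<omega>) \<partial>count_space UNIV)
        = (\<integral>\<^sup>+ i. (\<Sum>k<n. b k * indicator (A k) (X i \<omega>)) \<partial>count_space UNIV)"
      by (intro nn_integral_cong repr[of _ "\<lambda>x. x"] measurable_space[OF measurable_point that])
    also have "\<dots> = (\<Sum>k<n. b k * point_count X (A k) \<omega>)"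
      unfolding point_count_eq by (subst nn_integral_sum) (simp_all add: nn_integral_cmult)
    also have "\<dots> = (\<Sum>k<n. point_count X (A k) \<omega> * b k)"
      by (simp only: mult.commute)
    finally show ?thesis .
  qed
  then have "(\<integral>\<^sup>+ \<omega>. nexp (\<integral>\<^sup>+ i. h (X i \<omega>) \<partial>count_space UNIV) \<partial>M)
      = (\<integral>\<^sup>+ \<omega>. (\<Prod>k<n. nexp (point_count X (A k) \<omega> * b k)) \<partial>M)"
    by (intro nn_integral_cong) (simp add: nexp_sum)
  also have "\<dots> = (\<Prod>k<n. \<integral>\<^sup>+ \<omega>. nexp (point_count X (A k) \<omega> * b k) \<partial>M)"
  proof (rule indep_vars_nn_integral)
    have "indep_vars (\<lambda>_. borel) (\<lambda>k. point_count X (A k)) {..<n}"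
      by (rule indep_vars_subset[OF count_indep]) (use disj in auto)
    then show "indep_vars (\<lambda>_. borel) (\<lambda>k \<omega>. nexp (point_count X (A k) \<omega> * b k)) {..<n}"
      by (rule indep_vars_compose2[where Y = "\<lambda>k x. nexp (x * b k)"]) measurable
  qed auto
  also have "\<dots> = nexp (\<Sum>k<n. emeasure \<mu> (A k) * (1 - nexp (b k)))"
    by (simp add: laplace_count nexp_sum)
  also have "(\<Sum>k<n. emeasure \<mu> (A k) * (1 - nexp (b k))) = (\<Sum>k<n. (1 - nexp (b k)) * emeasure \<mu> (A k))"
    by (simp only: mult.commute)
  also have "\<dots> = (\<Sum>k<n. \<integral>\<^sup>+ x. (1 - nexp (b k)) * indicator (A k) x \<partial>\<mu>)"
    by (intro sum.cong refl nn_integral_cmult_indicator[symmetric] A)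
  also have "\<dots> = (\<integral>\<^sup>+ x. (\<Sum>k<n. (1 - nexp (b k)) * indicator (A k) x) \<partial>\<mu>)"
    by (rule nn_integral_sum[symmetric]) simp
  also have "\<dots> = (\<integral>\<^sup>+ x. 1 - nexp (h x) \<partial>\<mu>)"
    by (rule nn_integral_cong, rule repr[of _ "\<lambda>v. 1 - nexp v", symmetric])
  finally show ?thesis .
qed

text \<open>
  Approximation of \<open>h\<close> by simple functions from below; \<open>nexp\<close> is continuous, also at infinity.
\<close>

lemma laplace_functional:
  assumes h [measurable]: "h \<in> borel_measurable \<mu>"
  shows "(\<integral>\<^sup>+ \<omega>. nexp (\<integral>\<^sup>+ i. h (X i \<omega>) \<partial>count_space UNIV) \<partial>M)
    = nexp (\<integral>\<^sup>+ x. 1 - nexp (h x) \<partial>\<mu>)"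
proof -
  obtain s where s: "\<And>n. simple_function \<mu> (s n)" "incseq s" "\<And>x. (SUP n. s n x) = h x"
    by (rule borel_measurable_implies_simple_function_sequence'[OF h]) (rule that)
  have mono: "incseq (\<lambda>n. s n x)" for x using s(2) by (auto simp: incseq_def le_fun_def)
  have [measurable]: "s n \<in> borel_measurable \<mu>" for n
    by (rule borel_measurable_simple_function[OF s(1)])
  have lim: "(\<lambda>n. s n x) \<longlonglongrightarrow> h x" for x
    using LIMSEQ_SUP[OF mono[of x]] s(3) by simp
  let ?S = "\<lambda>h \<omega>. \<integral>\<^sup>+ i. h (X i \<omega>) \<partial>count_space UNIV"
  have limS: "(\<lambda>n. ?S (s n) \<omega>) \<longlonglongrightarrow> ?S h \<omega>" for \<omega>
  proof -
    have "?S h \<omega> = (SUP n. ?S (s n) \<omega>)"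
      unfolding s(3)[symmetric]
      using s(2) by (intro nn_integral_monotone_convergence_SUP) (simp_all add: incseq_def le_fun_def)
    moreover have "incseq (\<lambda>n. ?S (s n) \<omega>)"
      by (rule incseq_SucI, rule nn_integral_mono, rule incseq_SucD[OF mono])
    ultimately show ?thesis using LIMSEQ_SUP[of "\<lambda>n. ?S (s n) \<omega>"] by simp
  qed
  have L1: "(\<lambda>n. \<integral>\<^sup>+ \<omega>. nexp (?S (s n) \<omega>) \<partial>M) \<longlonglongrightarrow> (\<integral>\<^sup>+ \<omega>. nexp (?S h \<omega>) \<partial>M)"
  proof (rule nn_integral_dominated_convergence[where w = "\<lambda>_. 1"])
    show "(\<lambda>\<omega>. nexp (?S (s n) \<omega>)) \<in> borel_measurable M" for n
      by (rule measurable_compose[OF measurable_point_sum measurable_nexp]) simp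
    show "(\<lambda>\<omega>. nexp (?S h \<omega>)) \<in> borel_measurable M"
      by (rule measurable_compose[OF measurable_point_sum measurable_nexp]) simp
    show "AE \<omega> in M. (\<lambda>n. nexp (?S (s n) \<omega>)) \<longlonglongrightarrow> nexp (?S h \<omega>)"
      by (rule AE_I2, rule tendsto_nexp, rule limS)
  qed (simp_all add: nexp_le_1 emeasure_space_1)
  have L2: "(\<lambda>n. nexp (\<integral>\<^sup>+ x. 1 - nexp (s n x) \<partial>\<mu>)) \<longlonglongrightarrow> nexp (\<integral>\<^sup>+ x. 1 - nexp (h x) \<partial>\<mu>)"
  proof (rule tendsto_nexp)
    have inc: "incseq (\<lambda>n. 1 - nexp (s n x))" for x
      by (rule incseq_SucI, rule ennreal_minus_mono[OF order_refl], rule nexp_antimono, rule incseq_SucD[OF mono])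
    have lim1: "(\<lambda>n. 1 - nexp (s n x)) \<longlonglongrightarrow> 1 - nexp (h x)" for x
      by (intro tendsto_diff_ennreal tendsto_const tendsto_nexp lim) auto
    have sup: "(SUP n. 1 - nexp (s n x)) = 1 - nexp (h x)" for x
      by (rule LIMSEQ_unique[OF LIMSEQ_SUP[OF inc[of x]] lim1])
    have "(\<integral>\<^sup>+ x. 1 - nexp (h x) \<partial>\<mu>) = (SUP n. \<integral>\<^sup>+ x. 1 - nexp (s n x) \<partial>\<mu>)"
      unfolding sup[symmetric] using inc
      by (intro nn_integral_monotone_convergence_SUP) (simp_all add: incseq_def le_fun_def)
    moreover have "incseq (\<lambda>n. \<integral>\<^sup>+ x. 1 - nexp (s n x) \<partial>\<mu>)"
      by (rule incseq_SucI, rule nn_integral_mono, rule incseq_SucD[OF inc])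
    ultimately show "(\<lambda>n. \<integral>\<^sup>+ x. 1 - nexp (s n x) \<partial>\<mu>) \<longlonglongrightarrow> (\<integral>\<^sup>+ x. 1 - nexp (h x) \<partial>\<mu>)"
      using LIMSEQ_SUP[of "\<lambda>n. \<integral>\<^sup>+ x. 1 - nexp (s n x) \<partial>\<mu>"] by simp
  qed
  from L1[unfolded laplace_simple[OF s(1)]] L2 show ?thesis by (rule LIMSEQ_unique)
qed

text \<open>
  Given the points, the marks are independent, so the conditional probability of avoiding \<open>B\<close> is a product over the points.
  Written as \<open>nexp\<close> of a sum, its expectation is a Laplace functional.
\<close>

lemma marked_void_probability:
  fixes Q :: "nat \<Rightarrow> 'a \<Rightarrow> 'q :: topological_space" and L :: "'q measure"
  assumes Q: "\<And>i. Q i \<in> borel_measurable M" and L: "\<And>i. distr M borel (Q i) = L"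
    and iid: "indep_vars (\<lambda>_. borel) Q UNIV"
    and indep: "indep_set
      (sets (vimage_algebra (space M) (\<lambda>\<omega> i. X i \<omega>) (Pi\<^sub>M UNIV (\<lambda>_. \<mu>))))
      (sets (vimage_algebra (space M) (\<lambda>\<omega> i. Q i \<omega>) (Pi\<^sub>M UNIV (\<lambda>_. borel))))"
    and B: "B \<in> sets (\<mu> \<Otimes>\<^sub>M borel)"
  shows "emeasure M {\<omega> \<in> space M. \<forall>i. (X i \<omega>, Q i \<omega>) \<notin> B}
    = nexp (\<integral>\<^sup>+ x. emeasure L (Pair x -` B) \<partial>\<mu>)"
proof -
  let ?PX = "Pi\<^sub>M (UNIV :: nat set) (\<lambda>_. \<mu>)" and ?PQ = "Pi\<^sub>M (UNIV :: nat set) (\<lambda>_. borel :: 'q measure)"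
  let ?PL = "Pi\<^sub>M (UNIV :: nat set) (\<lambda>_. L)"
  let ?Xs = "\<lambda>\<omega> i. X i \<omega>" and ?Qs = "\<lambda>\<omega> i. Q i \<omega>"
  have setsL [simp, measurable_cong]: "sets L = sets borel" using L[of 0] by auto
  have spaceL [simp]: "space L = UNIV" using sets_eq_imp_space_eq[OF setsL] by simp
  have prob_L: "prob_space L" using L[of 0] prob_space_distr[OF Q[of 0]] by simp
  interpret L: prob_space L by (rule prob_L)
  interpret PL: product_prob_space "\<lambda>_ :: nat. L" UNIV by standard
  interpret SL: sequence_space L ..
  have prob_PL: "prob_space ?PL" by (rule prob_space_PiM) (rule prob_L)
  note sf_PL = prob_space_imp_sigma_finite[OF prob_PL]
  have Xs [measurable]: "?Xs \<in> M \<rightarrow>\<^sub>M ?PX"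
    by (rule measurable_PiM_single') (use measurable_space[OF measurable_point] in auto)
  have Qs [measurable]: "?Qs \<in> M \<rightarrow>\<^sub>M ?PQ"
    by (rule measurable_PiM_single') (use Q in auto)
  have joint: "distr M ?PX ?Xs \<Otimes>\<^sub>M distr M ?PQ ?Qs = distr M (?PX \<Otimes>\<^sub>M ?PQ) (\<lambda>\<omega>. (?Xs \<omega>, ?Qs \<omega>))"
  proof (rule pair_measure_eqI)
    show "sigma_finite_measure (distr M ?PX ?Xs)" "sigma_finite_measure (distr M ?PQ ?Qs)"
      using prob_space_distr[OF Xs] prob_space_distr[OF Qs]
      by (auto intro: prob_space_imp_sigma_finite)
    show "sets (distr M ?PX ?Xs \<Otimes>\<^sub>M distr M ?PQ ?Qs) = sets (distr M (?PX \<Otimes>\<^sub>M ?PQ) (\<lambda>\<omega>. (?Xs \<omega>, ?Qs \<omega>)))"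
      unfolding sets_distr by (rule sets_pair_measure_cong) simp_all
    fix A D assume "A \<in> sets (distr M ?PX ?Xs)" "D \<in> sets (distr M ?PQ ?Qs)"
    then have [measurable]: "A \<in> sets ?PX" "D \<in> sets ?PQ" by simp_all
    have eq: "(\<lambda>\<omega>. (?Xs \<omega>, ?Qs \<omega>)) -` (A \<times> D) \<inter> space M = (?Xs -` A \<inter> space M) \<inter> (?Qs -` D \<inter> space M)"
      by auto
    have "prob ((?Xs -` A \<inter> space M) \<inter> (?Qs -` D \<inter> space M)) = prob (?Xs -` A \<inter> space M) * prob (?Qs -` D \<inter> space M)"
      by (rule indep_setD[OF indep]) (simp_all add: in_vimage_algebra)
    then show "emeasure (distr M ?PX ?Xs) A * emeasure (distr M ?PQ ?Qs) D
        = emeasure (distr M (?PX \<Otimes>\<^sub>M ?PQ) (\<lambda>\<omega>. (?Xs \<omega>, ?Qs \<omega>))) (A \<times> D)"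
      by (simp add: emeasure_distr eq emeasure_eq_measure ennreal_mult)
  qed
  have "distr M ?PQ (\<lambda>\<omega>. \<lambda>i\<in>UNIV. Q i \<omega>) = Pi\<^sub>M UNIV (\<lambda>i. distr M borel (Q i))"
    using iid Q by (subst (asm) indep_vars_iff_distr_eq_PiM) auto
  then have lawQ: "distr M ?PQ ?Qs = ?PL" by (simp add: L restrict_def)
  define B' where "B' = space (\<mu> \<Otimes>\<^sub>M L) - B"
  have sets_eq: "sets (\<mu> \<Otimes>\<^sub>M L) = sets (\<mu> \<Otimes>\<^sub>M borel)"
    by (intro sets_pair_measure_cong) simp_all
  have B' [measurable]: "B' \<in> sets (\<mu> \<Otimes>\<^sub>M L)" unfolding B'_def
    by (rule sets.compl_sets) (use B in \<open>simp only: sets_eq\<close>)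
  have C: "Pair x -` B' \<in> sets L" for x by (rule sets_Pair1[OF B'])
  define c where "c x = emeasure L (Pair x -` B')" for x
  have c [measurable]: "c \<in> borel_measurable \<mu>"
    unfolding c_def by (rule L.measurable_emeasure_Pair[OF B'])
  have compl: "1 - c x = emeasure L (Pair x -` B)" if "x \<in> space \<mu>" for x
  proof -
    have "Pair x -` B = space L - Pair x -` B'"
      using that by (auto simp: B'_def space_pair_measure)
    then show ?thesis
      using emeasure_compl[OF C[of x]] L.emeasure_space_1 by (simp add: c_def)
  qed
  \<comment> \<open>Chosen such that \<open>nexp (h x)\<close> is the probability that the mark of a point at \<open>x\<close> avoids \<open>B\<close>.\<close>
  define h where "h x = (if c x = 0 then top else ennreal (- ln (enn2real (c x))))" for x
  have h [measurable]: "h \<in> borel_measurable \<mu>" unfolding h_def by measurable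
  have nexp_h: "nexp (h x) = c x" for x
    unfolding h_def by (rule nexp_inverse) (simp add: c_def L.emeasure_le_1)
  define S where "S = {p \<in> space (?PX \<Otimes>\<^sub>M ?PQ). \<forall>i. (fst p i, snd p i) \<in> B'}"
  have S: "S \<in> sets (?PX \<Otimes>\<^sub>M ?PQ)"
  proof -
    have "(\<lambda>p. (fst p i, snd p i)) \<in> ?PX \<Otimes>\<^sub>M ?PQ \<rightarrow>\<^sub>M \<mu> \<Otimes>\<^sub>M L" for i by measurable
    then show ?thesis unfolding S_def by measurable
  qed
  have S': "S \<in> sets (distr M ?PX ?Xs \<Otimes>\<^sub>M ?PL)"
    using S sets_pair_measure_cong[of "distr M ?PX ?Xs" ?PX ?PL ?PQ]
    by (simp cong: sets_PiM_cong)
  have slice: "emeasure ?PL (Pair (?Xs \<omega>) -` S) = nexp (\<integral>\<^sup>+ i. h (X i \<omega>) \<partial>count_space UNIV)"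
    if \<omega>: "\<omega> \<in> space M" for \<omega>
  proof -
    have "Pair (?Xs \<omega>) -` S = Pi UNIV (\<lambda>i. Pair (X i \<omega>) -` B')"
      using measurable_space[OF Xs \<omega>] by (auto simp: S_def space_pair_measure space_PiM)
    then have "(\<lambda>n. \<Prod>i\<le>n. measure L (Pair (X i \<omega>) -` B')) \<longlonglongrightarrow> measure ?PL (Pair (?Xs \<omega>) -` S)"
      using SL.measure_PiM_countable[of "\<lambda>i. Pair (X i \<omega>) -` B'"] C by simp
    then have "(\<lambda>n. ennreal (\<Prod>i\<le>n. measure L (Pair (X i \<omega>) -` B'))) \<longlonglongrightarrow> emeasure ?PL (Pair (?Xs \<omega>) -` S)"
      by (simp add: finite_measure.emeasure_eq_measure[OF prob_space.axioms(1)[OF prob_PL]])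
    also have "(\<lambda>n. ennreal (\<Prod>i\<le>n. measure L (Pair (X i \<omega>) -` B'))) = (\<lambda>n. nexp (\<Sum>i\<le>n. h (X i \<omega>)))"
      by (simp add: nexp_sum nexp_h c_def L.emeasure_eq_measure prod_ennreal)
    finally have "(\<lambda>n. nexp (\<Sum>i\<le>n. h (X i \<omega>))) \<longlonglongrightarrow> emeasure ?PL (Pair (?Xs \<omega>) -` S)" .
    moreover have "(\<lambda>n. nexp (\<Sum>i\<le>n. h (X i \<omega>))) \<longlonglongrightarrow> nexp (\<Sum>i. h (X i \<omega>))"
      by (intro tendsto_nexp summable_LIMSEQ') simp
    ultimately show ?thesis by (simp add: nn_integral_count_space_nat LIMSEQ_unique)
  qed
  have "{\<omega> \<in> space M. \<forall>i. (X i \<omega>, Q i \<omega>) \<notin> B} = (\<lambda>\<omega>. (?Xs \<omega>, ?Qs \<omega>)) -` S \<inter> space M"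
    using measurable_space[OF measurable_point] measurable_space[OF Xs] measurable_space[OF Qs]
    by (auto simp: S_def B'_def space_pair_measure)
  then have "emeasure M {\<omega> \<in> space M. \<forall>i. (X i \<omega>, Q i \<omega>) \<notin> B}
      = emeasure (distr M (?PX \<Otimes>\<^sub>M ?PQ) (\<lambda>\<omega>. (?Xs \<omega>, ?Qs \<omega>))) S"
    using S by (subst emeasure_distr) auto
  also have "\<dots> = emeasure (distr M ?PX ?Xs \<Otimes>\<^sub>M ?PL) S"
    by (simp add: joint[symmetric] lawQ)
  also have "\<dots> = (\<integral>\<^sup>+ x. emeasure ?PL (Pair x -` S) \<partial>distr M ?PX ?Xs)"
    by (rule sigma_finite_measure.emeasure_pair_measure_alt[OF sf_PL S'])
  also have "\<dots> = (\<integral>\<^sup>+ \<omega>. emeasure ?PL (Pair (?Xs \<omega>) -` S) \<partial>M)"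
    using sigma_finite_measure.measurable_emeasure_Pair[OF sf_PL S'] by (intro nn_integral_distr[OF Xs]) simp
  also have "\<dots> = (\<integral>\<^sup>+ \<omega>. nexp (\<integral>\<^sup>+ i. h (X i \<omega>) \<partial>count_space UNIV) \<partial>M)"
    by (intro nn_integral_cong slice)
  also have "\<dots> = nexp (\<integral>\<^sup>+ x. 1 - nexp (h x) \<partial>\<mu>)"
    by (rule laplace_functional[OF h])
  also have "(\<integral>\<^sup>+ x. 1 - nexp (h x) \<partial>\<mu>) = (\<integral>\<^sup>+ x. emeasure L (Pair x -` B) \<partial>\<mu>)"
    by (intro nn_integral_cong) (simp add: nexp_h compl)
  finally show ?thesis .
qed

end

section \<open>Maxima of families of points\<close>

text \<open>
  Lower orthants in finitely many coordinates are stable under intersection and generate the Borel sets.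
\<close>

lemma measure_eqI_cdf:
  fixes P Q :: "(int \<Rightarrow> real) measure"
  assumes "prob_space P" "sets P = sets borel" "sets Q = sets borel"
    and eq: "\<And>J x. finite J \<Longrightarrow> emeasure P {y. \<forall>j\<in>J. y j \<le> x j} = emeasure Q {y. \<forall>j\<in>J. y j \<le> x j}"
  shows "P = Q"
proof -
  let ?E = "{{y :: int \<Rightarrow> real. \<forall>j\<in>J. y j \<le> x j} | J x. finite J}"
  have "sets borel = sigma_sets UNIV ?E"
  proof
    show "sets borel \<subseteq> sigma_sets UNIV ?E"
    proof
      fix A :: "(int \<Rightarrow> real) set" assume A: "A \<in> sets borel"
      have "(\<lambda>y. y) \<in> borel_measurable (sigma UNIV ?E)"
      proof (rule measurable_seqI, rule borel_measurable_iff_le[THEN iffD2], rule allI)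
        fix i a
        have "{y :: int \<Rightarrow> real. y i \<le> a} \<in> ?E" by (intro CollectI exI[of _ "{i}"] exI[of _ "\<lambda>_. a"]) auto
        then show "{y \<in> space (sigma UNIV ?E). y i \<le> a} \<in> sets (sigma UNIV ?E)" by auto
      qed
      from measurable_sets[OF this A] show "A \<in> sigma_sets UNIV ?E" by simp
    qed
    have "{y :: int \<Rightarrow> real. \<forall>j\<in>J. y j \<le> x j} \<in> sets borel" if "finite J" for J x
      using that by measurable
    then have "?E \<subseteq> sets borel" by auto
    then show "sigma_sets UNIV ?E \<subseteq> sets borel"
      using sets.sigma_sets_subset[of ?E borel] by simp
  qed
  note gen = this
  interpret P: prob_space P by fact
  show ?thesis
  proof (rule measure_eqI_generator_eq[where E = ?E and \<Omega> = UNIV and A = "\<lambda>_. UNIV"])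
    show "Int_stable ?E"
    proof (rule Int_stableI)
      fix A B assume "A \<in> ?E" "B \<in> ?E"
      then obtain J x K z where
        A: "A = {y. \<forall>j\<in>J. y j \<le> x j}" "finite J" and B: "B = {y. \<forall>j\<in>K. y j \<le> z j}" "finite K" by auto
      let ?w = "\<lambda>j. if j \<in> J \<inter> K then min (x j) (z j) else if j \<in> J then x j else z j"
      have "A \<inter> B = {y. \<forall>j\<in>J \<union> K. y j \<le> ?w j}" unfolding A B by (auto split: if_splits)
      then show "A \<inter> B \<in> ?E" using A B by (intro CollectI exI[of _ "J \<union> K"] exI[of _ ?w]) auto
    qed
    show "emeasure P X = emeasure Q X" if "X \<in> ?E" for X using that eq by auto
    show "range (\<lambda>_. UNIV) \<subseteq> ?E" by (auto intro!: exI[of _ "{}"])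
    show "sets P = sigma_sets UNIV ?E" "sets Q = sigma_sets UNIV ?E" using assms gen by simp_all
  qed auto
qed

text \<open>
  A family of points, not necessarily Poisson, that avoids the sets \<open>{y. \<exists>j\<in>J. x j < y j}\<close> with the same probability as a Poisson
  process of mean measure \<open>\<nu>\<close>. Both the Poisson points \<open>W i\<close> and the terms of the M3 representation are of this kind, and
  the law of the maximum depends on nothing else.
\<close>

locale max_stable_points = prob_space N for N :: "'b measure" +
  fixes Z :: "nat \<Rightarrow> 'b \<Rightarrow> int \<Rightarrow> real" and \<alpha> :: real and \<nu> :: "(int \<Rightarrow> real) measure"
  assumes exponent_pos: "0 < \<alpha>"
    and Z_measurable [measurable]: "\<And>i. Z i \<in> borel_measurable N"
    and sets_exponent [simp, measurable_cong]: "sets \<nu> = sets borel"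
    and exponent_tail: "\<And>j x. 0 < x \<Longrightarrow> emeasure \<nu> {y. x < y j} = ennreal (x powr (- \<alpha>))"
    and avoidance: "\<And>J x. finite J \<Longrightarrow>
      emeasure N {\<omega> \<in> space N. \<forall>i. \<forall>j\<in>J. Z i \<omega> j \<le> x j} = nexp (emeasure \<nu> {y. \<exists>j\<in>J. x j < y j})"
begin

lemma Z_coord [measurable]: "(\<lambda>\<omega>. Z i \<omega> j) \<in> borel_measurable N"
  by (rule measurable_coordinate') measurable

lemma bdd_iff: "bdd_above (range (\<lambda>i. Z i \<omega> j)) \<longleftrightarrow> (\<exists>n :: nat. \<forall>i. Z i \<omega> j \<le> real (Suc n))"
proof
  assume "bdd_above (range (\<lambda>i. Z i \<omega> j))"
  then obtain b where b: "\<And>i. Z i \<omega> j \<le> b" by (auto simp: bdd_above_def)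
  obtain n where "b \<le> real n" using real_arch_simple by blast
  then have "Z i \<omega> j \<le> real (Suc n)" for i using b[of i] by simp
  then show "\<exists>n :: nat. \<forall>i. Z i \<omega> j \<le> real (Suc n)" by blast
qed (auto simp: bdd_above_def)

text \<open>
  All points stay below \<open>n\<close> at time \<open>j\<close> with probability \<open>exp (- (n powr (- \<alpha>)))\<close>, which tends to 1.
\<close>

lemma AE_bdd: "AE \<omega> in N. \<forall>j. bdd_above (range (\<lambda>i. Z i \<omega> j))"
  unfolding AE_all_countable
proof
  fix j
  let ?E = "\<lambda>n :: nat. {\<omega> \<in> space N. \<forall>i. Z i \<omega> j \<le> real (Suc n)}"
  have [measurable]: "?E n \<in> sets N" for n by measurable
  have "emeasure N (?E n) = ennreal (exp (- (real (Suc n) powr (- \<alpha>))))" for n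
    using avoidance[of "{j}" "\<lambda>_. real (Suc n)"] by (simp add: exponent_tail)
  then have val: "prob (?E n) = exp (- (real (Suc n) powr (- \<alpha>)))" for n
    by (simp add: emeasure_eq_measure)
  have "(\<lambda>n. real (Suc n) powr (- \<alpha>)) \<longlonglongrightarrow> 0"
    using exponent_pos filterlim_compose[OF filterlim_real_sequentially filterlim_Suc]
    by (intro tendsto_neg_powr) auto
  then have "(\<lambda>n. exp (- (real (Suc n) powr (- \<alpha>)))) \<longlonglongrightarrow> exp (- 0)"
    by (intro tendsto_intros)
  then have "(\<lambda>n. prob (?E n)) \<longlonglongrightarrow> 1" by (simp only: val minus_zero exp_zero)
  moreover have "(\<lambda>n. prob (?E n)) \<longlonglongrightarrow> prob (\<Union>n. ?E n)"
    by (rule finite_Lim_measure_incseq) (auto simp: incseq_def intro: order_trans)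
  ultimately have "prob (\<Union>n. ?E n) = 1" by (rule LIMSEQ_unique[symmetric])
  then have "AE \<omega> in N. \<omega> \<in> (\<Union>n. ?E n)" by (subst (asm) prob_eq_1) auto
  then show "AE \<omega> in N. bdd_above (range (\<lambda>i. Z i \<omega> j))"
    by eventually_elim (auto simp: bdd_iff)
qed

lemma ae_finite_max: "ae_finite_max N Z"
  unfolding ae_finite_max_def by (rule AE_bdd)

abbreviation "X \<equiv> max_process Z"

lemma max_process_le_iff:
  "bdd_above (range (\<lambda>i. Z i \<omega> j)) \<Longrightarrow> X \<omega> j \<le> a \<longleftrightarrow> (\<forall>i. Z i \<omega> j \<le> a)"
  unfolding max_process_def by (subst cSUP_le_iff) auto

text \<open>
  The supremum of an unbounded set of reals is a fixed unspecified number. It is therefore measurable on the exceptional set too.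
\<close>

lemma X_measurable [measurable]: "X \<in> borel_measurable N"
proof (rule measurable_seqI, rule borel_measurable_iff_le[THEN iffD2], rule allI)
  fix j a
  \<comment> \<open>The value of \<open>Sup\<close> on unbounded sets.\<close>
  define c where "c = (LEAST z :: real. False)"
  have c: "X \<omega> j = c" if "\<not> bdd_above (range (\<lambda>i. Z i \<omega> j))" for \<omega>
  proof -
    have "(\<lambda>z. \<forall>x\<in>range (\<lambda>i. Z i \<omega> j). x \<le> z) = (\<lambda>z. False)"
    proof
      show "(\<forall>x\<in>range (\<lambda>i. Z i \<omega> j). x \<le> z) = False" for z
        using that unfolding bdd_above_def by blast
    qed
    then show ?thesis by (simp only: max_process_def Sup_real_def c_def)
  qed
  let ?D = "\<lambda>\<omega>. \<exists>n :: nat. \<forall>i. Z i \<omega> j \<le> real (Suc n)"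
  have "X \<omega> j \<le> a \<longleftrightarrow> (if bdd_above (range (\<lambda>i. Z i \<omega> j)) then \<forall>i. Z i \<omega> j \<le> a else c \<le> a)" for \<omega>
    using max_process_le_iff[of \<omega> j a] c[of \<omega>] by simp
  then have "{\<omega> \<in> space N. X \<omega> j \<le> a}
      = {\<omega> \<in> space N. if ?D \<omega> then \<forall>i. Z i \<omega> j \<le> a else c \<le> a}"
    by (simp only: bdd_iff)
  also have "\<dots> \<in> sets N" by measurable
  finally show "{\<omega> \<in> space N. X \<omega> j \<le> a} \<in> sets N" .
qed

lemma X_coord [measurable]: "(\<lambda>\<omega>. X \<omega> j) \<in> borel_measurable N"
  by (rule measurable_coordinate') measurable

lemma emeasure_X_le:
  assumes "finite J"
  shows "emeasure N {\<omega> \<in> space N. \<forall>j\<in>J. X \<omega> j \<le> x j} = nexp (emeasure \<nu> {y. \<exists>j\<in>J. x j < y j})"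
proof -
  have "emeasure N {\<omega> \<in> space N. \<forall>j\<in>J. X \<omega> j \<le> x j} = emeasure N {\<omega> \<in> space N. \<forall>i. \<forall>j\<in>J. Z i \<omega> j \<le> x j}"
  proof (rule emeasure_eq_AE)
    show "AE \<omega> in N. (\<omega> \<in> {\<omega> \<in> space N. \<forall>j\<in>J. X \<omega> j \<le> x j})
        = (\<omega> \<in> {\<omega> \<in> space N. \<forall>i. \<forall>j\<in>J. Z i \<omega> j \<le> x j})"
      using AE_bdd by eventually_elim (auto simp: max_process_le_iff)
  qed (use assms in measurable)
  then show ?thesis using avoidance[OF assms] by simp
qed

lemma prob_X_le:
  assumes "0 < x"
  shows "prob {\<omega> \<in> space N. X \<omega> j \<le> x} = exp (- (x powr (- \<alpha>)))"
proof -
  have "emeasure N {\<omega> \<in> space N. X \<omega> j \<le> x} = ennreal (exp (- (x powr (- \<alpha>))))"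
    using emeasure_X_le[of "{j}" "\<lambda>_. x"] assms by (simp add: exponent_tail)
  then show ?thesis by (simp add: emeasure_eq_measure)
qed

lemma emeasure_law_le:
  assumes "finite J"
  shows "emeasure (distr N borel X) {y. \<forall>j\<in>J. y j \<le> x j} = nexp (emeasure \<nu> {y. \<exists>j\<in>J. x j < y j})"
proof -
  have "{y. \<forall>j\<in>J. y j \<le> x j} \<in> sets (borel :: (int \<Rightarrow> real) measure)" using assms by measurable
  then show ?thesis
    by (subst emeasure_distr) (auto simp: emeasure_X_le[OF assms, symmetric] vimage_def Int_def conj_commute)
qed

lemma stationary_X:
  assumes "\<And>k. distr \<nu> borel (backshift k) = \<nu>"
  shows "stationary N X"
  unfolding stationary_def same_law_def
proof (intro allI conjI)
  fix k
  have bm [measurable]: "(\<lambda>\<omega>. backshift k (X \<omega>)) \<in> borel_measurable N" by measurable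
  then show "(\<lambda>\<omega>. backshift k (X \<omega>)) \<in> borel_measurable N" .
  show "distr N borel (\<lambda>\<omega>. backshift k (X \<omega>)) = distr N borel X"
  proof (rule measure_eqI_cdf)
    fix J :: "int set" and x :: "int \<Rightarrow> real" assume J: "finite J"
    let ?J = "(\<lambda>j. j - k) ` J" and ?x = "\<lambda>j. x (j + k)"
    have sets: "{y. \<forall>j\<in>J. y j \<le> x j} \<in> sets (borel :: (int \<Rightarrow> real) measure)"
      "{y. \<exists>j\<in>J. x j < y j} \<in> sets (borel :: (int \<Rightarrow> real) measure)"
      using J by measurable
    have "emeasure (distr N borel (\<lambda>\<omega>. backshift k (X \<omega>))) {y. \<forall>j\<in>J. y j \<le> x j}
        = emeasure N {\<omega> \<in> space N. \<forall>j\<in>?J. X \<omega> j \<le> ?x j}"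
      by (subst emeasure_distr[OF bm sets(1)]) (auto simp: vimage_def Int_def conj_commute backshift_def)
    also have "\<dots> = nexp (emeasure \<nu> {y. \<exists>j\<in>?J. ?x j < y j})"
      using J by (intro emeasure_X_le) auto
    also have "emeasure \<nu> {y. \<exists>j\<in>?J. ?x j < y j} = emeasure (distr \<nu> borel (backshift k)) {y. \<exists>j\<in>J. x j < y j}"
      using sets sets_eq_imp_space_eq[OF sets_exponent]
      by (subst emeasure_distr) (auto simp: vimage_def backshift_def)
    also have "\<dots> = emeasure \<nu> {y. \<exists>j\<in>J. x j < y j}" by (simp only: assms)
    finally show "emeasure (distr N borel (\<lambda>\<omega>. backshift k (X \<omega>))) {y. \<forall>j\<in>J. y j \<le> x j}
        = emeasure (distr N borel X) {y. \<forall>j\<in>J. y j \<le> x j}"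
      by (simp add: emeasure_law_le[OF J])
  next
    show "prob_space (distr N borel (\<lambda>\<omega>. backshift k (X \<omega>)))" by (rule prob_space_distr[OF bm])
  qed simp_all
qed measurable

end

lemma max_process_same_law:
  assumes "max_stable_points N Z \<alpha> \<nu>" "max_stable_points K Z' \<alpha> \<nu>"
  shows "same_law N (max_process Z) K (max_process Z')"
proof -
  interpret N: max_stable_points N Z \<alpha> \<nu> by fact
  interpret K: max_stable_points K Z' \<alpha> \<nu> by fact
  have "distr N borel (max_process Z) = distr K borel (max_process Z')"
    by (rule measure_eqI_cdf)
      (auto intro: N.prob_space_distr simp: N.emeasure_law_le K.emeasure_law_le)
  then show ?thesis by (simp add: same_law_def)
qed

section \<open>The extremal index\<close>

lemma cesaro_mean:
  fixes d :: "nat \<Rightarrow> real"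
  assumes "d \<longlonglongrightarrow> l"
  shows "(\<lambda>n. (\<Sum>k<n. d k) / real n) \<longlonglongrightarrow> l"
proof (rule LIMSEQ_I)
  fix e :: real assume e: "0 < e"
  then obtain m where m: "\<And>k. m \<le> k \<Longrightarrow> \<bar>d k - l\<bar> < e / 2"
    using LIMSEQ_D[OF assms, of "e / 2"] by auto
  define c where "c = (\<Sum>k<m. \<bar>d k - l\<bar>)"
  have c: "0 \<le> c" by (simp add: c_def sum_nonneg)
  obtain n0 :: nat where n0: "2 * c / e < real n0" using reals_Archimedean2 by blast
  have "norm ((\<Sum>k<n. d k) / real n - l) < e" if n: "max (Suc m) n0 \<le> n" for n
  proof -
    have pos: "0 < real n" using n by simp
    have "(\<Sum>k<n. d k) - real n * l = (\<Sum>k<n. d k - l)" by (simp add: sum_subtractf)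
    then have "\<bar>(\<Sum>k<n. d k) - real n * l\<bar> \<le> (\<Sum>k<n. \<bar>d k - l\<bar>)" by simp
    also have "(\<Sum>k<n. \<bar>d k - l\<bar>) = c + (\<Sum>k=m..<n. \<bar>d k - l\<bar>)"
      unfolding c_def lessThan_atLeast0 using n by (intro sum.atLeastLessThan_concat[symmetric]) auto
    also have "(\<Sum>k=m..<n. \<bar>d k - l\<bar>) \<le> (\<Sum>k=m..<n. e / 2)"
      using m by (intro sum_mono) (auto intro: less_imp_le)
    also have "(\<Sum>k=m..<n. e / 2) \<le> real n * (e / 2)" using e by (simp add: mult_right_mono)
    also have "c < real n * (e / 2)"
      using n0 n e pos by (simp add: field_simps) (smt (verit) mult_left_mono of_nat_mono max.bounded_iff)
    finally have "\<bar>(\<Sum>k<n. d k) - real n * l\<bar> < e * real n" by (simp add: mult.commute)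
    moreover have "(\<Sum>k<n. d k) / real n - l = ((\<Sum>k<n. d k) - real n * l) / real n"
      using pos by (simp add: field_simps)
    ultimately show ?thesis using pos by (simp add: abs_divide pos_divide_less_eq)
  qed
  then show "\<exists>no. \<forall>n\<ge>no. norm ((\<Sum>k<n. d k) / real n - l) < e" by blast
qed

context tail_spectrum
begin

lemma emeasure_nu_exists_greater_finite:
  assumes "finite J" "0 < x"
  shows "emeasure \<nu> {y. \<exists>j\<in>J. x < y j} < top"
proof -
  have "{y :: int \<Rightarrow> real. \<exists>j\<in>J. x < y j} = (\<Union>j\<in>J. {y. x < y j})" by auto
  then have "emeasure \<nu> {y. \<exists>j\<in>J. x < y j} \<le> (\<Sum>j\<in>J. emeasure \<nu> {y. x < y j})"
    by (simp only:) (rule emeasure_subadditive_finite, use assms in auto)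
  also have "\<dots> < top"
    using assms by (simp add: emeasure_nu_greater ennreal_mult_less_top ennreal_of_nat_eq_real_of_nat)
  finally show ?thesis .
qed

text \<open>
  When the block \<open>{1..n}\<close> grows by one, the new sequences are those whose first exceedance within the block is at \<open>n + 1\<close>. By shift
  invariance their mass is that of the sequences exceeding 1 at time 0 but not during the \<open>n\<close> preceding instants, which decreases to
  \<open>\<theta>\<close>. Averaging the increments gives the claim.
\<close>

lemma measure_nu_block:
  "(\<lambda>n. measure \<nu> {y. \<exists>i\<in>{1..int n}. 1 < y i} / real n) \<longlonglongrightarrow> \<theta>"
proof -
  let ?A = "\<lambda>n :: nat. {y :: int \<Rightarrow> real. \<exists>i\<in>{1..int n}. 1 < y i}"
  \<comment> \<open>The increment of the block from \<open>n\<close> to \<open>n + 1\<close>, shifted back so that the new time becomes 0.\<close>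
  let ?D = "\<lambda>n :: nat. {y :: int \<Rightarrow> real. 1 < y 0 \<and> (\<forall>i\<in>{- int n..-1}. y i \<le> 1)}"
  have A: "?A n \<in> sets borel" for n by measurable
  have D: "?D n \<in> sets borel" for n by measurable
  have finA: "emeasure \<nu> (?A n) < top" for n by (rule emeasure_nu_exists_greater_finite) auto
  have finD: "emeasure \<nu> (?D n) < top" for n
  proof -
    have "emeasure \<nu> (?D n) \<le> emeasure \<nu> {y. 1 < y 0}" by (rule emeasure_mono) auto
    then show ?thesis by (simp add: emeasure_nu_greater le_less_trans)
  qed
  have step: "measure \<nu> (?A (Suc n)) = measure \<nu> (?A n) + measure \<nu> (?D n)" for n
  proof -
    let ?G = "{y :: int \<Rightarrow> real. backshift (- int (Suc n)) y \<in> ?D n}"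
    have mem: "y \<in> ?G \<longleftrightarrow> 1 < y (int (Suc n)) \<and> (\<forall>i\<in>{1..int n}. y i \<le> 1)" for y
    proof -
      have "(\<forall>i\<in>{- int n..-1}. y (i + int (Suc n)) \<le> 1) \<longleftrightarrow> (\<forall>i\<in>(\<lambda>i. i + int (Suc n)) ` {- int n..-1}. y i \<le> 1)"
        by blast
      also have "(\<lambda>i. i + int (Suc n)) ` {- int n..-1} = {1..int n}" by simp
      finally show ?thesis by (simp add: backshift_def algebra_simps)
    qed
    have G_eq: "?G = {y. 1 < y (int (Suc n)) \<and> (\<forall>i\<in>{1..int n}. y i \<le> 1)}"
      using mem by blast
    have block: "{1..int (Suc n)} = insert (int (Suc n)) {1..int n}" by auto
    have "?A (Suc n) = ?A n \<union> ?G" unfolding G_eq block by (auto simp: not_le)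
    moreover have "?A n \<inter> ?G = {}" unfolding G_eq by (auto simp: not_le[symmetric])
    moreover have G: "?G \<in> sets borel" using measurable_sets[OF measurable_backshift D[of n]] by (simp add: vimage_def)
    ultimately have "emeasure \<nu> (?A (Suc n)) = emeasure \<nu> (?A n) + emeasure \<nu> ?G"
      using plus_emeasure[of "?A n" \<nu> ?G] A[of n] by simp
    also have "emeasure \<nu> ?G = emeasure \<nu> (?D n)" by (rule emeasure_nu_backshift[OF D])
    finally show ?thesis
      using finA[of n] finD[of n] by (simp add: measure_def enn2real_plus)
  qed
  have sum: "measure \<nu> (?A n) = (\<Sum>k<n. measure \<nu> (?D k))" for n
    by (induction n) (simp_all add: step del: of_nat_Suc)
  have "(\<lambda>n. emeasure \<nu> (?D n)) \<longlonglongrightarrow> emeasure \<nu> (\<Inter>n. ?D n)"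
    using D finD by (intro Lim_emeasure_decseq) (auto simp: decseq_def less_top[symmetric])
  also have "emeasure \<nu> (\<Inter>n. ?D n) = emeasure \<nu> {y. first_exceedance y 0}"
  proof (rule emeasure_eq_AE)
    show "AE y in \<nu>. (y \<in> (\<Inter>n. ?D n)) = (y \<in> {y. first_exceedance y 0})"
      using nu_nonneg
    proof eventually_elim
      case (elim y)
      have "(\<forall>n. \<forall>i\<in>{- int n..-1}. y i \<le> 1) \<longleftrightarrow> (\<forall>i\<le>-1. y i \<le> 1)"
      proof (intro iffI allI impI ballI)
        fix i :: int assume *: "\<forall>n. \<forall>i\<in>{- int n..-1}. y i \<le> 1" "i \<le> -1"
        then show "y i \<le> 1" using spec[OF *(1), of "nat (- i)"] by simp
      qed auto
      then show ?case using elim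
        by (auto simp: first_exceedance_def abs_sup_le_1_iff nonneg_seqs_def)
    qed
  qed (use D in auto)
  finally have "(\<lambda>n. emeasure \<nu> (?D n)) \<longlonglongrightarrow> ennreal \<theta>"
    by (simp add: emeasure_nu_first_exceedance)
  then have "(\<lambda>n. measure \<nu> (?D n)) \<longlonglongrightarrow> \<theta>"
    unfolding measure_def using candidate_theta_pos by (intro tendsto_enn2real) auto
  from cesaro_mean[OF this] show ?thesis by (simp add: sum)
qed

lemma measure_nu_exists_scale:
  assumes "finite J" "0 < c" "0 < x"
  shows "measure \<nu> {y. \<exists>j\<in>J. c * x < y j} = c powr (- \<alpha>) * measure \<nu> {y. \<exists>j\<in>J. x < y j}"
proof -
  have "{y :: int \<Rightarrow> real. \<exists>j\<in>J. x < y j} \<in> sets borel" using assms by measurable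
  from emeasure_nu_scale[OF _ this, of "inverse c"]
  have "emeasure \<nu> {y. (\<lambda>i. inverse c * y i) \<in> {y. \<exists>j\<in>J. x < y j}}
      = ennreal (inverse c powr \<alpha>) * emeasure \<nu> {y. \<exists>j\<in>J. x < y j}"
    using assms by simp
  also have "{y. (\<lambda>i. inverse c * y i) \<in> {y. \<exists>j\<in>J. x < y j}} = {y. \<exists>j\<in>J. c * x < y j}"
    using assms by (simp add: field_simps)
  also have "inverse c powr \<alpha> = c powr (- \<alpha>)" by (simp add: powr_minus inverse_powr)
  finally have "emeasure \<nu> {y. \<exists>j\<in>J. c * x < y j} = ennreal (c powr (- \<alpha>)) * emeasure \<nu> {y. \<exists>j\<in>J. x < y j}" .
  then show ?thesis by (simp add: measure_def enn2real_mult)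
qed

text \<open>
  Homogeneity turns the level \<open>n powr (1 / \<alpha>) * x\<close> into the factor \<open>x powr (- \<alpha>) / n\<close>.
\<close>

lemma extremal_index:
  assumes "max_stable_points N Z \<alpha> \<nu>"
  shows "has_extremal_index \<alpha> N (max_process Z) \<theta>"
proof -
  interpret N: max_stable_points N Z \<alpha> \<nu> by fact
  show ?thesis
    unfolding has_extremal_index_def
  proof (intro conjI allI impI)
    fix j and x :: real assume "0 < x"
    then show "N.prob {\<omega> \<in> space N. N.X \<omega> j \<le> x} = exp (- (x powr (- \<alpha>)))" by (rule N.prob_X_le)
  next
    fix x :: real assume x: "0 < x"
    let ?A = "\<lambda>n :: nat. {y :: int \<Rightarrow> real. \<exists>i\<in>{1..int n}. 1 < y i}"
    have val: "N.prob {\<omega> \<in> space N. Max ((\<lambda>i. N.X \<omega> i) ` {1..int n}) \<le> real n powr (1 / \<alpha>) * x}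
        = exp (- (measure \<nu> (?A n) / real n) * x powr (- \<alpha>))" if n: "1 \<le> n" for n
    proof -
      let ?c = "real n powr (1 / \<alpha>) * x"
      have c: "0 < ?c" using n x by simp
      have "{\<omega> \<in> space N. Max ((\<lambda>i. N.X \<omega> i) ` {1..int n}) \<le> ?c}
          = {\<omega> \<in> space N. \<forall>j\<in>{1..int n}. N.X \<omega> j \<le> ?c}"
        using n by (subst Max_le_iff) auto
      then have "emeasure N {\<omega> \<in> space N. Max ((\<lambda>i. N.X \<omega> i) ` {1..int n}) \<le> ?c}
          = nexp (emeasure \<nu> {y. \<exists>j\<in>{1..int n}. ?c < y j})"
        by (simp add: N.emeasure_X_le)
      also have "emeasure \<nu> {y. \<exists>j\<in>{1..int n}. ?c < y j} = ennreal (measure \<nu> {y. \<exists>j\<in>{1..int n}. ?c * 1 < y j})"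
        using emeasure_nu_exists_greater_finite[OF _ c, of "{1..int n}"]
        by (simp add: emeasure_eq_ennreal_measure)
      also have "measure \<nu> {y. \<exists>j\<in>{1..int n}. ?c * 1 < y j} = ?c powr (- \<alpha>) * measure \<nu> (?A n)"
        using c by (intro measure_nu_exists_scale) auto
      also have "?c powr (- \<alpha>) = x powr (- \<alpha>) / real n"
        using n x \<alpha>_pos by (simp add: powr_mult powr_powr powr_minus field_simps)
      finally show ?thesis
        by (simp add: N.emeasure_eq_measure field_simps)
    qed
    have "(\<lambda>n. exp (- (measure \<nu> (?A n) / real n) * x powr (- \<alpha>))) \<longlonglongrightarrow> exp (- \<theta> * x powr (- \<alpha>))"
      by (intro tendsto_intros measure_nu_block)
    then show "(\<lambda>n. N.prob {\<omega> \<in> space N. Max ((\<lambda>i. N.X \<omega> i) ` {1..int n}) \<le> real n powr (1 / \<alpha>) * x})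
        \<longlonglongrightarrow> exp (- \<theta> * x powr (- \<alpha>))"
      by (rule Lim_transform_eventually) (use val in \<open>auto intro!: eventually_sequentiallyI[of 1]\<close>)
  qed
qed

section \<open>The Poisson points and the M3 points\<close>

text \<open>
  The mean measure lives on the non negative sequences, which carry the full mass of \<open>\<nu>\<close>.
\<close>

lemma max_stable_points_poisson:
  assumes ppp: "poisson_point_process N W (restrict_space \<nu> nonneg_seqs)"
  shows "max_stable_points N W \<alpha> \<nu>"
proof -
  let ?\<mu> = "restrict_space \<nu> nonneg_seqs"
  interpret W: poisson_process N W ?\<mu> by standard (rule ppp)
  show ?thesis
  proof unfold_locales
    show "W i \<in> borel_measurable N" for i
      using measurable_compose[OF W.measurable_point[of i], of "\<lambda>y. y" borel]
      by (simp add: measurable_restrict_space1)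
    fix J :: "int set" and x :: "int \<Rightarrow> real" assume J: "finite J"
    let ?B = "{y. \<exists>j\<in>J. x j < y j}"
    have B [measurable]: "?B \<in> sets borel" using J by measurable
    have "{\<omega> \<in> space N. \<forall>i. \<forall>j\<in>J. W i \<omega> j \<le> x j} = {\<omega> \<in> space N. \<forall>i. W i \<omega> \<notin> nonneg_seqs \<inter> ?B}"
      using measurable_space[OF W.measurable_point] by (auto simp: not_le[symmetric] space_restrict_space)
    also have "emeasure N \<dots> = nexp (emeasure ?\<mu> (nonneg_seqs \<inter> ?B))"
      by (rule W.void_probability) (auto simp: sets_restrict_space)
    also have "emeasure ?\<mu> (nonneg_seqs \<inter> ?B) = emeasure \<nu> (nonneg_seqs \<inter> ?B)"
      by (rule emeasure_restrict_space) auto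
    also have "\<dots> = emeasure \<nu> ?B"
      using nu_nonneg by (intro emeasure_eq_AE) (auto elim!: eventually_mono)
    finally show "emeasure N {\<omega> \<in> space N. \<forall>i. \<forall>j\<in>J. W i \<omega> j \<le> x j} = nexp (emeasure \<nu> ?B)" .
  qed (simp_all add: \<alpha>_pos emeasure_nu_greater)
qed

lemma nn_integral_PT_mean:
  assumes F: "\<And>t. (\<lambda>p. F (p, t)) \<in> borel_measurable borel"
  shows "(\<integral>\<^sup>+ z. F z \<partial>PT_mean \<alpha> \<theta>) = ennreal \<theta> * (\<integral>\<^sup>+ t. (\<integral>\<^sup>+ p. F (p, t) \<partial>\<rho>) \<partial>count_space UNIV)"
proof -
  let ?D = "density (restrict_space lborel {0<..}) (\<lambda>x. ennreal (\<alpha> * x powr (- \<alpha> - 1)))"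
  let ?C = "count_space (UNIV :: int set)"
  let ?S = "scale_measure (ennreal \<theta>) ?C"
  interpret C\<rho>: pair_sigma_finite ?C \<rho> ..
  have D: "(\<integral>\<^sup>+ p. G p \<partial>?D) = (\<integral>\<^sup>+ p. G p \<partial>\<rho>)" if [measurable]: "G \<in> borel_measurable borel" for G
  proof -
    have [measurable]: "G \<in> borel_measurable (restrict_space lborel {0<..})"
      "(\<lambda>x. ennreal (\<alpha> * x powr (- \<alpha> - 1))) \<in> borel_measurable (restrict_space lborel {0<..})"
      by (auto intro!: measurable_restrict_space1)
    have "(\<integral>\<^sup>+ p. G p \<partial>?D) = (\<integral>\<^sup>+ p. ennreal (\<alpha> * p powr (- \<alpha> - 1)) * G p \<partial>restrict_space lborel {0<..})"
      by (rule nn_integral_density) measurable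
    also have "\<dots> = (\<integral>\<^sup>+ p. ennreal (\<alpha> * p powr (- \<alpha> - 1)) * G p * indicator {0<..} p \<partial>lborel)"
      by (rule nn_integral_restrict_space) simp
    also have "\<dots> = (\<integral>\<^sup>+ p. G p \<partial>\<rho>)"
      by (subst nn_integral_radial) (auto simp: mult_ac)
    finally show ?thesis .
  qed
  have setsD: "sets ?D = sets (restrict_space borel {0<..})" by (simp cong: sets_restrict_space_cong)
  have S: "sigma_finite_measure ?S"
  proof
    show "\<exists>A. countable A \<and> A \<subseteq> sets ?S \<and> \<Union>A = space ?S \<and> (\<forall>a\<in>A. emeasure ?S a \<noteq> \<infinity>)"
      by (intro exI[of _ "range (\<lambda>t. {t})"]) (auto simp: space_scale_measure)
  qed
  have Ft: "(\<lambda>p. F (p, t)) \<in> borel_measurable ?D" for t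
    using measurable_restrict_space1[OF F[of t], of "{0<..}"] by (simp only: measurable_cong_sets[OF setsD refl])
  have "(\<lambda>(t, p). F (p, t)) \<in> borel_measurable (?C \<Otimes>\<^sub>M ?D)"
    by (rule measurable_pair_measure_countable1, simp, unfold prod.case, rule Ft)
  from measurable_pair_swap[OF this]
  have FC: "F \<in> borel_measurable (?D \<Otimes>\<^sub>M ?C)" by simp
  have sets_S: "sets (?D \<Otimes>\<^sub>M ?S) = sets (?D \<Otimes>\<^sub>M ?C)"
    by (intro sets_pair_measure_cong) simp_all
  have FM: "F \<in> borel_measurable (?D \<Otimes>\<^sub>M ?S)"
    using FC by (simp only: measurable_cong_sets[OF sets_S refl])
  have "(\<integral>\<^sup>+ z. F z \<partial>PT_mean \<alpha> \<theta>) = (\<integral>\<^sup>+ p. (\<integral>\<^sup>+ t. F (p, t) \<partial>?S) \<partial>?D)"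
    unfolding PT_mean_def by (rule sigma_finite_measure.nn_integral_fst[OF S FM, symmetric])
  also have "\<dots> = (\<integral>\<^sup>+ p. ennreal \<theta> * (\<integral>\<^sup>+ t. F (p, t) \<partial>?C) \<partial>?D)"
    by (simp add: nn_integral_scale_measure)
  also have "\<dots> = (\<integral>\<^sup>+ p. ennreal \<theta> * (\<integral>\<^sup>+ t. F (p, t) \<partial>?C) \<partial>\<rho>)"
  proof (rule D)
    have [measurable]: "(\<lambda>p. \<integral>\<^sup>+ t. F (p, t) \<partial>?C) \<in> borel_measurable borel"
      by (rule measurable_nn_integral_count_int) (rule F)
    show "(\<lambda>p. ennreal \<theta> * (\<integral>\<^sup>+ t. F (p, t) \<partial>?C)) \<in> borel_measurable borel" by measurable
  qed
  also have "\<dots> = ennreal \<theta> * (\<integral>\<^sup>+ p. (\<integral>\<^sup>+ t. F (p, t) \<partial>?C) \<partial>\<rho>)"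
    using measurable_nn_integral_count_int[of "\<lambda>t p. F (p, t)" \<rho>] F
    by (intro nn_integral_cmult) (simp cong: measurable_cong_sets)
  also have "(\<integral>\<^sup>+ p. (\<integral>\<^sup>+ t. F (p, t) \<partial>?C) \<partial>\<rho>) = (\<integral>\<^sup>+ t. (\<integral>\<^sup>+ p. F (p, t) \<partial>\<rho>) \<partial>?C)"
    by (rule C\<rho>.Fubini'[of "\<lambda>t p. F (p, t)"], rule measurable_pair_measure_countable1)
      (use F in \<open>simp_all cong: measurable_cong_sets\<close>)
  finally show ?thesis .
qed

end

context tail_spectrum
begin

lemma measurable_fst_PT: "fst \<in> borel_measurable (PT_mean \<alpha> \<theta>)"
proof -
  have "(\<lambda>x. x) \<in> borel_measurable (density (restrict_space lborel {0<..}) (\<lambda>x. ennreal (\<alpha> * x powr (- \<alpha> - 1))))"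
    by (simp add: measurable_restrict_space1)
  then show ?thesis unfolding PT_mean_def by (rule measurable_compose[OF measurable_fst])
qed

lemma measurable_snd_PT: "snd \<in> PT_mean \<alpha> \<theta> \<rightarrow>\<^sub>M count_space UNIV"
proof -
  have "snd \<in> PT_mean \<alpha> \<theta> \<rightarrow>\<^sub>M scale_measure (ennreal \<theta>) (count_space UNIV)"
    unfolding PT_mean_def by (rule measurable_snd)
  also have "(PT_mean \<alpha> \<theta> \<rightarrow>\<^sub>M scale_measure (ennreal \<theta>) (count_space UNIV)) = (PT_mean \<alpha> \<theta> \<rightarrow>\<^sub>M count_space UNIV)"
    by (rule measurable_cong_sets) simp_all
  finally show ?thesis .
qed

lemma mean_marked_points:
  assumes H [measurable]: "H \<in> borel_measurable borel"
  shows "(\<integral>\<^sup>+ z. (\<integral>\<^sup>+ q. H (\<lambda>i. fst z * q (i - snd z)) \<partial>QL) \<partial>PT_mean \<alpha> \<theta>) = (\<integral>\<^sup>+ y. H y \<partial>\<nu>)"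
proof -
  interpret L: prob_space QL by (rule prob_space_Q_law)
  interpret \<rho>L: pair_sigma_finite \<rho> QL ..
  interpret CL: pair_sigma_finite "count_space (UNIV :: int set)" QL ..
  have H2: "(\<lambda>(p, q). H (\<lambda>i. p * q (i - t))) \<in> borel_measurable (\<rho> \<Otimes>\<^sub>M QL)" for t
    using measurable_compose[OF measurable_shifted_scaled[of t] H]
    by (simp add: case_prod_beta' cong: measurable_cong_sets sets_pair_measure_cong)
  have H1: "(\<lambda>p. \<integral>\<^sup>+ q. H (\<lambda>i. p * q (i - t)) \<partial>QL) \<in> borel_measurable borel" for t
    using L.borel_measurable_nn_integral[OF H2] by simp
  have H3: "(\<lambda>q. \<integral>\<^sup>+ p. H (\<lambda>i. p * q (i - t)) \<partial>\<rho>) \<in> borel_measurable QL" for t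
    using \<rho>.borel_measurable_nn_integral[OF measurable_pair_swap[OF H2]] by simp
  have "(\<integral>\<^sup>+ z. (\<integral>\<^sup>+ q. H (\<lambda>i. fst z * q (i - snd z)) \<partial>QL) \<partial>PT_mean \<alpha> \<theta>)
      = ennreal \<theta> * (\<integral>\<^sup>+ t. (\<integral>\<^sup>+ p. (\<integral>\<^sup>+ q. H (\<lambda>i. p * q (i - t)) \<partial>QL) \<partial>\<rho>) \<partial>count_space UNIV)"
    using nn_integral_PT_mean[of "\<lambda>z. \<integral>\<^sup>+ q. H (\<lambda>i. fst z * q (i - snd z)) \<partial>QL"] H1 by simp
  also have "(\<integral>\<^sup>+ t. (\<integral>\<^sup>+ p. (\<integral>\<^sup>+ q. H (\<lambda>i. p * q (i - t)) \<partial>QL) \<partial>\<rho>) \<partial>count_space UNIV)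
      = (\<integral>\<^sup>+ t. (\<integral>\<^sup>+ q. (\<integral>\<^sup>+ p. H (\<lambda>i. p * q (i - t)) \<partial>\<rho>) \<partial>QL) \<partial>count_space UNIV)"
    by (intro nn_integral_cong \<rho>L.Fubini'[symmetric] H2)
  also have "\<dots> = (\<integral>\<^sup>+ q. (\<integral>\<^sup>+ t. (\<integral>\<^sup>+ p. H (\<lambda>i. p * q (i - t)) \<partial>\<rho>) \<partial>count_space UNIV) \<partial>QL)"
    by (rule CL.Fubini'[symmetric], rule measurable_pair_measure_countable1, simp, unfold prod.case, rule H3)
  finally show ?thesis by (simp add: nn_integral_nu_Q[OF H])
qed

text \<open>
  The points \<open>(P i, T i)\<close> marked by \<open>Q i\<close> produce the sequences \<open>P i B\<^sup>T\<^sup>i Q i\<close>, and the mean measure of these is \<open>\<nu>\<close> by the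
  description of \<open>\<nu>\<close> through \<open>Q\<close>.
\<close>

lemma max_stable_points_M3:
  assumes M3: "M3_ingredients \<alpha> \<theta> QL K P T Q"
  shows "max_stable_points K (M3_terms P T Q) \<alpha> \<nu>"
proof -
  let ?PT = "PT_mean \<alpha> \<theta>"
  interpret PT: poisson_process K "\<lambda>i \<omega>. (P i \<omega>, T i \<omega>)" ?PT
    by standard (use M3 in \<open>simp add: M3_ingredients_def\<close>)
  have Q: "\<And>i. Q i \<in> borel_measurable K" "\<And>i. distr K borel (Q i) = QL"
    "PT.indep_vars (\<lambda>_. borel) Q UNIV"
    "PT.indep_set
       (sets (vimage_algebra (space K) (\<lambda>\<omega> i. (P i \<omega>, T i \<omega>)) (Pi\<^sub>M UNIV (\<lambda>_. ?PT))))
       (sets (vimage_algebra (space K) (\<lambda>\<omega> i. Q i \<omega>) (Pi\<^sub>M UNIV (\<lambda>_. borel))))"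
    using M3 by (simp_all add: M3_ingredients_def)
  have P: "P i \<in> borel_measurable K" for i
    using measurable_compose[OF PT.measurable_point[of i] measurable_fst_PT] by simp
  have T: "T i \<in> K \<rightarrow>\<^sub>M count_space UNIV" for i
    using measurable_compose[OF PT.measurable_point[of i] measurable_snd_PT] by simp
  show ?thesis
  proof unfold_locales
    fix i
    show "M3_terms P T Q i \<in> borel_measurable K"
    proof (rule measurable_seqI)
      fix j
      have "(\<lambda>\<omega>. P i \<omega> * Q i \<omega> (j - t)) \<in> borel_measurable K" for t
        using P[of i] measurable_coordinate'[OF Q(1)[of i]] by measurable
      from measurable_compose_countable[OF this T[of i]]
      show "(\<lambda>\<omega>. M3_terms P T Q i \<omega> j) \<in> borel_measurable K" by (simp add: M3_terms_def)
    qed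
  next
    fix J :: "int set" and x :: "int \<Rightarrow> real" assume J: "finite J"
    let ?A = "{y. \<exists>j\<in>J. x j < y j}"
    have A [measurable]: "?A \<in> sets borel" using J by measurable
    define B where "B = {z \<in> space (?PT \<Otimes>\<^sub>M borel). (\<lambda>j. fst (fst z) * snd z (j - snd (fst z))) \<in> ?A}"
    have "(\<lambda>z j. fst (fst z) * snd z (j - snd (fst z))) \<in> borel_measurable (?PT \<Otimes>\<^sub>M (borel :: (int \<Rightarrow> real) measure))"
    proof (rule measurable_seqI)
      fix j
      have 1: "(\<lambda>z. fst (fst z)) \<in> borel_measurable (?PT \<Otimes>\<^sub>M (borel :: (int \<Rightarrow> real) measure))"
        by (rule measurable_compose[OF measurable_fst measurable_fst_PT])
      have 2: "(\<lambda>z. snd (fst z)) \<in> ?PT \<Otimes>\<^sub>M (borel :: (int \<Rightarrow> real) measure) \<rightarrow>\<^sub>M count_space UNIV"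
        by (rule measurable_compose[OF measurable_fst measurable_snd_PT])
      have "(\<lambda>z. fst (fst z) * snd z (j - t)) \<in> borel_measurable (?PT \<Otimes>\<^sub>M (borel :: (int \<Rightarrow> real) measure))" for t
        using 1 by measurable
      from measurable_compose_countable[OF this 2]
      show "(\<lambda>z. fst (fst z) * snd z (j - snd (fst z))) \<in> borel_measurable (?PT \<Otimes>\<^sub>M (borel :: (int \<Rightarrow> real) measure))" .
    qed
    then have B: "B \<in> sets (?PT \<Otimes>\<^sub>M borel)"
      unfolding B_def by measurable
    have "{\<omega> \<in> space K. \<forall>i. \<forall>j\<in>J. M3_terms P T Q i \<omega> j \<le> x j}
        = {\<omega> \<in> space K. \<forall>i. ((P i \<omega>, T i \<omega>), Q i \<omega>) \<notin> B}"
      using measurable_space[OF PT.measurable_point]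
      by (auto simp: B_def space_pair_measure M3_terms_def not_less)
    also have "emeasure K \<dots> = nexp (\<integral>\<^sup>+ z. emeasure QL (Pair z -` B) \<partial>?PT)"
      by (rule PT.marked_void_probability[OF Q B])
    also have "(\<integral>\<^sup>+ z. emeasure QL (Pair z -` B) \<partial>?PT)
        = (\<integral>\<^sup>+ z. (\<integral>\<^sup>+ q. indicator ?A (\<lambda>i. fst z * q (i - snd z)) \<partial>QL) \<partial>?PT)"
    proof (rule nn_integral_cong)
      fix z assume z: "z \<in> space ?PT"
      have "Pair z -` B \<in> sets QL" using sets_Pair1[OF B, of z] by simp
      then have "emeasure QL (Pair z -` B) = (\<integral>\<^sup>+ q. indicator (Pair z -` B) q \<partial>QL)" by simp
      also have "\<dots> = (\<integral>\<^sup>+ q. indicator ?A (\<lambda>i. fst z * q (i - snd z)) \<partial>QL)"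
        using z by (intro nn_integral_cong) (auto simp: indicator_def B_def space_pair_measure)
      finally show "emeasure QL (Pair z -` B) = \<dots>" .
    qed
    also have "\<dots> = (\<integral>\<^sup>+ y. indicator ?A y \<partial>\<nu>)"
      by (rule mean_marked_points) measurable
    also have "\<dots> = emeasure \<nu> ?A" by simp
    finally show "emeasure K {\<omega> \<in> space K. \<forall>i. \<forall>j\<in>J. M3_terms P T Q i \<omega> j \<le> x j} = nexp (emeasure \<nu> ?A)" .
  qed (simp_all add: \<alpha>_pos emeasure_nu_greater)
qed

end

section \<open>Oscillation of functions of finitely many coordinates\<close>

definition box_on :: "int set \<Rightarrow> real \<Rightarrow> (int \<Rightarrow> real) \<Rightarrow> (int \<Rightarrow> real) set" where
  "box_on J \<delta> y = {w. \<forall>j\<in>J. \<bar>w j - y j\<bar> < \<delta>}"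

definition box_continuous :: "((int \<Rightarrow> real) \<Rightarrow> real) \<Rightarrow> int set \<Rightarrow> (int \<Rightarrow> real) \<Rightarrow> bool" where
  "box_continuous g J y \<longleftrightarrow> (\<forall>\<eta>>0. \<exists>\<delta>>0. \<forall>w\<in>box_on J \<delta> y. \<bar>g w - g y\<bar> < \<eta>)"

text \<open>
  Both arguments range over the box, rather than only one of them with the other at its centre: this makes the oscillation lower
  semicontinuous, hence Borel measurable, for every function \<open>g\<close>.
\<close>

definition oscillation :: "((int \<Rightarrow> real) \<Rightarrow> real) \<Rightarrow> int set \<Rightarrow> real \<Rightarrow> (int \<Rightarrow> real) \<Rightarrow> ennreal" where
  "oscillation g J \<delta> y = (SUP w\<in>box_on J \<delta> y. SUP w'\<in>box_on J \<delta> y. ennreal \<bar>g w - g w'\<bar>)"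

lemma oscillation_ge:
  "w \<in> box_on J \<delta> y \<Longrightarrow> w' \<in> box_on J \<delta> y \<Longrightarrow> ennreal \<bar>g w - g w'\<bar> \<le> oscillation g J \<delta> y"
  unfolding oscillation_def by (rule SUP_upper2, assumption, rule SUP_upper)

lemma oscillation_le:
  "(\<And>w w'. w \<in> box_on J \<delta> y \<Longrightarrow> w' \<in> box_on J \<delta> y \<Longrightarrow> \<bar>g w - g w'\<bar> \<le> c) \<Longrightarrow> oscillation g J \<delta> y \<le> ennreal c"
  unfolding oscillation_def by (intro SUP_least ennreal_leI)

text \<open>
  If two points of the box around \<open>y\<close> witness an oscillation above \<open>c\<close>, they are also in the box around every \<open>y'\<close> close to
  \<open>y\<close>; so the superlevel sets are open.
\<close>

lemma measurable_oscillation [measurable]: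
  assumes J: "finite J"
  shows "oscillation g J \<delta> \<in> borel_measurable borel"
proof (rule borel_measurableI_greater)
  fix c
  have "{y. c < oscillation g J \<delta> y}
    = (\<Union>(w, w')\<in>{(w, w'). c < ennreal \<bar>g w - g w'\<bar>}. {y. \<forall>j\<in>J. \<bar>w j - y j\<bar> < \<delta> \<and> \<bar>w' j - y j\<bar> < \<delta>})"
    by (auto simp: oscillation_def less_SUP_iff box_on_def)
  moreover have "open {y :: int \<Rightarrow> real. \<forall>j\<in>J. \<bar>w j - y j\<bar> < \<delta> \<and> \<bar>w' j - y j\<bar> < \<delta>}" for w w' :: "int \<Rightarrow> real"
  proof -
    have "open {y :: int \<Rightarrow> real. \<bar>v - y j\<bar> < \<delta>}" for v j
      by (intro open_Collect_less continuous_intros continuous_on_product_coordinates)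
    then have "open ({y :: int \<Rightarrow> real. \<bar>w j - y j\<bar> < \<delta>} \<inter> {y. \<bar>w' j - y j\<bar> < \<delta>})" for j
      by (intro open_Int)
    then have "open (\<Inter>j\<in>J. {y :: int \<Rightarrow> real. \<bar>w j - y j\<bar> < \<delta>} \<inter> {y. \<bar>w' j - y j\<bar> < \<delta>})"
      using J by (intro open_INT) auto
    also have "(\<Inter>j\<in>J. {y :: int \<Rightarrow> real. \<bar>w j - y j\<bar> < \<delta>} \<inter> {y. \<bar>w' j - y j\<bar> < \<delta>})
        = {y. \<forall>j\<in>J. \<bar>w j - y j\<bar> < \<delta> \<and> \<bar>w' j - y j\<bar> < \<delta>}" by auto
    finally show ?thesis .
  qed
  ultimately have "open {y. c < oscillation g J \<delta> y}" by (auto intro!: open_UN)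
  then show "{y \<in> space borel. c < oscillation g J \<delta> y} \<in> sets borel" by simp
qed

section \<open>The principle of a single large point\<close>

locale max_stable_poisson = tail_spectrum M \<alpha> \<Theta> for M :: "'a measure" and \<alpha> \<Theta> +
  fixes N :: "'b measure" and W :: "nat \<Rightarrow> 'b \<Rightarrow> int \<Rightarrow> real"
  assumes poisson: "poisson_point_process N W (restrict_space \<nu> nonneg_seqs)"
begin

sublocale W: poisson_process N W "restrict_space \<nu> nonneg_seqs"
  by standard (rule poisson)

sublocale Z: max_stable_points N W \<alpha> \<nu>
  by (rule max_stable_points_poisson[OF poisson])

abbreviation "\<zeta> \<equiv> max_process W"

lemma W_nonneg: "\<omega> \<in> space N \<Longrightarrow> 0 \<le> W i \<omega> j"
  using measurable_space[OF W.measurable_point] by (auto simp: space_restrict_space nonneg_seqs_def)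

lemma zeta_measurable [measurable]:
  "(\<lambda>\<omega>. \<zeta> \<omega> j) \<in> borel_measurable N"
  "(\<lambda>\<omega> j. \<zeta> \<omega> j / u) \<in> borel_measurable N"
  using Z.X_coord by (auto intro!: measurable_seqI borel_measurable_divide)

lemma W_borel: "W i \<in> borel_measurable N"
  by (rule Z.Z_measurable)

lemma campbell_nu:
  assumes h [measurable]: "h \<in> borel_measurable borel"
  shows "(\<integral>\<^sup>+ \<omega>. (\<integral>\<^sup>+ i. h (W i \<omega>) \<partial>count_space UNIV) \<partial>N) = (\<integral>\<^sup>+ y. h y \<partial>\<nu>)"
proof -
  have "(\<integral>\<^sup>+ \<omega>. (\<integral>\<^sup>+ i. h (W i \<omega>) \<partial>count_space UNIV) \<partial>N) = (\<integral>\<^sup>+ y. h y \<partial>restrict_space \<nu> nonneg_seqs)"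
    by (rule W.campbell) (simp add: measurable_restrict_space1)
  also have "\<dots> = (\<integral>\<^sup>+ y. h y * indicator nonneg_seqs y \<partial>\<nu>)"
    by (rule nn_integral_restrict_space) simp
  also have "\<dots> = (\<integral>\<^sup>+ y. h y \<partial>\<nu>)"
    using nu_nonneg by (intro nn_integral_cong_AE) (auto elim!: eventually_mono)
  finally show ?thesis .
qed

text \<open>
  The pathwise comparison of \<open>g (\<zeta> / u)\<close> with the sum of \<open>g (W i / u)\<close>, by the number of points in \<open>A\<close>, those that exceed \<open>\<delta> u\<close>
  somewhere on \<open>J\<close>. If there is none, both vanish. If there is exactly one, it is the only term of the sum and differs from
  \<open>\<zeta>\<close> by at most \<open>\<delta> u\<close> on \<open>J\<close>, so the oscillation controls the error. If there are at least two, \<open>R\<close> exceeds both sides.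
\<close>

lemma single_big_point:
  fixes g :: "(int \<Rightarrow> real) \<Rightarrow> real"
  assumes J: "finite J" and \<delta>: "0 < \<delta>" "\<delta> \<le> \<epsilon>" and u: "0 < u" and C: "0 < C"
    and g: "\<And>y. 0 \<le> g y" "\<And>y. g y \<le> C"
    and van: "\<And>y. (\<And>j. j \<in> J \<Longrightarrow> \<bar>y j\<bar> \<le> \<epsilon>) \<Longrightarrow> g y = 0"
    and \<omega>: "\<omega> \<in> space N" and bdd: "\<And>j. bdd_above (range (\<lambda>i. W i \<omega> j))"
  defines "A \<equiv> nonneg_seqs \<inter> {y. \<exists>j\<in>J. \<delta> * u < y j}"
  defines "G \<equiv> ennreal (g (\<lambda>j. \<zeta> \<omega> j / u))"
    and "S \<equiv> \<integral>\<^sup>+ i. ennreal (g (\<lambda>j. W i \<omega> j / u)) \<partial>count_space UNIV"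
    and "D \<equiv> \<integral>\<^sup>+ i. oscillation g J (2 * \<delta>) (\<lambda>j. W i \<omega> j / u) \<partial>count_space UNIV"
    and "R \<equiv> ennreal C * ((1 + point_count W A \<omega>) * indicator {2..} (point_count W A \<omega>))"
  shows "G \<le> S + D + R" "S \<le> G + D + R"
proof -
  let ?n = "point_count W A \<omega>"
  have W_le: "W i \<omega> j \<le> \<zeta> \<omega> j" for i j
    using bdd unfolding max_process_def by (intro cSUP_upper) auto
  have small: "W i \<omega> j \<le> \<delta> * u" if "W i \<omega> \<notin> A" "j \<in> J" for i j
    using that W_nonneg[OF \<omega>] by (auto simp: A_def nonneg_seqs_def not_less)
  have \<zeta>_le: "\<zeta> \<omega> j \<le> c" if "\<And>i. W i \<omega> j \<le> c" for j c
    using Z.max_process_le_iff[OF bdd] that by blast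
  have \<zeta>_nonneg: "0 \<le> \<zeta> \<omega> j" for j using W_le[of 0 j] W_nonneg[OF \<omega>, of 0 j] by simp
  have g_small: "g (\<lambda>j. W i \<omega> j / u) = 0" if "W i \<omega> \<notin> A" for i
  proof (rule van)
    fix j assume "j \<in> J"
    then have "W i \<omega> j / u \<le> \<delta>" using small[OF that] u by (simp add: field_simps)
    then show "\<bar>W i \<omega> j / u\<bar> \<le> \<epsilon>" using \<delta> W_nonneg[OF \<omega>, of i j] u by simp
  qed
  have S_le: "S \<le> ennreal C * ?n"
  proof -
    have "S \<le> (\<integral>\<^sup>+ i. ennreal C * indicator A (W i \<omega>) \<partial>count_space UNIV)"
      unfolding S_def using g g_small by (intro nn_integral_mono) (auto simp: indicator_def intro: ennreal_leI)
    also have "\<dots> = ennreal C * ?n"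
      by (simp add: nn_integral_cmult W.point_count_eq)
    finally show ?thesis .
  qed
  have G_le: "G \<le> ennreal C" unfolding G_def using g by (intro ennreal_leI) auto
  consider "?n = 0" | "?n = 1" | "2 \<le> ?n"
  proof (cases rule: W.point_count_cases[of A \<omega>])
    case (1 k)
    consider "k = 0" | "k = 1" | "2 \<le> k" by linarith
    then show ?thesis
    proof cases
      case 3
      then have "(of_nat 2 :: ennreal) \<le> of_nat k" by (subst of_nat_le_iff)
      then show ?thesis using 1 that(3) by simp
    qed (use 1 that in auto)
  qed (use that(3) in simp)
  then have "G \<le> S + D + R \<and> S \<le> G + D + R"
  proof cases
    case 1
    then have none: "W i \<omega> \<notin> A" for i
      by (auto simp: point_count_def emeasure_count_space_eq_0)
    have "g (\<lambda>j. \<zeta> \<omega> j / u) = 0"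
    proof (rule van)
      fix j assume "j \<in> J"
      then have "\<zeta> \<omega> j \<le> \<delta> * u" using small[OF none] by (intro \<zeta>_le)
      then have "\<zeta> \<omega> j / u \<le> \<delta>" using u by (simp add: field_simps)
      then show "\<bar>\<zeta> \<omega> j / u\<bar> \<le> \<epsilon>" using \<delta> \<zeta>_nonneg[of j] u by simp
    qed
    then show ?thesis by (simp add: G_def S_def g_small[OF none])
  next
    case 2
    have "finite {i. W i \<omega> \<in> A}" using 2 by (rule_tac ccontr) (simp add: point_count_def)
    then have "card {i. W i \<omega> \<in> A} = 1" using 2 by (simp add: point_count_def)
    then obtain k where "{i. W i \<omega> \<in> A} = {k}" by (auto simp: card_1_singleton_iff)
    then have k: "W i \<omega> \<in> A \<longleftrightarrow> i = k" for i by auto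
    let ?w = "\<lambda>j. W k \<omega> j / u"
    have "S = (\<integral>\<^sup>+ i. ennreal (g ?w) * indicator {k} i \<partial>count_space UNIV)"
      unfolding S_def using g_small k by (intro nn_integral_cong) (auto simp: indicator_def)
    then have S: "S = ennreal (g ?w)" by (simp add: nn_integral_cmult)
    \<comment> \<open>The distance is at most \<open>\<delta>\<close>; boxes are open, hence the radius \<open>2 * \<delta>\<close>.\<close>
    have "(\<lambda>j. \<zeta> \<omega> j / u) \<in> box_on J (2 * \<delta>) ?w"
      unfolding box_on_def
    proof (intro CollectI ballI)
      fix j assume j: "j \<in> J"
      have "\<zeta> \<omega> j \<le> W k \<omega> j + \<delta> * u"
      proof (rule \<zeta>_le)
        fix i show "W i \<omega> j \<le> W k \<omega> j + \<delta> * u"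
          using small[of i j] j k[of i] W_nonneg[OF \<omega>, of k j] \<delta> u by (cases "i = k") auto
      qed
      then have "(\<zeta> \<omega> j - W k \<omega> j) / u \<le> \<delta>" using u by (simp add: field_simps)
      moreover have "0 \<le> (\<zeta> \<omega> j - W k \<omega> j) / u" using W_le[of k j] u by simp
      ultimately show "\<bar>\<zeta> \<omega> j / u - W k \<omega> j / u\<bar> < 2 * \<delta>" using \<delta> by (simp add: diff_divide_distrib)
    qed
    moreover have "?w \<in> box_on J (2 * \<delta>) ?w" using \<delta> by (simp add: box_on_def)
    ultimately have "ennreal \<bar>g (\<lambda>j. \<zeta> \<omega> j / u) - g ?w\<bar> \<le> oscillation g J (2 * \<delta>) ?w"
      by (rule oscillation_ge)
    also have "\<dots> = (\<integral>\<^sup>+ i. oscillation g J (2 * \<delta>) (\<lambda>j. W i \<omega> j / u) * indicator {k} i \<partial>count_space UNIV)"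
      by (subst nn_integral_count_space_indicator[symmetric]) (simp_all add: nn_integral_count_space_finite)
    also have "\<dots> \<le> D" unfolding D_def by (intro nn_integral_mono) (auto simp: indicator_def)
    finally have D: "ennreal \<bar>g (\<lambda>j. \<zeta> \<omega> j / u) - g ?w\<bar> \<le> D" .
    have "ennreal a \<le> ennreal b + ennreal \<bar>a - b\<bar>" if "0 \<le> b" for a b :: real
    proof -
      have "ennreal a \<le> ennreal (b + \<bar>a - b\<bar>)" by (intro ennreal_leI) linarith
      then show ?thesis using that by (simp add: ennreal_plus)
    qed
    from this[of "g ?w" "g (\<lambda>j. \<zeta> \<omega> j / u)"] this[of "g (\<lambda>j. \<zeta> \<omega> j / u)" "g ?w"]
    have "G \<le> S + ennreal \<bar>g (\<lambda>j. \<zeta> \<omega> j / u) - g ?w\<bar>" "S \<le> G + ennreal \<bar>g (\<lambda>j. \<zeta> \<omega> j / u) - g ?w\<bar>"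
      using g by (simp_all add: G_def S abs_minus_commute)
    then have "G \<le> S + D" "S \<le> G + D" using D by (auto intro: order_trans add_left_mono)
    then show ?thesis by (auto intro: order_trans)
  next
    case 3
    then have R: "R = ennreal C + ennreal C * ?n" by (simp add: R_def distrib_left)
    have "G \<le> R" unfolding R using G_le by (rule order_trans) simp
    moreover have "S \<le> R" unfolding R using S_le by (rule order_trans) simp
    ultimately show ?thesis by (auto intro: order_trans simp: add_increasing)
  qed
  then show "G \<le> S + D + R" "S \<le> G + D + R" by auto
qed

text \<open>
  Dominated convergence: the oscillation is at most \<open>C\<close>, and for boxes of radius at most \<open>\<epsilon> / 2\<close> it is zero unless some entry
  exceeds \<open>\<epsilon> / 2\<close>, which happens on a set of finite mass.
\<close>

lemma oscillation_vanishes: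
  fixes g :: "(int \<Rightarrow> real) \<Rightarrow> real"
  assumes J: "finite J" and \<epsilon>: "0 < \<epsilon>"
    and g: "\<And>y. 0 \<le> g y" "\<And>y. g y \<le> C"
    and van: "\<And>y. (\<And>j. j \<in> J \<Longrightarrow> \<bar>y j\<bar> \<le> \<epsilon>) \<Longrightarrow> g y = 0"
    and cont: "AE y in \<nu>. (\<exists>j\<in>J. y j \<noteq> 0) \<longrightarrow> box_continuous g J y"
  shows "(\<lambda>n. \<integral>\<^sup>+ y. oscillation g J (\<epsilon> / real (n + 2)) y \<partial>\<nu>) \<longlonglongrightarrow> 0"
proof -
  let ?d = "\<lambda>n :: nat. \<epsilon> / real (n + 2)"
  let ?B = "{y :: int \<Rightarrow> real. \<exists>j\<in>J. \<epsilon> / 2 < y j}"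
  have B [measurable]: "?B \<in> sets borel" using J by measurable
  have d: "0 < ?d n" "?d n \<le> \<epsilon> / 2" for n
    using \<epsilon> by (auto simp: field_simps)
  have C: "0 \<le> C" using g[of "\<lambda>_. 0"] by linarith
  have dlim: "?d \<longlonglongrightarrow> 0"
    using lim_const_over_n[of \<epsilon>] LIMSEQ_ignore_initial_segment by blast
  have zero: "oscillation g J (?d n) y = 0" if "y \<in> nonneg_seqs" "y \<notin> ?B" for n y
  proof -
    have "g w = 0" if "w \<in> box_on J (?d n) y" for w
    proof (rule van)
      fix j assume j: "j \<in> J"
      then have "\<bar>w j - y j\<bar> < ?d n" using that by (simp add: box_on_def)
      then have "\<bar>w j - y j\<bar> < \<epsilon> / 2" using d(2)[of n] by (rule less_le_trans)
      moreover have "0 \<le> y j" "y j \<le> \<epsilon> / 2"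
        using j \<open>y \<in> nonneg_seqs\<close> \<open>y \<notin> ?B\<close> by (auto simp: nonneg_seqs_def not_less)
      ultimately show "\<bar>w j\<bar> \<le> \<epsilon>" by linarith
    qed
    then have "oscillation g J (?d n) y \<le> ennreal 0" by (intro oscillation_le) simp
    then show ?thesis by simp
  qed
  have "(\<lambda>n. \<integral>\<^sup>+ y. oscillation g J (?d n) y \<partial>\<nu>) \<longlonglongrightarrow> (\<integral>\<^sup>+ y. 0 \<partial>\<nu>)"
  proof (rule nn_integral_dominated_convergence[where w = "\<lambda>y. ennreal C * indicator ?B y"])
    show "AE y in \<nu>. oscillation g J (?d n) y \<le> ennreal C * indicator ?B y" for n
      using nu_nonneg
    proof eventually_elim
      case (elim y)
      have "oscillation g J (?d n) y \<le> ennreal C"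
      proof (rule oscillation_le)
        show "\<bar>g w - g w'\<bar> \<le> C" for w w' using g(1)[of w] g(2)[of w] g(1)[of w'] g(2)[of w'] by linarith
      qed
      then show ?case using zero[OF elim, of n] by (auto simp: indicator_def)
    qed
    have "(\<integral>\<^sup>+ y. ennreal C * indicator ?B y \<partial>\<nu>) = ennreal C * emeasure \<nu> ?B"
      by (simp add: nn_integral_cmult_indicator)
    also have "\<dots> < \<infinity>"
      using emeasure_nu_exists_greater_finite[OF J, of "\<epsilon> / 2"] \<epsilon> by (simp add: ennreal_mult_less_top)
    finally show "(\<integral>\<^sup>+ y. ennreal C * indicator ?B y \<partial>\<nu>) < \<infinity>" .
    show "AE y in \<nu>. (\<lambda>n. oscillation g J (?d n) y) \<longlonglongrightarrow> 0"
      using nu_nonneg cont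
    proof eventually_elim
      case (elim y)
      show ?case
      proof (cases "\<exists>j\<in>J. y j \<noteq> 0")
        case True
        show ?thesis
        proof (rule order_tendstoI)
          fix a :: ennreal assume "0 < a"
          then obtain b where b: "0 < b" "b < a" using dense by blast
          then obtain e where e: "b = ennreal e" "0 < e" by (cases b) auto
          have "0 < e / 2" using e by simp
          moreover have "box_continuous g J y" using elim(2) True by blast
          ultimately obtain \<delta> where \<delta>: "0 < \<delta>" "\<And>w. w \<in> box_on J \<delta> y \<Longrightarrow> \<bar>g w - g y\<bar> < e / 2"
            unfolding box_continuous_def by blast
          have "eventually (\<lambda>n. ?d n < \<delta>) sequentially" by (rule order_tendstoD(2)[OF dlim \<delta>(1)])
          then show "eventually (\<lambda>n. oscillation g J (?d n) y < a) sequentially"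
          proof eventually_elim
            case (elim n)
            have "oscillation g J (?d n) y \<le> ennreal e"
            proof (rule oscillation_le)
              fix w w' assume "w \<in> box_on J (?d n) y" "w' \<in> box_on J (?d n) y"
              then have "w \<in> box_on J \<delta> y" "w' \<in> box_on J \<delta> y"
                using elim by (auto simp: box_on_def intro: less_trans)
              from \<delta>(2)[OF this(1)] \<delta>(2)[OF this(2)] show "\<bar>g w - g w'\<bar> \<le> e" by linarith
            qed
            then show ?case using b e by auto
          qed
        qed simp
      next
        case False
        then have "y \<notin> ?B" using \<epsilon> by (auto dest!: bspec)
        then show ?thesis using zero[OF elim(1)] by simp
      qed
    qed
  qed (use J in \<open>auto intro: measurable_oscillation\<close>)
  then show ?thesis by simp
qed

text \<open>
  Taking expectations in \<open>single_big_point\<close>: Campbell's formula and homogeneity give the sum mean \<open>u powr (- \<alpha>) * \<nu>(g)\<close>, the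
  oscillation term is of the same order with a factor that is small for small \<open>\<delta>\<close>, and the term of multiple points is of the order
  \<open>u powr (- 2 * \<alpha>)\<close>. The sign of \<open>g\<close> allows all of this to be done with non negative integrals.
\<close>

lemma tail_limit_nonneg:
  fixes g :: "(int \<Rightarrow> real) \<Rightarrow> real"
  assumes J: "finite J" and \<epsilon>: "0 < \<epsilon>" and gm [measurable]: "g \<in> borel_measurable borel"
    and g: "\<And>y. 0 \<le> g y" "\<And>y. g y \<le> C"
    and van: "\<And>y. (\<And>j. j \<in> J \<Longrightarrow> \<bar>y j\<bar> \<le> \<epsilon>) \<Longrightarrow> g y = 0"
    and cont: "AE y in \<nu>. (\<exists>j\<in>J. y j \<noteq> 0) \<longrightarrow> box_continuous g J y"
  shows "integrable \<nu> g"
    and "((\<lambda>u. u powr \<alpha> * (\<integral>\<omega>. g (\<lambda>j. \<zeta> \<omega> j / u) \<partial>N)) \<longlongrightarrow> (\<integral>y. g y \<partial>\<nu>)) at_top"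
proof -
  \<comment> \<open>A positive bound, so that its product with an infinite count is infinite.\<close>
  define C' where "C' = max 1 C"
  have C': "0 < C'" "\<And>y. g y \<le> C'" using g(2) by (auto simp: C'_def le_max_iff_disj)
  define V where "V \<delta> = measure \<nu> {y. \<exists>j\<in>J. \<delta> < y j}" for \<delta>
  define E where "E = (\<integral>y. g y \<partial>\<nu>)"
  have "(\<integral>\<^sup>+ y. ennreal (g y) \<partial>\<nu>) \<le> (\<integral>\<^sup>+ y. ennreal C' * indicator {y. \<exists>j\<in>J. \<epsilon> < y j} y \<partial>\<nu>)"
  proof (rule nn_integral_mono_AE)
    show "AE y in \<nu>. ennreal (g y) \<le> ennreal C' * indicator {y. \<exists>j\<in>J. \<epsilon> < y j} y"
      using nu_nonneg
    proof eventually_elim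
      case (elim y)
      then show ?case using van[of y] C'(2)[of y]
        by (auto simp: indicator_def nonneg_seqs_def not_less intro!: ennreal_leI)
    qed
  qed
  also have "\<dots> = ennreal C' * emeasure \<nu> {y. \<exists>j\<in>J. \<epsilon> < y j}"
    using J by (intro nn_integral_cmult_indicator) measurable
  also have "\<dots> < \<infinity>"
    using emeasure_nu_exists_greater_finite[OF J \<epsilon>] by (simp add: ennreal_mult_less_top)
  finally have fin: "(\<integral>\<^sup>+ y. ennreal (g y) \<partial>\<nu>) < \<infinity>" .
  show int: "integrable \<nu> g"
    using fin g by (intro integrableI_nonneg) auto
  have E: "(\<integral>\<^sup>+ y. ennreal (g y) \<partial>\<nu>) = ennreal E"
    unfolding E_def using g by (intro nn_integral_eq_integral int) auto
  have E_nonneg: "0 \<le> E" unfolding E_def using g by (intro Bochner_Integration.integral_nonneg) auto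
  have bound: "\<bar>u powr \<alpha> * (\<integral>\<omega>. g (\<lambda>j. \<zeta> \<omega> j / u) \<partial>N) - E\<bar> \<le> r + C' * (2 * (V \<delta>)\<^sup>2) * u powr (- \<alpha>)"
    if u: "0 < u" and \<delta>: "0 < \<delta>" "\<delta> \<le> \<epsilon>" and r: "0 \<le> r" "(\<integral>\<^sup>+ y. oscillation g J (2 * \<delta>) y \<partial>\<nu>) = ennreal r"
    for u \<delta> r
  proof -
    define A where "A = nonneg_seqs \<inter> {y :: int \<Rightarrow> real. \<exists>j\<in>J. \<delta> * u < y j}"
    let ?G = "\<lambda>\<omega>. ennreal (g (\<lambda>j. \<zeta> \<omega> j / u))"
    let ?S = "\<lambda>\<omega>. \<integral>\<^sup>+ i. ennreal (g (\<lambda>j. W i \<omega> j / u)) \<partial>count_space UNIV"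
    let ?D = "\<lambda>\<omega>. \<integral>\<^sup>+ i. oscillation g J (2 * \<delta>) (\<lambda>j. W i \<omega> j / u) \<partial>count_space UNIV"
    let ?R = "\<lambda>\<omega>. ennreal C' * ((1 + point_count W A \<omega>) * indicator {2..} (point_count W A \<omega>))"
    have sc [measurable]: "(\<lambda>y j. y j / u) \<in> borel_measurable (borel :: (int \<Rightarrow> real) measure)"
      by (rule measurable_seqI) measurable
    have scW [measurable]: "(\<lambda>\<omega> j. W i \<omega> j / u) \<in> borel_measurable N" for i
      by (rule measurable_compose[OF W_borel sc])
    note [measurable] = measurable_oscillation[OF J]
    have A0 [measurable]: "{y :: int \<Rightarrow> real. \<exists>j\<in>J. \<delta> * u < y j} \<in> sets borel" using J by measurable
    have A [measurable]: "A \<in> sets (restrict_space \<nu> nonneg_seqs)"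
      unfolding A_def by (auto simp: sets_restrict_space)
    have mA: "emeasure (restrict_space \<nu> nonneg_seqs) A = emeasure \<nu> {y. \<exists>j\<in>J. \<delta> * u < y j}"
    proof -
      have "emeasure (restrict_space \<nu> nonneg_seqs) A = emeasure \<nu> A"
        unfolding A_def by (rule emeasure_restrict_space) auto
      also have "\<dots> = emeasure \<nu> {y. \<exists>j\<in>J. \<delta> * u < y j}"
        unfolding A_def using nu_nonneg by (intro emeasure_eq_AE) (auto elim!: eventually_mono)
      finally show ?thesis .
    qed
    have finA: "emeasure (restrict_space \<nu> nonneg_seqs) A < top"
      unfolding mA using u \<delta> by (intro emeasure_nu_exists_greater_finite J) auto
    have "measure (restrict_space \<nu> nonneg_seqs) A = measure \<nu> {y. \<exists>j\<in>J. u * \<delta> < y j}"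
      unfolding measure_def mA by (simp add: mult.commute)
    also have "\<dots> = u powr (- \<alpha>) * V \<delta>"
      unfolding V_def using u \<delta> J by (intro measure_nu_exists_scale)
    finally have valA: "measure (restrict_space \<nu> nonneg_seqs) A = u powr (- \<alpha>) * V \<delta>" .
    have Sint: "(\<integral>\<^sup>+ \<omega>. ?S \<omega> \<partial>N) = ennreal (u powr (- \<alpha>) * E)"
    proof -
      have "(\<integral>\<^sup>+ \<omega>. ?S \<omega> \<partial>N) = (\<integral>\<^sup>+ y. ennreal (g (\<lambda>j. y j / u)) \<partial>\<nu>)"
        by (rule campbell_nu) measurable
      also have "\<dots> = (\<integral>\<^sup>+ y. ennreal (g (\<lambda>j. inverse u * y j)) \<partial>\<nu>)"
        by (simp add: divide_inverse mult.commute)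
      also have "\<dots> = ennreal (inverse u powr \<alpha>) * (\<integral>\<^sup>+ y. ennreal (g y) \<partial>\<nu>)"
        using u by (intro nn_integral_nu_scale) auto
      also have "inverse u powr \<alpha> = u powr (- \<alpha>)" by (simp add: powr_minus inverse_powr)
      finally show ?thesis using E_nonneg by (simp add: E ennreal_mult)
    qed
    have Dint: "(\<integral>\<^sup>+ \<omega>. ?D \<omega> \<partial>N) = ennreal (u powr (- \<alpha>) * r)"
    proof -
      have "(\<integral>\<^sup>+ \<omega>. ?D \<omega> \<partial>N) = (\<integral>\<^sup>+ y. oscillation g J (2 * \<delta>) (\<lambda>j. y j / u) \<partial>\<nu>)"
        by (rule campbell_nu) measurable
      also have "\<dots> = (\<integral>\<^sup>+ y. oscillation g J (2 * \<delta>) (\<lambda>j. inverse u * y j) \<partial>\<nu>)"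
        by (simp add: divide_inverse mult.commute)
      also have "\<dots> = ennreal (inverse u powr \<alpha>) * (\<integral>\<^sup>+ y. oscillation g J (2 * \<delta>) y \<partial>\<nu>)"
        using u by (intro nn_integral_nu_scale) auto
      also have "inverse u powr \<alpha> = u powr (- \<alpha>)" by (simp add: powr_minus inverse_powr)
      finally show ?thesis using r by (simp add: ennreal_mult)
    qed
    have Rint: "(\<integral>\<^sup>+ \<omega>. ?R \<omega> \<partial>N) \<le> ennreal (C' * (2 * (u powr (- \<alpha>) * V \<delta>)\<^sup>2))"
    proof -
      have "(\<integral>\<^sup>+ \<omega>. ?R \<omega> \<partial>N)
          = ennreal C' * (\<integral>\<^sup>+ \<omega>. (1 + point_count W A \<omega>) * indicator {2..} (point_count W A \<omega>) \<partial>N)"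
        by (rule nn_integral_cmult) measurable
      also have "\<dots> \<le> ennreal C' * ennreal (2 * (u powr (- \<alpha>) * V \<delta>)\<^sup>2)"
        using W.multiple_points_bound[OF A finA] unfolding valA by (rule mult_left_mono) simp
      finally show ?thesis using C' by (simp add: ennreal_mult)
    qed
    have mS: "?S \<in> borel_measurable N" "?D \<in> borel_measurable N"
      unfolding nn_integral_count_space_nat by measurable
    define I where "I = (\<integral>\<omega>. g (\<lambda>j. \<zeta> \<omega> j / u) \<partial>N)"
    have intG: "integrable N (\<lambda>\<omega>. g (\<lambda>j. \<zeta> \<omega> j / u))"
      by (rule W.integrable_const_bound[where B = C']) (use g C' in auto)
    have I: "(\<integral>\<^sup>+ \<omega>. ?G \<omega> \<partial>N) = ennreal I"
      unfolding I_def using g by (intro nn_integral_eq_integral intG) auto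
    have I_nonneg: "0 \<le> I" unfolding I_def using g by (intro Bochner_Integration.integral_nonneg) auto
    have path: "AE \<omega> in N. ?G \<omega> \<le> ?S \<omega> + ?D \<omega> + ?R \<omega> \<and> ?S \<omega> \<le> ?G \<omega> + ?D \<omega> + ?R \<omega>"
      using Z.AE_bdd AE_space
    proof eventually_elim
      case (elim \<omega>)
      show ?case unfolding A_def
        by (intro conjI single_big_point[OF J \<delta> u C'(1) g(1) C'(2) van]) (use elim in auto)
    qed
    let ?e = "u powr (- \<alpha>) * r + C' * (2 * (u powr (- \<alpha>) * V \<delta>)\<^sup>2)"
    have e: "(\<integral>\<^sup>+ \<omega>. ?D \<omega> \<partial>N) + (\<integral>\<^sup>+ \<omega>. ?R \<omega> \<partial>N) \<le> ennreal ?e"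
      using Rint r C' by (simp add: Dint ennreal_plus)
    have "ennreal I \<le> (\<integral>\<^sup>+ \<omega>. ?S \<omega> + ?D \<omega> + ?R \<omega> \<partial>N)"
      unfolding I[symmetric] using path by (intro nn_integral_mono_AE) (auto elim!: eventually_mono)
    also have "\<dots> = (\<integral>\<^sup>+ \<omega>. ?S \<omega> \<partial>N) + ((\<integral>\<^sup>+ \<omega>. ?D \<omega> \<partial>N) + (\<integral>\<^sup>+ \<omega>. ?R \<omega> \<partial>N))"
      using mS by (simp add: nn_integral_add add.assoc)
    also have "\<dots> \<le> ennreal (u powr (- \<alpha>) * E) + ennreal ?e"
      unfolding Sint by (rule add_left_mono[OF e])
    finally have 1: "I \<le> u powr (- \<alpha>) * E + ?e"
      using E_nonneg r C' by (simp add: ennreal_plus[symmetric] ennreal_le_iff del: ennreal_plus)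
    have "ennreal (u powr (- \<alpha>) * E) \<le> (\<integral>\<^sup>+ \<omega>. ?G \<omega> + ?D \<omega> + ?R \<omega> \<partial>N)"
      unfolding Sint[symmetric] using path by (intro nn_integral_mono_AE) (auto elim!: eventually_mono)
    also have "\<dots> = (\<integral>\<^sup>+ \<omega>. ?G \<omega> \<partial>N) + ((\<integral>\<^sup>+ \<omega>. ?D \<omega> \<partial>N) + (\<integral>\<^sup>+ \<omega>. ?R \<omega> \<partial>N))"
      using mS by (simp add: nn_integral_add add.assoc)
    also have "\<dots> \<le> ennreal I + ennreal ?e"
      unfolding I by (rule add_left_mono[OF e])
    finally have 2: "u powr (- \<alpha>) * E \<le> I + ?e"
      using I_nonneg r C' by (simp add: ennreal_plus[symmetric] ennreal_le_iff del: ennreal_plus)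
    have uu: "u powr \<alpha> * u powr (- \<alpha>) = 1" using u by (simp add: powr_add[symmetric])
    have abs: "\<bar>I - u powr (- \<alpha>) * E\<bar> \<le> ?e" using 1 2 by linarith
    have "u powr \<alpha> * I - E = u powr \<alpha> * (I - u powr (- \<alpha>) * E)"
      using uu by (simp add: right_diff_distrib mult.assoc[symmetric])
    then have "\<bar>u powr \<alpha> * I - E\<bar> = u powr \<alpha> * \<bar>I - u powr (- \<alpha>) * E\<bar>" by (simp add: abs_mult)
    also have "\<dots> \<le> u powr \<alpha> * ?e" using abs by (rule mult_left_mono) simp
    also have "u powr \<alpha> * ?e = (u powr \<alpha> * u powr (- \<alpha>)) * r
        + C' * (2 * (V \<delta>)\<^sup>2) * ((u powr \<alpha> * u powr (- \<alpha>)) * u powr (- \<alpha>))"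
      by (simp add: power2_eq_square algebra_simps)
    also have "\<dots> = r + C' * (2 * (V \<delta>)\<^sup>2) * u powr (- \<alpha>)" unfolding uu by simp
    finally show ?thesis unfolding I_def .
  qed
  have osc: "(\<lambda>n. \<integral>\<^sup>+ y. oscillation g J (\<epsilon> / real (n + 2)) y \<partial>\<nu>) \<longlonglongrightarrow> 0"
    by (rule oscillation_vanishes[OF J \<epsilon> g van cont])
  show "((\<lambda>u. u powr \<alpha> * (\<integral>\<omega>. g (\<lambda>j. \<zeta> \<omega> j / u) \<partial>N)) \<longlongrightarrow> (\<integral>y. g y \<partial>\<nu>)) at_top"
    unfolding E_def[symmetric]
  proof (rule tendstoI)
    fix e :: real assume e: "0 < e"
    have "eventually (\<lambda>n. (\<integral>\<^sup>+ y. oscillation g J (\<epsilon> / real (n + 2)) y \<partial>\<nu>) < ennreal (e / 2)) sequentially"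
      by (rule order_tendstoD(2)[OF osc]) (use e in simp)
    then obtain n where n: "(\<integral>\<^sup>+ y. oscillation g J (\<epsilon> / real (n + 2)) y \<partial>\<nu>) < ennreal (e / 2)"
      by (auto simp: eventually_sequentially)
    define \<delta> where "\<delta> = \<epsilon> / real (n + 2) / 2"
    have \<delta>: "0 < \<delta>" "\<delta> \<le> \<epsilon>" using \<epsilon> by (auto simp: \<delta>_def field_simps)
    have "2 * (a / 2) = a" for a :: real by simp
    then have "2 * \<delta> = \<epsilon> / real (n + 2)" unfolding \<delta>_def .
    then have n': "(\<integral>\<^sup>+ y. oscillation g J (2 * \<delta>) y \<partial>\<nu>) < ennreal (e / 2)"
      using n by (simp only:)
    obtain r where r: "(\<integral>\<^sup>+ y. oscillation g J (2 * \<delta>) y \<partial>\<nu>) = ennreal r" "0 \<le> r" "r < e / 2"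
    proof (cases "\<integral>\<^sup>+ y. oscillation g J (2 * \<delta>) y \<partial>\<nu>")
      case (real r)
      then show ?thesis using n' that[of r] by (simp add: ennreal_less_iff)
    next
      case top
      then show ?thesis using n' by simp
    qed
    have "((\<lambda>u. C' * (2 * (V \<delta>)\<^sup>2) * u powr (- \<alpha>)) \<longlongrightarrow> C' * (2 * (V \<delta>)\<^sup>2) * 0) at_top"
      using \<alpha>_pos by (intro tendsto_intros tendsto_neg_powr filterlim_ident) auto
    then have "eventually (\<lambda>u. C' * (2 * (V \<delta>)\<^sup>2) * u powr (- \<alpha>) < e / 2) at_top"
      using e by (intro order_tendstoD(2)) auto
    then show "eventually (\<lambda>u. dist (u powr \<alpha> * (\<integral>\<omega>. g (\<lambda>j. \<zeta> \<omega> j / u) \<partial>N)) E < e) at_top"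
      using eventually_gt_at_top[of 0]
    proof eventually_elim
      case (elim u)
      show ?case using bound[OF elim(2) \<delta> r(2,1)] elim(1) r(3) by (simp add: dist_real_def)
    qed
  qed
qed

end

section \<open>Limits for signed functions that are continuous almost everywhere\<close>

lemma continuous_on_restrict: "continuous_on S (\<lambda>y :: int \<Rightarrow> real. restrict y J)"
proof (rule continuous_on_coordinatewise_then_product)
  fix i
  show "continuous_on S (\<lambda>y :: int \<Rightarrow> real. restrict y J i)"
    by (cases "i \<in> J") (auto intro!: continuous_on_product_coordinates continuous_on_subset[of UNIV])
qed

lemma measurable_restrict_seq [measurable]:
  "(\<lambda>y :: int \<Rightarrow> real. restrict y J) \<in> borel \<rightarrow>\<^sub>M Pi\<^sub>M J (\<lambda>_. borel)"
  by (rule measurable_restrict) measurable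

lemma measurable_embed_seq: "(\<lambda>y. y) \<in> Pi\<^sub>M J (\<lambda>_. borel :: real measure) \<rightarrow>\<^sub>M (borel :: (int \<Rightarrow> real) measure)"
proof (rule measurable_seqI)
  fix i
  show "(\<lambda>y. y i) \<in> borel_measurable (Pi\<^sub>M J (\<lambda>_. borel :: real measure))"
  proof (cases "i \<in> J")
    case False
    then have "(\<lambda>y. y i) \<in> borel_measurable (Pi\<^sub>M J (\<lambda>_. borel :: real measure))
        \<longleftrightarrow> (\<lambda>y. undefined :: real) \<in> borel_measurable (Pi\<^sub>M J (\<lambda>_. borel :: real measure))"
      by (intro measurable_cong) (auto simp: space_PiM PiE_def extensional_def)
    then show ?thesis by simp
  qed (rule measurable_component_singleton)
qed

text \<open>
  A neighbourhood in the product topology constrains finitely many coordinates, possibly some outside \<open>J\<close>; these are harmless because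
  \<open>g\<close> does not see them.
\<close>

lemma continuous_box:
  fixes g :: "(int \<Rightarrow> real) \<Rightarrow> real"
  assumes J: "finite J" and dep: "\<And>w w'. (\<And>j. j \<in> J \<Longrightarrow> w j = w' j) \<Longrightarrow> g w = g w'"
    and U: "open U" "y \<in> U" and cont: "continuous_on U g"
  shows "box_continuous g J y"
  unfolding box_continuous_def
proof (intro allI impI)
  fix \<eta> :: real assume \<eta>: "0 < \<eta>"
  let ?O = "U \<inter> g -` ball (g y) \<eta>"
  have "open ?O" by (rule continuous_open_preimage[OF cont U(1)]) simp
  then have op: "openin (product_topology (\<lambda>i. euclidean) UNIV) ?O" by (simp add: open_fun_def)
  have "y \<in> ?O" using U \<eta> by simp
  from product_topology_open_contains_basis[OF op this]
  obtain X where X: "y \<in> Pi\<^sub>E UNIV X" "\<forall>i. openin euclidean (X i)" "Pi\<^sub>E UNIV X \<subseteq> ?O"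
    by blast
  have "\<exists>d>0. ball (y i) d \<subseteq> X i" for i
  proof -
    have "open (X i)" "y i \<in> X i" using X(1,2) by (simp_all add: PiE_iff)
    then show ?thesis by (meson openE)
  qed
  then obtain d where d: "\<And>i. 0 < d i" "\<And>i. ball (y i) (d i) \<subseteq> X i" by metis
  define \<delta> where "\<delta> = Min (insert 1 (d ` J))"
  have "0 < \<delta>" unfolding \<delta>_def using J d(1) by (subst Min_gr_iff) auto
  moreover have "\<bar>g w - g y\<bar> < \<eta>" if w: "w \<in> box_on J \<delta> y" for w
  proof -
    \<comment> \<open>Off \<open>J\<close> the sequence \<open>w\<close> is unconstrained; \<open>?w\<close> replaces it there by \<open>y\<close>, with no effect on \<open>g\<close>.\<close>
    let ?w = "\<lambda>i. if i \<in> J then w i else y i"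
    have "?w i \<in> X i" for i
    proof (cases "i \<in> J")
      case True
      have "\<delta> \<le> d i" unfolding \<delta>_def using J True by (intro Min_le) auto
      then have "w i \<in> ball (y i) (d i)" using w True by (auto simp: box_on_def dist_real_def abs_minus_commute)
      then show ?thesis using d(2)[of i] True by auto
    qed (use X(1) in \<open>auto simp: PiE_iff\<close>)
    then have "?w \<in> Pi\<^sub>E UNIV X" by (simp add: PiE_iff)
    with X(3) have "?w \<in> ?O" by blast
    then have "\<bar>g ?w - g y\<bar> < \<eta>" by (simp add: dist_real_def abs_minus_commute)
    also have "g ?w = g w" by (rule dep) simp
    finally show ?thesis .
  qed
  ultimately show "\<exists>\<delta>>0. \<forall>w\<in>box_on J \<delta> y. \<bar>g w - g y\<bar> < \<eta>" by blast
qed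

context max_stable_poisson
begin

text \<open>
  The positive and the negative part satisfy the hypotheses of \<open>tail_limit_nonneg\<close> separately.
\<close>

lemma tail_limit:
  fixes g :: "(int \<Rightarrow> real) \<Rightarrow> real"
  assumes J: "finite J" and \<epsilon>: "0 < \<epsilon>" and gm [measurable]: "g \<in> borel_measurable borel"
    and g: "\<And>y. \<bar>g y\<bar> \<le> C"
    and van: "\<And>y. (\<And>j. j \<in> J \<Longrightarrow> \<bar>y j\<bar> \<le> \<epsilon>) \<Longrightarrow> g y = 0"
    and cont: "AE y in \<nu>. (\<exists>j\<in>J. y j \<noteq> 0) \<longrightarrow> box_continuous g J y"
  shows "((\<lambda>u. u powr \<alpha> * (\<integral>\<omega>. g (\<lambda>j. \<zeta> \<omega> j / u) \<partial>N)) \<longlongrightarrow> (\<integral>y. g y \<partial>\<nu>)) at_top"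
proof -
  let ?p = "\<lambda>y. max 0 (g y)" and ?m = "\<lambda>y. max 0 (- g y)"
  have part: "integrable \<nu> (\<lambda>y. max 0 (s * g y))
      \<and> ((\<lambda>u. u powr \<alpha> * (\<integral>\<omega>. max 0 (s * g (\<lambda>j. \<zeta> \<omega> j / u)) \<partial>N)) \<longlongrightarrow> (\<integral>y. max 0 (s * g y) \<partial>\<nu>)) at_top"
    if s: "\<bar>s\<bar> = 1" for s :: real
  proof -
    have s': "s = 1 \<or> s = -1" using s by linarith
    have m: "(\<lambda>y. max 0 (s * g y)) \<in> borel_measurable borel" by measurable
    have nonneg: "0 \<le> max 0 (s * g y)" for y by simp
    have le: "max 0 (s * g y) \<le> C" for y using s' g[of y] by auto
    have zero: "max 0 (s * g y) = 0" if "\<And>j. j \<in> J \<Longrightarrow> \<bar>y j\<bar> \<le> \<epsilon>" for y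
      using van[OF that] by simp
    have contr: "\<bar>max 0 (s * g w) - max 0 (s * g y)\<bar> \<le> \<bar>g w - g y\<bar>" for w y
      using s' by (auto simp: max_def)
    have co: "AE y in \<nu>. (\<exists>j\<in>J. y j \<noteq> 0) \<longrightarrow> box_continuous (\<lambda>y. max 0 (s * g y)) J y"
      using cont unfolding box_continuous_def by (rule eventually_mono) (meson contr le_less_trans)
    show ?thesis
      by (intro conjI tail_limit_nonneg[OF J \<epsilon> m nonneg le _ co]) (rule zero, blast)+
  qed
  from part[of 1] part[of "-1"]
  have intp: "integrable \<nu> ?p" and limp: "((\<lambda>u. u powr \<alpha> * (\<integral>\<omega>. ?p (\<lambda>j. \<zeta> \<omega> j / u) \<partial>N)) \<longlongrightarrow> (\<integral>y. ?p y \<partial>\<nu>)) at_top"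
    and intm: "integrable \<nu> ?m" and limm: "((\<lambda>u. u powr \<alpha> * (\<integral>\<omega>. ?m (\<lambda>j. \<zeta> \<omega> j / u) \<partial>N)) \<longlongrightarrow> (\<integral>y. ?m y \<partial>\<nu>)) at_top"
    by simp_all
  have split: "g y = ?p y - ?m y" for y by (simp add: max_def)
  have "(\<integral>\<omega>. g (\<lambda>j. \<zeta> \<omega> j / u) \<partial>N) = (\<integral>\<omega>. ?p (\<lambda>j. \<zeta> \<omega> j / u) \<partial>N) - (\<integral>\<omega>. ?m (\<lambda>j. \<zeta> \<omega> j / u) \<partial>N)" for u
  proof -
    have C: "0 \<le> C" using g[of "\<lambda>_. 0"] by linarith
    have "integrable N (\<lambda>\<omega>. ?p (\<lambda>j. \<zeta> \<omega> j / u))" "integrable N (\<lambda>\<omega>. ?m (\<lambda>j. \<zeta> \<omega> j / u))"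
      using g C by (auto intro!: W.integrable_const_bound[where B = C] simp: abs_le_iff max_def)
    then have "(\<integral>\<omega>. ?p (\<lambda>j. \<zeta> \<omega> j / u) - ?m (\<lambda>j. \<zeta> \<omega> j / u) \<partial>N)
        = (\<integral>\<omega>. ?p (\<lambda>j. \<zeta> \<omega> j / u) \<partial>N) - (\<integral>\<omega>. ?m (\<lambda>j. \<zeta> \<omega> j / u) \<partial>N)"
      by (rule Bochner_Integration.integral_diff)
    then show ?thesis by (simp only: split[symmetric])
  qed
  moreover have "(\<integral>y. g y \<partial>\<nu>) = (\<integral>y. ?p y \<partial>\<nu>) - (\<integral>y. ?m y \<partial>\<nu>)"
    using Bochner_Integration.integral_diff[OF intp intm] by (simp only: split[symmetric])
  ultimately show ?thesis
    using tendsto_diff[OF limp limm] by (simp add: right_diff_distrib)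
qed

end

context max_stable_poisson
begin

section \<open>The tail process\<close>

lemma nu_0_neq: "AE y in \<nu>. y 0 \<noteq> 1"
proof -
  have "emeasure \<nu> {y. y 0 = 1} = (\<integral>\<^sup>+ y. indicator {y. y 0 = 1} y \<partial>\<nu>)" by simp
  also have "\<dots> = (\<integral>\<^sup>+ y. indicator {y. y 0 = 1} y * indicator {y. y 0 \<noteq> 0} y \<partial>\<nu>)"
    by (intro nn_integral_cong) (auto simp: indicator_def)
  also have "\<dots> = (\<integral>\<^sup>+ r. (\<integral>\<^sup>+ \<omega>. indicator {y. y 0 = 1} (\<lambda>i. r * \<Theta> \<omega> i) \<partial>M) \<partial>\<rho>)"
    by (rule nn_integral_nu_nonzero) measurable
  also have "\<dots> = (\<integral>\<^sup>+ r. 0 \<partial>\<rho>)"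
  proof (rule nn_integral_cong_AE[OF eventually_mono[OF AE_radial_neq]])
    fix r :: real assume "r \<noteq> 1"
    then have "(\<integral>\<^sup>+ \<omega>. indicator {y. y 0 = 1} (\<lambda>i. r * \<Theta> \<omega> i) \<partial>M) = (\<integral>\<^sup>+ \<omega>. 0 \<partial>M)"
      using \<Theta>_0 by (intro nn_integral_cong_AE) (auto elim!: eventually_mono)
    then show "(\<integral>\<^sup>+ \<omega>. indicator {y. y 0 = 1} (\<lambda>i. r * \<Theta> \<omega> i) \<partial>M) = 0" by simp
  qed
  finally have "emeasure \<nu> {y. y 0 = 1} = 0" by simp
  then show ?thesis by (intro AE_I[where N = "{y. y 0 = 1}"]) auto
qed

text \<open>
  The indicator makes the function vanish near the origin. It is discontinuous where \<open>y 0 = 1\<close>, a null set of \<open>\<nu>\<close>.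
\<close>

lemma conditional_tail_limit:
  fixes f :: "(int \<Rightarrow> real) \<Rightarrow> real"
  assumes J: "finite J" and cont: "continuous_on (PiE J (\<lambda>_. UNIV)) f"
    and bdd: "\<And>y. \<bar>f (restrict y J)\<bar> \<le> C"
  shows "((\<lambda>u. u powr \<alpha> * (\<integral>\<omega>. f (restrict (\<lambda>j. \<zeta> \<omega> j / u) J) * indicator {y. 1 < y 0} (\<lambda>j. \<zeta> \<omega> j / u) \<partial>N))
    \<longlongrightarrow> (\<integral>y. f (restrict y J) * indicator {y. 1 < y 0} y \<partial>\<nu>)) at_top"
proof -
  let ?h = "\<lambda>y. f (restrict y J)"
  let ?g = "\<lambda>y. ?h y * indicator {y. 1 < y 0} y :: real"
  have C: "0 \<le> C" using bdd[of undefined] by linarith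
  have h: "continuous_on S ?h" for S
    by (rule continuous_on_compose2[OF cont continuous_on_restrict]) auto
  have hm [measurable]: "?h \<in> borel_measurable borel"
    by (rule borel_measurable_continuous_onI) (rule h)
  show ?thesis
  proof (rule tail_limit[where J = "insert 0 J" and \<epsilon> = 1 and C = C])
    show "\<bar>?g y\<bar> \<le> C" for y using bdd[of y] C by (auto simp: indicator_def)
    show "?g y = 0" if "\<And>j. j \<in> insert 0 J \<Longrightarrow> \<bar>y j\<bar> \<le> 1" for y using that[of 0] by (auto simp: indicator_def abs_le_iff)
    have dep: "?g w = ?g w'" if "\<And>j. j \<in> insert 0 J \<Longrightarrow> w j = w' j" for w w'
    proof -
      have "restrict w J = restrict w' J" using that by (auto simp: restrict_def)
      then show ?thesis using that[of 0] by (simp add: indicator_def)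
    qed
    have "box_continuous ?g (insert 0 J) y" if "y 0 \<noteq> 1" for y
    proof (cases "1 < y 0")
      case True
      have "continuous_on {y. 1 < y 0} ?g \<longleftrightarrow> continuous_on {y. 1 < y 0} ?h"
        by (rule continuous_on_cong) auto
      then have c: "continuous_on {y. 1 < y 0} ?g" using h by simp
      have o: "open {y :: int \<Rightarrow> real. 1 < y 0}"
        by (intro open_Collect_less continuous_intros continuous_on_product_coordinates)
      show ?thesis by (rule continuous_box[OF _ dep o _ c]) (use J True that in auto)
    next
      case False
      have "continuous_on {y. y 0 < 1} ?g \<longleftrightarrow> continuous_on {y :: int \<Rightarrow> real. y 0 < 1} (\<lambda>y. 0 :: real)"
        by (rule continuous_on_cong) (auto simp: indicator_def)
      then have c: "continuous_on {y. y 0 < 1} ?g" by simp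
      have o: "open {y :: int \<Rightarrow> real. y 0 < 1}"
        by (intro open_Collect_less continuous_intros continuous_on_product_coordinates)
      show ?thesis by (rule continuous_box[OF _ dep o _ c]) (use J False that in auto)
    qed
    then show "AE y in \<nu>. (\<exists>j\<in>insert 0 J. y j \<noteq> 0) \<longrightarrow> box_continuous ?g (insert 0 J) y"
      using nu_0_neq by (auto elim!: eventually_mono)
  qed (use J in auto)
qed

abbreviation "exceed u \<equiv> {\<omega> \<in> space N. u < \<bar>\<zeta> \<omega> 0\<bar>}"

lemma sets_exceed [measurable]: "exceed u \<in> sets N"
proof -
  show ?thesis by measurable
qed

lemma AE_exceed:
  assumes u: "0 < u"
  shows "AE \<omega> in N. u < \<bar>\<zeta> \<omega> 0\<bar> \<longleftrightarrow> 1 < \<zeta> \<omega> 0 / u"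
  using Z.AE_bdd AE_space
proof eventually_elim
  case (elim \<omega>)
  have "0 \<le> W 0 \<omega> 0" by (rule W_nonneg[OF elim(2)])
  also have "W 0 \<omega> 0 \<le> \<zeta> \<omega> 0" using Z.max_process_le_iff[of \<omega> 0 "\<zeta> \<omega> 0"] elim(1) by auto
  finally show ?case using u by (simp add: field_simps)
qed

lemma tail_prob_limit:
  "((\<lambda>u. u powr \<alpha> * measure N (exceed u)) \<longlongrightarrow> 1) at_top"
proof -
  have lim: "((\<lambda>u. u powr \<alpha> * (\<integral>\<omega>. 1 * indicator {y. 1 < y 0} (\<lambda>j. \<zeta> \<omega> j / u) \<partial>N))
    \<longlongrightarrow> (\<integral>y. 1 * indicator {y. 1 < y 0} y \<partial>\<nu>)) at_top"
    using conditional_tail_limit[of "{}" "\<lambda>_. 1" 1] by simp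
  have one: "(\<integral>y. 1 * indicator {y. 1 < y 0} y \<partial>\<nu>) = (1 :: real)"
    using emeasure_nu_0_greater[of 1] by (simp add: measure_def)
  have ev: "eventually (\<lambda>u. u powr \<alpha> * (\<integral>\<omega>. 1 * indicator {y. 1 < y 0} (\<lambda>j. \<zeta> \<omega> j / u) \<partial>N)
      = u powr \<alpha> * measure N (exceed u)) at_top"
    using eventually_gt_at_top[of 0]
  proof eventually_elim
    case (elim u)
    have "(\<integral>\<omega>. 1 * indicator {y. 1 < y 0} (\<lambda>j. \<zeta> \<omega> j / u) \<partial>N)
        = (\<integral>\<omega>. (indicator (exceed u) \<omega> :: real) \<partial>N)"
    proof (rule integral_cong_AE)
      show "(\<lambda>\<omega>. 1 * indicator {y. 1 < y 0} (\<lambda>j. \<zeta> \<omega> j / u) :: real) \<in> borel_measurable N"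
        unfolding indicator_def by measurable
      show "AE \<omega> in N. 1 * indicator {y. 1 < y 0} (\<lambda>j. \<zeta> \<omega> j / u)
          = (indicator (exceed u) \<omega> :: real)"
        using AE_exceed[OF elim] AE_space by eventually_elim (simp add: indicator_def)
    qed measurable
    then show ?case by simp
  qed
  from Lim_transform_eventually[OF lim[unfolded one] ev] show ?thesis .
qed

text \<open>
  In the limit, dividing by the exceedance probability amounts to multiplying by \<open>u powr \<alpha>\<close>.
\<close>

lemma ratio_limit:
  assumes "((\<lambda>u. u powr \<alpha> * I u) \<longlongrightarrow> l) at_top"
  shows "((\<lambda>u. I u / measure N (exceed u)) \<longlongrightarrow> l) at_top"
proof -
  have "((\<lambda>u. (u powr \<alpha> * I u) / (u powr \<alpha> * measure N (exceed u))) \<longlongrightarrow> l / 1) at_top"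
    by (intro tendsto_divide assms tail_prob_limit) simp
  then have "((\<lambda>u. (u powr \<alpha> * I u) / (u powr \<alpha> * measure N (exceed u))) \<longlongrightarrow> l) at_top" by simp
  moreover have "eventually (\<lambda>u. (u powr \<alpha> * I u) / (u powr \<alpha> * measure N (exceed u))
      = I u / measure N (exceed u)) at_top"
    using eventually_gt_at_top[of 0] by eventually_elim simp
  ultimately show ?thesis by (rule Lim_transform_eventually)
qed

text \<open>
  By \<open>nn_integral_Y\<close>, the limit found in \<open>conditional_tail_limit\<close> is an expectation under the law of \<open>Y = Y\<^sub>0 \<Theta>\<close>.
\<close>

lemma tail_process: "tail_process_law N \<zeta> (distr PM borel Y)"
  unfolding tail_process_law_def
proof (intro conjI allI impI)
  interpret PM: prob_space PM by (rule prob_space_PM)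
  show "prob_space (distr PM borel Y)" by (rule PM.prob_space_distr) measurable
  fix J :: "int set" and f :: "(int \<Rightarrow> real) \<Rightarrow> real"
  assume J: "finite J" and f: "continuous_on (PiE J (\<lambda>_. UNIV)) f \<and> bounded (f ` PiE J (\<lambda>_. UNIV))"
  let ?h = "\<lambda>y. f (restrict y J)"
  obtain C where C: "\<And>y. y \<in> PiE J (\<lambda>_. UNIV) \<Longrightarrow> \<bar>f y\<bar> \<le> C"
    using f by (auto simp: bounded_iff)
  have [measurable]: "?h \<in> borel_measurable borel"
    by (rule borel_measurable_continuous_onI, rule continuous_on_compose2[OF conjunct1[OF f] continuous_on_restrict]) auto
  have law: "distr PM borel Y = density \<nu> (\<lambda>y. ennreal (indicator {y. 1 < y 0} y))"
  proof (rule measure_eqI)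
    fix A assume "A \<in> sets (distr PM borel Y)"
    then have [measurable]: "A \<in> sets borel" by simp
    have "emeasure (distr PM borel Y) A = (\<integral>\<^sup>+ y. indicator A y \<partial>distr PM borel Y)" by simp
    also have "\<dots> = (\<integral>\<^sup>+ p. indicator A (Y p) \<partial>PM)" by (rule nn_integral_distr) measurable
    also have "\<dots> = (\<integral>\<^sup>+ y. indicator A y * indicator {y. 1 < y 0} y \<partial>\<nu>)" by (rule nn_integral_Y) measurable
    also have "\<dots> = emeasure (density \<nu> (\<lambda>y. ennreal (indicator {y. 1 < y 0} y))) A"
      by (subst emeasure_density) (auto simp: ennreal_indicator mult.commute)
    finally show "emeasure (distr PM borel Y) A = \<dots>" .
  qed simp
  have lim: "((\<lambda>u. (\<integral>\<omega>. ?h (\<lambda>j. \<zeta> \<omega> j / u) * indicator {y. 1 < y 0} (\<lambda>j. \<zeta> \<omega> j / u) \<partial>N)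
      / measure N (exceed u)) \<longlongrightarrow> (\<integral>y. ?h y * indicator {y. 1 < y 0} y \<partial>\<nu>)) at_top"
    by (rule ratio_limit, rule conditional_tail_limit[OF J conjunct1[OF f], of C]) (rule C, simp)
  have mean: "(\<integral>y. ?h y * indicator {y. 1 < y 0} y \<partial>\<nu>) = (\<integral>y. ?h y \<partial>distr PM borel Y)"
    unfolding law by (subst integral_density) (auto simp: mult.commute)
  have ev: "eventually (\<lambda>u. (\<integral>\<omega>. ?h (\<lambda>j. \<zeta> \<omega> j / u) * indicator {y. 1 < y 0} (\<lambda>j. \<zeta> \<omega> j / u) \<partial>N)
      / measure N (exceed u)
      = (\<integral>\<omega>. ?h (\<lambda>j. \<zeta> \<omega> j / u) \<partial>uniform_measure N (exceed u))) at_top"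
    using eventually_gt_at_top[of 0] order_tendstoD(1)[OF tail_prob_limit zero_less_one]
  proof eventually_elim
    case (elim u)
    let ?E = "exceed u"
    have pos: "0 < measure N ?E" using elim by (simp add: zero_less_mult_iff)
    have hm [measurable]: "(\<lambda>\<omega>. ?h (\<lambda>j. \<zeta> \<omega> j / u)) \<in> borel_measurable N"
      by (rule measurable_compose[OF zeta_measurable(2)]) measurable
    have "1 / ennreal (measure N ?E) = ennreal (1 / measure N ?E)"
      using pos divide_ennreal[of 1 "measure N ?E"] by simp
    then have "indicator ?E \<omega> / emeasure N ?E = ennreal (indicator ?E \<omega> / measure N ?E)" for \<omega>
      by (simp only: W.emeasure_eq_measure) (simp add: indicator_def)
    then have "uniform_measure N ?E = density N (\<lambda>\<omega>. ennreal (indicator ?E \<omega> / measure N ?E))"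
      by (simp only: uniform_measure_def)
    then have "(\<integral>\<omega>. ?h (\<lambda>j. \<zeta> \<omega> j / u) \<partial>uniform_measure N ?E)
        = (\<integral>\<omega>. (indicator ?E \<omega> / measure N ?E) * ?h (\<lambda>j. \<zeta> \<omega> j / u) \<partial>N)"
      by (simp only:) (subst integral_density, auto)
    also have "\<dots> = (\<integral>\<omega>. (?h (\<lambda>j. \<zeta> \<omega> j / u) * indicator {y. 1 < y 0} (\<lambda>j. \<zeta> \<omega> j / u)) / measure N ?E \<partial>N)"
    proof (rule integral_cong_AE)
      show "AE \<omega> in N. indicator ?E \<omega> / measure N ?E * ?h (\<lambda>j. \<zeta> \<omega> j / u)
          = (?h (\<lambda>j. \<zeta> \<omega> j / u) * indicator {y. 1 < y 0} (\<lambda>j. \<zeta> \<omega> j / u)) / measure N ?E"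
        using AE_exceed[OF elim(1)] AE_space by eventually_elim (simp add: indicator_def)
      show "(\<lambda>\<omega>. (?h (\<lambda>j. \<zeta> \<omega> j / u) * indicator {y. 1 < y 0} (\<lambda>j. \<zeta> \<omega> j / u)) / measure N ?E) \<in> borel_measurable N"
        unfolding indicator_def by measurable
    qed measurable
    finally show ?case by simp
  qed
  from Lim_transform_eventually[OF lim[unfolded mean] ev]
  show "((\<lambda>u. \<integral>\<omega>. f (restrict (\<lambda>j. \<zeta> \<omega> j / u) J) \<partial>uniform_measure N (exceed u))
      \<longlongrightarrow> (\<integral>y. f (restrict y J) \<partial>distr PM borel Y)) at_top" .
qed simp

lemma spectral_tail_process: "has_spectral_tail_process N \<zeta> M \<Theta>"
  unfolding has_spectral_tail_process_def same_law_def
proof (intro exI conjI)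
  let ?\<phi> = "\<lambda>(y :: int \<Rightarrow> real) j. y j / \<bar>y 0\<bar>"
  show "tail_process_law N \<zeta> (distr PM borel Y)" by (rule tail_process)
  have \<phi> [measurable]: "?\<phi> \<in> borel_measurable borel" by (rule measurable_seqI) measurable
  then show "?\<phi> \<in> borel_measurable (distr PM borel Y)" by simp
  show "\<Theta> \<in> borel_measurable M" by simp
  interpret P: prob_space "pareto \<alpha>" by (rule prob_space_pareto[OF \<alpha>_pos])
  show "distr (distr PM borel Y) borel ?\<phi> = distr M borel \<Theta>"
  proof (rule measure_eqI)
    fix A assume "A \<in> sets (distr (distr PM borel Y) borel ?\<phi>)"
    then have A [measurable]: "A \<in> sets borel" by simp
    have m: "(\<lambda>p. indicator A (?\<phi> (Y p)) :: ennreal) \<in> borel_measurable PM"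
      by (rule measurable_compose[OF measurable_Y]) measurable
    have "emeasure (distr (distr PM borel Y) borel ?\<phi>) A
        = (\<integral>\<^sup>+ y. indicator A y \<partial>distr (distr PM borel Y) borel ?\<phi>)" by simp
    also have "\<dots> = (\<integral>\<^sup>+ y. indicator A (?\<phi> y) \<partial>distr PM borel Y)"
      by (rule nn_integral_distr) auto
    also have "\<dots> = (\<integral>\<^sup>+ p. indicator A (?\<phi> (Y p)) \<partial>PM)"
      by (rule nn_integral_distr) measurable
    also have "\<dots> = (\<integral>\<^sup>+ r. (\<integral>\<^sup>+ \<omega>. indicator A (?\<phi> (Y (r, \<omega>))) \<partial>M) \<partial>pareto \<alpha>)"
      by (rule nn_integral_fst[OF m, symmetric])
    also have "\<dots> = (\<integral>\<^sup>+ r. (\<integral>\<^sup>+ \<omega>. indicator A (\<Theta> \<omega>) \<partial>M) \<partial>pareto \<alpha>)"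
    proof (rule nn_integral_cong_AE)
      have "AE r in pareto \<alpha>. 0 < r"
        unfolding pareto_def by (subst AE_density) (auto split: split_indicator)
      then show "AE r in pareto \<alpha>. (\<integral>\<^sup>+ \<omega>. indicator A (?\<phi> (Y (r, \<omega>))) \<partial>M) = (\<integral>\<^sup>+ \<omega>. indicator A (\<Theta> \<omega>) \<partial>M)"
      proof eventually_elim
        case (elim r)
        show ?case
          using \<Theta>_0 by (intro nn_integral_cong_AE) (use elim in \<open>auto elim!: eventually_mono\<close>)
      qed
    qed
    also have "\<dots> = (\<integral>\<^sup>+ \<omega>. indicator A (\<Theta> \<omega>) \<partial>M)" by (simp add: P.emeasure_space_1)
    also have "\<dots> = (\<integral>\<^sup>+ y. indicator A y \<partial>distr M borel \<Theta>)"
      by (rule nn_integral_distr[symmetric]) measurable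
    also have "\<dots> = emeasure (distr M borel \<Theta>) A" by simp
    finally show "emeasure (distr (distr PM borel Y) borel ?\<phi>) A = emeasure (distr M borel \<Theta>) A" .
  qed simp
qed

end

section \<open>The tail measure\<close>

lemma punctured_eq:
  "punctured s t = {x \<in> space (Pi\<^sub>M {s..t} (\<lambda>_. borel :: real measure)). \<exists>j\<in>{s..t}. x j \<noteq> 0}"
proof -
  have "x = restrict (\<lambda>_. 0) {s..t} \<longleftrightarrow> (\<forall>j\<in>{s..t}. x j = 0)" if "x \<in> extensional {s..t}" for x :: "int \<Rightarrow> real"
    using that by (auto simp: extensional_def restrict_def fun_eq_iff)
  then show ?thesis
    unfolding punctured_def by (auto simp: space_PiM PiE_def)
qed

lemma sets_punctured [measurable]: "punctured s t \<in> sets (Pi\<^sub>M {s..t} (\<lambda>_. borel :: real measure))"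
  unfolding punctured_eq by measurable

lemma restrict_in_punctured: "restrict y {s..t} \<in> punctured s t \<longleftrightarrow> (\<exists>j\<in>{s..t}. y j \<noteq> 0)"
  unfolding punctured_eq by (auto simp: space_PiM)

lemma restrict_punctured: "x \<in> punctured s t \<Longrightarrow> restrict x {s..t} = x"
  unfolding punctured_eq by (auto simp: space_PiM PiE_restrict)

text \<open>
  The sum of the moduli of the entries is continuous and positive on the compact set, so it is bounded away from 0.
\<close>

lemma compact_punctured_bound:
  assumes "compact K" "K \<subseteq> punctured s t"
  obtains \<epsilon> where "0 < \<epsilon>" "\<And>y. y \<in> K \<Longrightarrow> \<exists>j\<in>{s..t}. \<epsilon> < \<bar>y j\<bar>"
proof (cases "K = {}")
  case True
  then show ?thesis using that[of 1] by simp
next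
  case False
  let ?J = "{s..t}"
  let ?\<phi> = "\<lambda>y. \<Sum>j\<in>?J. \<bar>y j\<bar>"
  have "continuous_on K ?\<phi>"
    by (intro continuous_intros continuous_on_subset[OF continuous_on_product_coordinates]) simp
  then obtain x where x: "x \<in> K" "\<And>y. y \<in> K \<Longrightarrow> ?\<phi> x \<le> ?\<phi> y"
    using continuous_attains_inf[OF assms(1) False] by blast
  have "\<exists>j\<in>?J. x j \<noteq> 0" using x(1) assms(2) unfolding punctured_eq by auto
  then have pos: "0 < ?\<phi> x" by (auto intro!: sum_pos2)
  \<comment> \<open>One more than the number of entries, to make the final inequality strict.\<close>
  define n where "n = real (card ?J) + 1"
  have n: "0 < n" by (simp add: n_def)
  show ?thesis
  proof (rule that[of "?\<phi> x / n"])
    show "0 < ?\<phi> x / n" using pos n by simp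
    fix y assume y: "y \<in> K"
    show "\<exists>j\<in>?J. ?\<phi> x / n < \<bar>y j\<bar>"
    proof (rule ccontr)
      assume "\<not> (\<exists>j\<in>?J. ?\<phi> x / n < \<bar>y j\<bar>)"
      then have "?\<phi> y \<le> (\<Sum>j\<in>?J. ?\<phi> x / n)" by (intro sum_mono) (auto simp: not_less)
      also have "\<dots> = real (card ?J) * (?\<phi> x / n)" by (rule sum_constant)
      also have "\<dots> < n * (?\<phi> x / n)" using pos n by (intro mult_strict_right_mono) (auto simp: n_def)
      also have "\<dots> = ?\<phi> x" using n by simp
      finally show False using x(2)[OF y] by simp
    qed
  qed
qed

context max_stable_poisson
begin

definition exponent :: "int \<Rightarrow> int \<Rightarrow> (int \<Rightarrow> real) measure" where
  "exponent s t = restrict_space (distr \<nu> (Pi\<^sub>M {s..t} (\<lambda>_. borel)) (\<lambda>y. restrict y {s..t})) (punctured s t)"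

lemma sets_exponent_eq: "sets (exponent s t) = sets (restrict_space (Pi\<^sub>M {s..t} (\<lambda>_. borel)) (punctured s t))"
  unfolding exponent_def by (rule sets_restrict_space_cong) simp

lemma sets_exponentD:
  assumes "A \<in> sets (exponent s t)"
  shows "A \<subseteq> punctured s t" "A \<in> sets (Pi\<^sub>M {s..t} (\<lambda>_. borel))"
  using assms unfolding sets_exponent_eq by (auto simp: sets_restrict_space_iff)

lemma emeasure_exponent:
  assumes "A \<in> sets (exponent s t)"
  shows "emeasure (exponent s t) A = emeasure \<nu> {y. restrict y {s..t} \<in> A}"
proof -
  have "emeasure (exponent s t) A = emeasure (distr \<nu> (Pi\<^sub>M {s..t} (\<lambda>_. borel)) (\<lambda>y. restrict y {s..t})) A"
    unfolding exponent_def using sets_exponentD[OF assms] by (intro emeasure_restrict_space) auto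
  also have "\<dots> = emeasure \<nu> {y. restrict y {s..t} \<in> A}"
    using sets_exponentD(2)[OF assms] by (subst emeasure_distr) (auto simp: vimage_def)
  finally show ?thesis .
qed

lemma sets_preimage_exponent:
  "A \<in> sets (exponent s t) \<Longrightarrow> {y. restrict y {s..t} \<in> A} \<in> sets borel"
  using measurable_sets[OF measurable_restrict_seq sets_exponentD(2)] by (simp add: vimage_def)

lemma exponent_nonzero:
  assumes "s \<le> t"
  shows "emeasure (exponent s t) (space (exponent s t)) \<noteq> 0"
proof -
  let ?S = "space (exponent s t)"
  have space: "?S = punctured s t"
    using sets.sets_into_space[OF sets_punctured[of s t]] by (auto simp: exponent_def space_restrict_space)
  have "emeasure \<nu> {y. 1 < y s} \<le> emeasure \<nu> {y. restrict y {s..t} \<in> ?S}"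
  proof (rule emeasure_mono)
    show "{y. 1 < y s} \<subseteq> {y. restrict y {s..t} \<in> ?S}"
      unfolding space restrict_in_punctured using assms by (auto intro!: bexI[of _ s])
    show "{y. restrict y {s..t} \<in> ?S} \<in> sets \<nu>" using sets_preimage_exponent[OF sets.top] by simp
  qed
  then show ?thesis using emeasure_nu_greater[of 1 s] emeasure_exponent[OF sets.top[of "exponent s t"]] by auto
qed

lemma exponent_finite_compact:
  assumes K: "compact K" "K \<subseteq> punctured s t"
  shows "emeasure (exponent s t) K < top"
proof (cases "K \<in> sets (exponent s t)")
  case True
  obtain \<epsilon> where \<epsilon>: "0 < \<epsilon>" "\<And>y. y \<in> K \<Longrightarrow> \<exists>j\<in>{s..t}. \<epsilon> < \<bar>y j\<bar>"
    using compact_punctured_bound[OF K] by blast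
  have "emeasure (exponent s t) K = emeasure \<nu> {y. restrict y {s..t} \<in> K}" by (rule emeasure_exponent[OF True])
  also have "\<dots> \<le> emeasure \<nu> {y. \<exists>j\<in>{s..t}. \<epsilon> < y j}"
  proof (rule emeasure_mono_AE)
    show "AE y in \<nu>. y \<in> {y. restrict y {s..t} \<in> K} \<longrightarrow> y \<in> {y. \<exists>j\<in>{s..t}. \<epsilon> < y j}"
      using nu_nonneg
    proof eventually_elim
      case (elim y)
      then show ?case using \<epsilon>(2)[of "restrict y {s..t}"] by (auto simp: nonneg_seqs_def)
    qed
  qed measurable
  also have "\<dots> < top" by (rule emeasure_nu_exists_greater_finite) (use \<epsilon> in auto)
  finally show ?thesis .
qed (simp add: emeasure_notin_sets)

lemma exponent_homogeneous:
  assumes c: "0 < c" and A: "A \<in> sets (exponent s t)"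
  shows "emeasure (exponent s t) ((\<lambda>y. restrict (\<lambda>j. c * y j) {s..t}) ` A)
    = ennreal (c powr (- \<alpha>)) * emeasure (exponent s t) A"
proof -
  let ?J = "{s..t}"
  let ?P = "Pi\<^sub>M ?J (\<lambda>_. borel :: real measure)"
  let ?I = "(\<lambda>y. restrict (\<lambda>j. c * y j) ?J) ` A"
  let ?d = "\<lambda>x. restrict (\<lambda>j. inverse c * x j) ?J"
  have inv1: "?d (restrict (\<lambda>j. c * y j) ?J) = y" if "y \<in> A" for y
  proof -
    have "restrict y ?J = y" using that sets_exponentD(1)[OF A] by (intro restrict_punctured) auto
    moreover have "?d (restrict (\<lambda>j. c * y j) ?J) = restrict y ?J"
      using c by (auto simp: restrict_def mult.assoc[symmetric])
    ultimately show ?thesis by simp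
  qed
  have inv2: "restrict (\<lambda>j. c * ?d x j) ?J = restrict x ?J" for x
    using c by (auto simp: restrict_def mult.assoc[symmetric])
  have mem: "restrict y ?J \<in> ?I \<longleftrightarrow> ?d y \<in> A" for y
  proof
    assume "restrict y ?J \<in> ?I"
    then obtain a where a: "a \<in> A" "restrict y ?J = restrict (\<lambda>j. c * a j) ?J" by auto
    have "?d y = ?d (restrict y ?J)" by (auto simp: restrict_def)
    also have "\<dots> = a" unfolding a(2) by (rule inv1[OF a(1)])
    finally show "?d y \<in> A" using a(1) by simp
  next
    assume "?d y \<in> A"
    then show "restrict y ?J \<in> ?I" using inv2[of y] by (metis imageI)
  qed
  have ext: "restrict x ?J = x" if "x \<in> ?I" for x using that by (auto simp: restrict_def)
  have I_eq: "?I = {x \<in> space ?P. ?d x \<in> A}"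
  proof (intro set_eqI iffI)
    fix x assume "x \<in> ?I"
    then show "x \<in> {x \<in> space ?P. ?d x \<in> A}"
      using mem[of x] ext[of x] by (auto simp: space_PiM)
  next
    fix x assume x: "x \<in> {x \<in> space ?P. ?d x \<in> A}"
    then have "restrict x ?J = x" by (auto simp: space_PiM PiE_restrict)
    then show "x \<in> ?I" using mem[of x] x by simp
  qed
  have "?d \<in> ?P \<rightarrow>\<^sub>M ?P" by (rule measurable_restrict) measurable
  from measurable_sets[OF this sets_exponentD(2)[OF A]]
  have I_sets: "?I \<in> sets ?P" unfolding I_eq by (simp add: vimage_def Int_def conj_commute)
  have "?I \<subseteq> punctured s t"
  proof
    fix x assume x: "x \<in> ?I"
    then obtain a where a: "a \<in> A" "x = restrict (\<lambda>j. c * a j) ?J" by auto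
    have "\<exists>j\<in>?J. a j \<noteq> 0" using a(1) sets_exponentD(1)[OF A] unfolding punctured_eq by auto
    then have "\<exists>j\<in>?J. c * a j \<noteq> 0" using c by simp
    then show "x \<in> punctured s t" unfolding a(2) by (simp only: restrict_in_punctured)
  qed
  then have I: "?I \<in> sets (exponent s t)"
    unfolding sets_exponent_eq using I_sets by (subst sets_restrict_space_iff) auto
  have "emeasure (exponent s t) ?I = emeasure \<nu> {y. restrict y ?J \<in> ?I}" by (rule emeasure_exponent[OF I])
  also have "{y. restrict y ?J \<in> ?I} = {y. (\<lambda>i. inverse c * y i) \<in> {y. restrict y ?J \<in> A}}"
    unfolding mem by simp
  also have "emeasure \<nu> \<dots> = ennreal (inverse c powr \<alpha>) * emeasure \<nu> {y. restrict y ?J \<in> A}"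
    using c sets_preimage_exponent[OF A] by (intro emeasure_nu_scale) auto
  also have "inverse c powr \<alpha> = c powr (- \<alpha>)" by (simp add: powr_minus inverse_powr)
  also have "emeasure \<nu> {y. restrict y ?J \<in> A} = emeasure (exponent s t) A" by (rule emeasure_exponent[OF A, symmetric])
  finally show ?thesis .
qed

text \<open>
  A test function is continuous where some entry on \<open>[s,t]\<close> is nonzero and vanishes near the origin by compactness of its support,
  so \<open>tail_limit\<close> applies.
\<close>

lemma exponent_vague_limit:
  fixes f :: "(int \<Rightarrow> real) \<Rightarrow> real"
  assumes cont: "continuous_on (punctured s t) f" and K: "compact K" "K \<subseteq> punctured s t"
    and zero: "\<And>y. y \<notin> K \<Longrightarrow> f y = 0"
  shows "((\<lambda>u. (\<integral>\<omega>. f (restrict (\<lambda>j. \<zeta> \<omega> j / u) {s..t}) \<partial>N) / measure N (exceed u))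
    \<longlongrightarrow> (\<integral>y. f y \<partial>exponent s t)) at_top"
proof -
  let ?J = "{s..t}"
  let ?P = "Pi\<^sub>M ?J (\<lambda>_. borel :: real measure)"
  let ?g = "\<lambda>y. f (restrict y ?J)"
  define U where "U = {y :: int \<Rightarrow> real. \<exists>j\<in>?J. y j \<noteq> 0}"
  obtain \<epsilon> where \<epsilon>: "0 < \<epsilon>" "\<And>y. y \<in> K \<Longrightarrow> \<exists>j\<in>?J. \<epsilon> < \<bar>y j\<bar>"
    using compact_punctured_bound[OF K] by blast
  have "open (\<Union>j\<in>?J. {y :: int \<Rightarrow> real. y j \<noteq> 0})"
    by (intro open_UN ballI open_Collect_neq continuous_on_const continuous_on_product_coordinates)
  also have "(\<Union>j\<in>?J. {y :: int \<Rightarrow> real. y j \<noteq> 0}) = U" by (auto simp: U_def)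
  finally have U: "open U" .
  have cg: "continuous_on U ?g"
  proof (rule continuous_on_compose2[OF cont continuous_on_restrict])
    show "(\<lambda>y. restrict y ?J) ` U \<subseteq> punctured s t"
      unfolding U_def using restrict_in_punctured by blast
  qed
  have g0: "?g y = 0" if "y \<notin> U" for y
    using that K(2) restrict_in_punctured[of y s t] by (intro zero) (auto simp: U_def)
  have "(\<lambda>y. indicator U y *\<^sub>R ?g y) \<in> borel_measurable borel"
    using U cg by (intro borel_measurable_continuous_on_indicator) auto
  also have "(\<lambda>y. indicator U y *\<^sub>R ?g y) = ?g"
  proof
    show "indicator U y *\<^sub>R ?g y = ?g y" for y using g0[of y] by (cases "y \<in> U") auto
  qed
  finally have gm [measurable]: "?g \<in> borel_measurable borel" .
  have "bounded (f ` K)"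
    using K continuous_on_subset[OF cont K(2)] by (intro compact_imp_bounded compact_continuous_image)
  then obtain C where C: "\<And>y. y \<in> K \<Longrightarrow> \<bar>f y\<bar> \<le> C" by (auto simp: bounded_iff)
  have bdd: "\<bar>?g y\<bar> \<le> max 0 C" for y
    using C[of "restrict y ?J"] zero[of "restrict y ?J"] by (cases "restrict y ?J \<in> K") auto
  have van: "?g y = 0" if "\<And>j. j \<in> ?J \<Longrightarrow> \<bar>y j\<bar> \<le> \<epsilon>" for y
  proof (rule zero, rule notI)
    assume "restrict y ?J \<in> K"
    from \<epsilon>(2)[OF this] that show False by (auto simp: not_less[symmetric])
  qed
  have dep: "?g w = ?g w'" if "\<And>j. j \<in> ?J \<Longrightarrow> w j = w' j" for w w'
    using that by (intro arg_cong[where f = f]) (auto simp: restrict_def)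
  have "((\<lambda>u. u powr \<alpha> * (\<integral>\<omega>. ?g (\<lambda>j. \<zeta> \<omega> j / u) \<partial>N)) \<longlongrightarrow> (\<integral>y. ?g y \<partial>\<nu>)) at_top"
  proof (rule tail_limit[OF _ \<epsilon>(1) gm bdd van])
    show "AE y in \<nu>. (\<exists>j\<in>?J. y j \<noteq> 0) \<longrightarrow> box_continuous ?g ?J y"
    proof (intro AE_I2 impI)
      fix y :: "int \<Rightarrow> real" assume "\<exists>j\<in>?J. y j \<noteq> 0"
      then show "box_continuous ?g ?J y"
        by (intro continuous_box[OF _ dep U _ cg]) (auto simp: U_def)
    qed
  qed auto
  then have "((\<lambda>u. (\<integral>\<omega>. ?g (\<lambda>j. \<zeta> \<omega> j / u) \<partial>N) / measure N (exceed u))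
      \<longlongrightarrow> (\<integral>y. ?g y \<partial>\<nu>)) at_top"
    by (rule ratio_limit)
  moreover have "(\<integral>y. f y \<partial>exponent s t) = (\<integral>y. ?g y \<partial>\<nu>)"
  proof -
    have "(\<integral>y. f y \<partial>exponent s t)
        = (\<integral>x. indicator (punctured s t) x *\<^sub>R f x \<partial>distr \<nu> ?P (\<lambda>y. restrict y ?J))"
      unfolding exponent_def by (rule integral_restrict_space) auto
    also have "\<dots> = (\<integral>y. indicator (punctured s t) (restrict y ?J) *\<^sub>R ?g y \<partial>\<nu>)"
    proof (rule integral_distr)
      have "?g \<in> borel_measurable ?P" by (rule measurable_compose[OF measurable_embed_seq gm])
      then have "(\<lambda>x. indicator (punctured s t) x *\<^sub>R ?g x) \<in> borel_measurable ?P" by measurable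
      also have "(\<lambda>x. indicator (punctured s t) x *\<^sub>R ?g x) = (\<lambda>x. indicator (punctured s t) x *\<^sub>R f x)"
        using restrict_punctured[of _ s t] by (auto simp: indicator_def)
      finally show "(\<lambda>x. indicator (punctured s t) x *\<^sub>R f x) \<in> borel_measurable ?P" .
    qed simp
    also have "\<dots> = (\<integral>y. ?g y \<partial>\<nu>)"
      using g0 by (intro Bochner_Integration.integral_cong) (auto simp: indicator_def restrict_in_punctured U_def)
    finally show ?thesis .
  qed
  ultimately show ?thesis by simp
qed

lemma exponent_measure_exponent:
  assumes "s \<le> t"
  shows "exponent_measure \<alpha> N \<zeta> s t (exponent s t)"
  unfolding exponent_measure_def
proof (intro conjI)
  show "\<forall>f :: (int \<Rightarrow> real) \<Rightarrow> real. \<forall>K.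
      continuous_on (punctured s t) f \<and> compact K \<and> K \<subseteq> punctured s t \<and> (\<forall>y. y \<notin> K \<longrightarrow> f y = 0) \<longrightarrow>
      ((\<lambda>u. (\<integral>\<omega>. f (restrict (\<lambda>j. \<zeta> \<omega> j / u) {s..t}) \<partial>N) / measure N (exceed u))
        \<longlongrightarrow> (\<integral>y. f y \<partial>exponent s t)) at_top"
    by (intro allI impI, elim conjE, rule exponent_vague_limit) auto
  show "\<forall>K. compact K \<and> K \<subseteq> punctured s t \<longrightarrow> emeasure (exponent s t) K < top"
    by (intro allI impI, elim conjE, rule exponent_finite_compact)
  show "\<forall>c>0. \<forall>A\<in>sets (exponent s t). emeasure (exponent s t) ((\<lambda>y. restrict (\<lambda>j. c * y j) {s..t}) ` A)
      = ennreal (c powr (- \<alpha>)) * emeasure (exponent s t) A"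
    by (intro allI impI ballI exponent_homogeneous)
qed (rule sets_exponent_eq exponent_nonzero[OF assms])+

lemma tail_measure: "has_tail_measure \<alpha> N \<zeta> \<nu>"
  unfolding has_tail_measure_def
proof (intro conjI allI impI)
  fix s t :: int assume "s \<le> t"
  then show "\<exists>\<mu>. exponent_measure \<alpha> N \<zeta> s t \<mu> \<and>
      (\<forall>A\<in>sets \<mu>. emeasure \<nu> {y. restrict y {s..t} \<in> A} = emeasure \<mu> A)"
    by (intro exI[of _ "exponent s t"]) (simp add: exponent_measure_exponent emeasure_exponent)
qed (simp_all add: nu_zero)

end

section \<open>The max-stable process of a spectral tail process\<close>

theorem theorem5p1:
  fixes \<alpha> :: real
    and M :: "'a measure" and \<Theta> :: "'a \<Rightarrow> int \<Rightarrow> real"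
    and N :: "'b measure" and W :: "nat \<Rightarrow> 'b \<Rightarrow> int \<Rightarrow> real"
    and K :: "'c measure" and P :: "nat \<Rightarrow> 'c \<Rightarrow> real" and T :: "nat \<Rightarrow> 'c \<Rightarrow> int"
    and Q :: "nat \<Rightarrow> 'c \<Rightarrow> int \<Rightarrow> real"
  assumes "0 < \<alpha>"
    and "prob_space M"
    and "\<Theta> \<in> borel_measurable M"
    and "AE \<omega> in M. \<forall>j. 0 \<le> \<Theta> \<omega> j"
    and "AE \<omega> in M. \<Theta> \<omega> 0 = 1"
    and "AE \<omega> in M. (\<Theta> \<omega> \<longlongrightarrow> 0) at_top \<and> (\<Theta> \<omega> \<longlongrightarrow> 0) at_bot"
    and time_change: "\<And>k (H :: (int \<Rightarrow> real) \<Rightarrow> ennreal). H \<in> borel_measurable borel \<Longrightarrow>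
      (\<integral>\<^sup>+ \<omega>. H (backshift k (\<Theta> \<omega>)) * indicator {\<omega>. \<Theta> \<omega> (- k) \<noteq> 0} \<omega> \<partial>M)
      = (\<integral>\<^sup>+ \<omega>. (if \<Theta> \<omega> k = 0 then 0
               else H (\<lambda>j. inverse (\<Theta> \<omega> k) * \<Theta> \<omega> j) * ennreal (\<Theta> \<omega> k powr \<alpha>)) \<partial>M)"
  shows "sigma_finite_measure (nu \<alpha> M \<Theta>)
    \<and> emeasure (nu \<alpha> M \<Theta>) {\<lambda>_. 0} = 0
    \<and> homogeneous \<alpha> (nu \<alpha> M \<Theta>)
    \<and> shift_invariant (nu \<alpha> M \<Theta>)
    \<and> 0 < candidate_theta M \<Theta>
    \<and> (poisson_point_process N W (restrict_space (nu \<alpha> M \<Theta>) nonneg_seqs) \<longrightarrow>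
         ae_finite_max N W
       \<and> stationary N (max_process W)
       \<and> has_tail_measure \<alpha> N (max_process W) (nu \<alpha> M \<Theta>)
       \<and> has_spectral_tail_process N (max_process W) M \<Theta>
       \<and> has_extremal_index \<alpha> N (max_process W) (candidate_theta M \<Theta>)
       \<and> (M3_ingredients \<alpha> (candidate_theta M \<Theta>) (Q_law \<alpha> M \<Theta>) K P T Q \<longrightarrow>
            ae_finite_max K (M3_terms P T Q)
          \<and> same_law N (max_process W) K (max_process (M3_terms P T Q))))"
proof -
  interpret tail_spectrum M \<alpha> \<Theta>
    by (intro tail_spectrum.intro tail_spectrum_axioms.intro) (fact assms)+
  have poisson: "ae_finite_max N W
       \<and> stationary N (max_process W)
       \<and> has_tail_measure \<alpha> N (max_process W) (nu \<alpha> M \<Theta>)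
       \<and> has_spectral_tail_process N (max_process W) M \<Theta>
       \<and> has_extremal_index \<alpha> N (max_process W) (candidate_theta M \<Theta>)
       \<and> (M3_ingredients \<alpha> (candidate_theta M \<Theta>) (Q_law \<alpha> M \<Theta>) K P T Q \<longrightarrow>
            ae_finite_max K (M3_terms P T Q)
          \<and> same_law N (max_process W) K (max_process (M3_terms P T Q)))"
    if "poisson_point_process N W (restrict_space (nu \<alpha> M \<Theta>) nonneg_seqs)"
  proof -
    interpret max_stable_poisson M \<alpha> \<Theta> N W by standard (fact that)
    show ?thesis
    proof (intro conjI impI)
      show "ae_finite_max N W" by (rule Z.ae_finite_max)
      show "stationary N (max_process W)" by (rule Z.stationary_X) (rule distr_nu_backshift)
      show "has_tail_measure \<alpha> N (max_process W) (nu \<alpha> M \<Theta>)" by (rule tail_measure)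
      show "has_spectral_tail_process N (max_process W) M \<Theta>" by (rule spectral_tail_process)
      show "has_extremal_index \<alpha> N (max_process W) (candidate_theta M \<Theta>)"
        by (rule extremal_index) (rule Z.max_stable_points_axioms)
    next
      assume "M3_ingredients \<alpha> (candidate_theta M \<Theta>) (Q_law \<alpha> M \<Theta>) K P T Q"
      then have M3: "max_stable_points K (M3_terms P T Q) \<alpha> (nu \<alpha> M \<Theta>)" by (rule max_stable_points_M3)
      show "ae_finite_max K (M3_terms P T Q)" by (rule max_stable_points.ae_finite_max[OF M3])
      show "same_law N (max_process W) K (max_process (M3_terms P T Q))"
        by (rule max_process_same_law[OF Z.max_stable_points_axioms M3])
    qed
  qed
  show ?thesis
    using sigma_finite_nu nu_zero homogeneous_nu distr_nu_backshift[of 1] candidate_theta_pos poisson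
    unfolding shift_invariant_def by blast
qed

end
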